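(* Let $(\Omega,\mathbb P)$ be a non purely atomic probability space and $\Psi$ an Orlicz function (with the standing assumptions below) whose complementary function $\Phi$ satisfies the $\Delta_2$ condition. Then the Orlicz space $L^\Psi(\Omega,\mathbb P)$ has Pe{\l}czy\'nski's property $(V)$.
   Context: An Orlicz function is a non-decreasing convex $\Psi\colon[0,\infty]\to[0,\infty]$ with $\Psi(0)=0$, $\Psi(\infty)=\infty$; it is assumed moreover continuous at $0$, strictly convex, and with $\Psi(x)/x\to\infty$ as $x\to\infty$. $L^\Psi(\Omega)$ is the space of (classes of) measurable $f\colon\Omega\to\mathbb C$ such that $\int_\Omega\Psi(|f|/C)\,d\mathbb P<\infty$ for some $C>0$, with the Luxemburg norm $\|f\|_\Psi=\inf\{C>0:\int_\Omega\Psi(|f|/C)\,d\mathbb P\le1\}$. The complementary function is $\Phi(x)=\sup_{y\ge0}(xy-\Psi(y))$. A function $\Phi$ satisfies $\Delta_2$ if there are $K>0$, $x_0>0$ with $\Phi(2x)\le K\Phi(x)$ for all $x\ge x_0$. A Banach space $X$ has Pe{\l}czy\'nski's property $(V)$ if for every Banach space $Z$ and every non-weakly compact operator $T\colon X\to Z$ there is a subspace $X_0\subseteq X$ isomorphic to $c_0$ such that $T|_{X_0}$ is an isomorphism onto $T(X_0)$ (equivalently: every subset $A\subseteq X^\ast$ with $\lim_n\sup_{x^\ast\in A}|x^\ast(x_n)|=0$ for all weakly unconditionally Cauchy sequences $(x_n)$ in $X$ is relatively weakly compact). *)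

theory Defs
  imports "HOL-Analysis.Analysis" "HOL-Probability.Probability"
begin

definition strictly_convex_on :: "real set \<Rightarrow> (real \<Rightarrow> real) \<Rightarrow> bool" where
  "strictly_convex_on S f \<longleftrightarrow> convex S \<and>
     (\<forall>x\<in>S. \<forall>y\<in>S. \<forall>t. x \<noteq> y \<and> 0 < t \<and> t < 1 \<longrightarrow>
        f (t * x + (1 - t) * y) < t * f x + (1 - t) * f y)"

(* Orlicz function with the standing assumptions.  Psi is given by its (necessarily
   finite, by strict convexity) values on [0,\<infinity>); Psi(\<infinity>)=\<infinity> is implicit. *)
definition orlicz_function :: "(real \<Rightarrow> real) \<Rightarrow> bool" where
  "orlicz_function \<Psi> \<longleftrightarrow>
     mono_on {0..} \<Psi> \<and> convex_on {0..} \<Psi> \<and> \<Psi> 0 = 0 \<and>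
     continuous (at_right 0) \<Psi> \<and>
     strictly_convex_on {0..} \<Psi> \<and>
     filterlim (\<lambda>x. \<Psi> x / x) at_top at_top"

definition complementary :: "(real \<Rightarrow> real) \<Rightarrow> real \<Rightarrow> real" where
  "complementary \<Psi> x = (SUP y\<in>{0..}. x * y - \<Psi> y)"

definition Delta2 :: "(real \<Rightarrow> real) \<Rightarrow> bool" where
  "Delta2 \<Phi> \<longleftrightarrow> (\<exists>K>0. \<exists>x0>0. \<forall>x\<ge>x0. \<Phi> (2 * x) \<le> K * \<Phi> x)"

definition is_atom :: "'a measure \<Rightarrow> 'a set \<Rightarrow> bool" where
  "is_atom M B \<longleftrightarrow> B \<in> sets M \<and> measure M B > 0 \<and>
     (\<forall>C\<in>sets M. C \<subseteq> B \<longrightarrow> measure M C = 0 \<or> measure M C = measure M B)"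

definition purely_atomic :: "'a measure \<Rightarrow> bool" where
  "purely_atomic M \<longleftrightarrow>
     (\<forall>A\<in>sets M. measure M A > 0 \<longrightarrow> (\<exists>B. B \<subseteq> A \<and> is_atom M B))"

definition orlicz_space :: "'a measure \<Rightarrow> (real \<Rightarrow> real) \<Rightarrow> ('a \<Rightarrow> complex) set" where
  "orlicz_space M \<Psi> = {f \<in> borel_measurable M.
     \<exists>C>0. (\<integral>\<^sup>+ \<omega>. ennreal (\<Psi> (cmod (f \<omega>) / C)) \<partial>M) < \<infinity>}"

definition luxemburg_norm :: "'a measure \<Rightarrow> (real \<Rightarrow> real) \<Rightarrow> ('a \<Rightarrow> complex) \<Rightarrow> real" where
  "luxemburg_norm M \<Psi> f = Inf {C. C > 0 \<and>
     (\<integral>\<^sup>+ \<omega>. ennreal (\<Psi> (cmod (f \<omega>) / C)) \<partial>M) \<le> 1}"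

(* Dual space of a (semi)normed complex function space given by carrier X and norm N:
   bounded complex-linear functionals, vanishing off X (to make them unique). *)
definition dual_space :: "('v \<Rightarrow> complex) set \<Rightarrow> (('v \<Rightarrow> complex) \<Rightarrow> real)
                          \<Rightarrow> (('v \<Rightarrow> complex) \<Rightarrow> complex) set" where
  "dual_space X N = {g.
     (\<forall>f\<in>X. \<forall>h\<in>X. g (\<lambda>\<omega>. f \<omega> + h \<omega>) = g f + g h) \<and>
     (\<forall>c. \<forall>f\<in>X. g (\<lambda>\<omega>. c * f \<omega>) = c * g f) \<and>
     (\<exists>B. \<forall>f\<in>X. cmod (g f) \<le> B * N f) \<and>
     (\<forall>f. f \<notin> X \<longrightarrow> g f = 0)}"

definition dual_norm :: "('v \<Rightarrow> complex) set \<Rightarrow> (('v \<Rightarrow> complex) \<Rightarrow> real)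
                          \<Rightarrow> (('v \<Rightarrow> complex) \<Rightarrow> complex) \<Rightarrow> real" where
  "dual_norm X N g = Inf {B. B \<ge> 0 \<and> (\<forall>f\<in>X. cmod (g f) \<le> B * N f)}"

definition bidual_space :: "('v \<Rightarrow> complex) set \<Rightarrow> (('v \<Rightarrow> complex) \<Rightarrow> real)
                          \<Rightarrow> ((('v \<Rightarrow> complex) \<Rightarrow> complex) \<Rightarrow> complex) set" where
  "bidual_space X N = {\<phi>.
     (\<forall>g\<in>dual_space X N. \<forall>h\<in>dual_space X N. \<phi> (\<lambda>f. g f + h f) = \<phi> g + \<phi> h) \<and>
     (\<forall>c. \<forall>g\<in>dual_space X N. \<phi> (\<lambda>f. c * g f) = c * \<phi> g) \<and>
     (\<exists>B. \<forall>g\<in>dual_space X N. cmod (\<phi> g) \<le> B * dual_norm X N g)}"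

definition weak_topology_dual :: "('v \<Rightarrow> complex) set \<Rightarrow> (('v \<Rightarrow> complex) \<Rightarrow> real)
                          \<Rightarrow> (('v \<Rightarrow> complex) \<Rightarrow> complex) topology" where
  "weak_topology_dual X N = subtopology
     (topology_generated_by {{g. \<phi> g \<in> U} | \<phi> U. \<phi> \<in> bidual_space X N \<and> open U})
     (dual_space X N)"

definition rel_weakly_compact_dual :: "('v \<Rightarrow> complex) set \<Rightarrow> (('v \<Rightarrow> complex) \<Rightarrow> real)
                          \<Rightarrow> (('v \<Rightarrow> complex) \<Rightarrow> complex) set \<Rightarrow> bool" where
  "rel_weakly_compact_dual X N A \<longleftrightarrow>
     compactin (weak_topology_dual X N) (weak_topology_dual X N closure_of A)"

definition wuc_sequence :: "('v \<Rightarrow> complex) set \<Rightarrow> (('v \<Rightarrow> complex) \<Rightarrow> real)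
                          \<Rightarrow> (nat \<Rightarrow> ('v \<Rightarrow> complex)) \<Rightarrow> bool" where
  "wuc_sequence X N x \<longleftrightarrow> (\<forall>n. x n \<in> X) \<and>
     (\<forall>g\<in>dual_space X N. summable (\<lambda>n. cmod (g (x n))))"

(* Pelczynski's property (V), dual formulation:
   every A in the dual with lim_n sup_{x*\<in>A} |x*(x_n)| = 0 for all WUC (x_n)
   is relatively weakly compact. *)
definition property_V :: "('v \<Rightarrow> complex) set \<Rightarrow> (('v \<Rightarrow> complex) \<Rightarrow> real) \<Rightarrow> bool" where
  "property_V X N \<longleftrightarrow>
     (\<forall>A \<subseteq> dual_space X N.
        (\<forall>x. wuc_sequence X N x \<longrightarrow>
           (\<forall>\<epsilon>>0. \<exists>n0. \<forall>n\<ge>n0. \<forall>g\<in>A. cmod (g (x n)) \<le> \<epsilon>))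
        \<longrightarrow> rel_weakly_compact_dual X N A)"

end

(* Let A be a subset of the dual on which weakly unconditionally Cauchy (wuc) sequences
   converge uniformly to 0.  If A were not relatively weakly compact, Helly's lemma would
   produce functions f_m in a ball of L^Psi and functionals h_n, differences of elements of
   A and a fixed functional, for which the two iterated limits of h_n(f_m) differ.
   This is impossible once some convex combinations of tails of (f_m) are Cauchy, up to a
   small error, uniformly in n.  They are found as follows.
   (1) Delta_2 for Phi makes Psi equivalent at infinity to a uniformly convex Q.  Convex
   combinations almost minimising the integral of Q(|f|) differ by a function of small norm
   plus one of small modular.
   (2) By the wuc condition, functions of small modular that exceed a suitable x in L^Psi on
   their support are uniformly small on A.
   (3) What remains lies in an order interval [-x, x].  There a Hilbert space minimisation,
   weighted by a functional that dominates all |h_n|, gives further convex combinations, and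
   the wuc condition for monotone order bounded sequences makes them Cauchy uniformly in n. *)

theory Submission
  imports Defs
begin

text \<open>\<open>\<Psi>\<close> itself may fail Delta_2. In that case the norm is not order
  continuous, some functionals on the space are not given by integration, and a small modular does
  not force a small norm. So there is no integral representation to lean on: functionals enter only
  through their lattice modulus, and order continuity, uniform over the set, is extracted from the
  wuc condition itself. The double limit reduces the set to a sequence h_n, for which the sum of
  2^-n |h_n| is a single dominating positive functional. Smallness for that functional is not
  uniform in n; this gap is what the monotone order bounded sequences have to close. All convex
  combinations are iterated midpoints. Both minimisations use only the defect at a midpoint, and one
  tree can be evaluated in the functions f_m and in the numbers h_n(f_m) alike. Trees whose leaves
  lie beyond k preserve the limit in m for every n below k, and a single tree preserves the limit in
  n.\<close>

section \<open>Solid seminormed function spaces and their duals\<close>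

text \<open>Elements are functions, not classes, and \<open>N\<close> is only a seminorm: order
  relations can then be pointwise, and null sets never enter the lattice arguments.\<close>

locale function_lattice =
  fixes M :: "'a measure" and X :: "('a \<Rightarrow> complex) set" and N :: "('a \<Rightarrow> complex) \<Rightarrow> real"
  assumes X_meas: "f \<in> X \<Longrightarrow> f \<in> borel_measurable M"
    and X_zero: "(\<lambda>_. 0) \<in> X"
    and X_add: "f \<in> X \<Longrightarrow> g \<in> X \<Longrightarrow> (\<lambda>\<omega>. f \<omega> + g \<omega>) \<in> X"
    and X_cmult: "f \<in> X \<Longrightarrow> (\<lambda>\<omega>. c * f \<omega>) \<in> X"
    and N_add: "f \<in> X \<Longrightarrow> g \<in> X \<Longrightarrow> N (\<lambda>\<omega>. f \<omega> + g \<omega>) \<le> N f + N g"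
    and N_cmult: "f \<in> X \<Longrightarrow> N (\<lambda>\<omega>. c * f \<omega>) = cmod c * N f"
    and X_solid: "f \<in> X \<Longrightarrow> g \<in> borel_measurable M \<Longrightarrow> (\<And>\<omega>. cmod (g \<omega>) \<le> cmod (f \<omega>)) \<Longrightarrow> g \<in> X"
    and N_solid: "f \<in> X \<Longrightarrow> g \<in> borel_measurable M \<Longrightarrow> (\<And>\<omega>. cmod (g \<omega>) \<le> cmod (f \<omega>)) \<Longrightarrow> N g \<le> N f"
begin

abbreviation dual :: "(('a \<Rightarrow> complex) \<Rightarrow> complex) set" where
  "dual \<equiv> dual_space X N"

abbreviation dnorm :: "(('a \<Rightarrow> complex) \<Rightarrow> complex) \<Rightarrow> real" where
  "dnorm \<equiv> dual_norm X N"

abbreviation bidual :: "((('a \<Rightarrow> complex) \<Rightarrow> complex) \<Rightarrow> complex) set" where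
  "bidual \<equiv> bidual_space X N"

lemma N_zero: "N (\<lambda>_. 0) = 0"
  using N_cmult[OF X_zero, of 0] by simp

lemma N_nonneg: "f \<in> X \<Longrightarrow> 0 \<le> N f"
proof -
  assume f: "f \<in> X"
  have "N (\<lambda>\<omega>. f \<omega> + (-1) * f \<omega>) \<le> N f + N (\<lambda>\<omega>. (-1) * f \<omega>)"
    using f X_cmult[OF f, of "-1"] by (intro N_add)
  then show ?thesis using N_cmult[OF f, of "-1"] N_zero by simp
qed

lemma X_diff: "f \<in> X \<Longrightarrow> g \<in> X \<Longrightarrow> (\<lambda>\<omega>. f \<omega> - g \<omega>) \<in> X"
  using X_add[of f "\<lambda>\<omega>. (-1) * g \<omega>"] X_cmult[of g "-1"] by simp

lemma X_sum: "(\<And>i. i \<in> I \<Longrightarrow> f i \<in> X) \<Longrightarrow> (\<lambda>\<omega>. \<Sum>i\<in>I. f i \<omega>) \<in> X"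
  by (induction I rule: infinite_finite_induct) (auto simp: X_zero X_add)

lemma dual_add: "g \<in> dual \<Longrightarrow> f \<in> X \<Longrightarrow> h \<in> X \<Longrightarrow> g (\<lambda>\<omega>. f \<omega> + h \<omega>) = g f + g h"
  by (auto simp: dual_space_def)

lemma dual_cmult: "g \<in> dual \<Longrightarrow> f \<in> X \<Longrightarrow> g (\<lambda>\<omega>. c * f \<omega>) = c * g f"
  by (auto simp: dual_space_def)

lemma dual_zero: "g \<in> dual \<Longrightarrow> g (\<lambda>_. 0) = 0"
  using dual_cmult[OF _ X_zero, of g 0] by simp

lemma dual_diff: "g \<in> dual \<Longrightarrow> f \<in> X \<Longrightarrow> h \<in> X \<Longrightarrow> g (\<lambda>\<omega>. f \<omega> - h \<omega>) = g f - g h"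
  using dual_add[of g f "\<lambda>\<omega>. (-1) * h \<omega>"] X_cmult[of h "-1"] dual_cmult[of g h "-1"] by simp

lemma dual_sum: "g \<in> dual \<Longrightarrow> (\<And>i. i \<in> I \<Longrightarrow> f i \<in> X) \<Longrightarrow> g (\<lambda>\<omega>. \<Sum>i\<in>I. f i \<omega>) = (\<Sum>i\<in>I. g (f i))"
proof (induction I rule: infinite_finite_induct)
  case (insert x F)
  then show ?case using dual_add[of g "f x" "\<lambda>\<omega>. \<Sum>i\<in>F. f i \<omega>"] X_sum[of F f] by simp
qed (auto simp: dual_zero)

lemma dual_bounded_pos:
  assumes "g \<in> dual"
  obtains B where "B \<ge> 0" "\<And>f. f \<in> X \<Longrightarrow> cmod (g f) \<le> B * N f"
proof -
  from assms obtain B where B: "\<And>f. f \<in> X \<Longrightarrow> cmod (g f) \<le> B * N f" unfolding dual_space_def by blast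
  have "cmod (g f) \<le> max B 0 * N f" if "f \<in> X" for f
    using B[OF that] mult_right_mono[OF max.cobounded1[of B 0] N_nonneg[OF that]] by linarith
  then show ?thesis using that[of "max B 0"] by auto
qed

lemma dnorm_bounds_nonempty:
  assumes "g \<in> dual" shows "{B. B \<ge> 0 \<and> (\<forall>f\<in>X. cmod (g f) \<le> B * N f)} \<noteq> {}"
proof -
  from assms obtain B where "B \<ge> 0" "\<And>f. f \<in> X \<Longrightarrow> cmod (g f) \<le> B * N f" by (rule dual_bounded_pos) blast
  then show ?thesis by blast
qed

lemma dnorm_nonneg: "g \<in> dual \<Longrightarrow> 0 \<le> dnorm g"
  unfolding dual_norm_def by (rule cInf_greatest[OF dnorm_bounds_nonempty]) auto

lemma dnorm_le: "B \<ge> 0 \<Longrightarrow> (\<And>f. f \<in> X \<Longrightarrow> cmod (g f) \<le> B * N f) \<Longrightarrow> dnorm g \<le> B"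
  unfolding dual_norm_def by (rule cInf_lower) (auto intro!: bdd_belowI[of _ 0])

lemma dnorm_bound:
  assumes "g \<in> dual" "f \<in> X"
  shows "cmod (g f) \<le> dnorm g * N f"
proof (cases "N f = 0")
  case True
  \<comment> \<open>A seminorm may vanish at \<open>f\<close>; any admissible bound then already
    gives \<open>g f = 0\<close>.\<close>
  obtain B where "\<And>f. f \<in> X \<Longrightarrow> cmod (g f) \<le> B * N f" using dual_bounded_pos[OF assms(1)] by blast
  from this[OF assms(2)] True show ?thesis by simp
next
  case False
  then have pos: "N f > 0" using N_nonneg[OF assms(2)] by simp
  have "cmod (g f) / N f \<le> dnorm g"
    unfolding dual_norm_def
  proof (rule cInf_greatest[OF dnorm_bounds_nonempty[OF assms(1)]])
  qed (use pos assms(2) in \<open>auto simp: divide_le_eq\<close>)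
  then show ?thesis using pos by (simp add: divide_le_eq)
qed

lemma dualI:
  assumes "\<And>f h. f \<in> X \<Longrightarrow> h \<in> X \<Longrightarrow> g (\<lambda>\<omega>. f \<omega> + h \<omega>) = g f + g h"
    and "\<And>c f. f \<in> X \<Longrightarrow> g (\<lambda>\<omega>. c * f \<omega>) = c * g f"
    and "\<And>f. f \<in> X \<Longrightarrow> cmod (g f) \<le> B * N f"
    and "\<And>f. f \<notin> X \<Longrightarrow> g f = 0"
  shows "g \<in> dual"
  using assms unfolding dual_space_def by blast

lemma dual_off: "g \<in> dual \<Longrightarrow> f \<notin> X \<Longrightarrow> g f = 0"
  by (auto simp: dual_space_def)

lemma dual_add_mem: assumes "g \<in> dual" "h \<in> dual" shows "(\<lambda>f. g f + h f) \<in> dual"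
proof (rule dualI[where B = "dnorm g + dnorm h"])
  show "cmod (g f + h f) \<le> (dnorm g + dnorm h) * N f" if "f \<in> X" for f
    using dnorm_bound[OF assms(1) that] dnorm_bound[OF assms(2) that] norm_triangle_ineq[of "g f" "h f"]
    by (simp add: distrib_right)
qed (use assms in \<open>auto simp: dual_add dual_cmult dual_off algebra_simps\<close>)

lemma dual_cmult_mem: assumes "g \<in> dual" shows "(\<lambda>f. c * g f) \<in> dual"
proof (rule dualI[where B = "cmod c * dnorm g"])
  show "cmod (c * g f) \<le> cmod c * dnorm g * N f" if "f \<in> X" for f
    using dnorm_bound[OF assms(1) that] by (simp add: norm_mult mult.assoc mult_left_mono)
qed (use assms in \<open>auto simp: dual_add dual_cmult dual_off algebra_simps\<close>)

lemma dual_zero_mem: "(\<lambda>_. 0) \<in> dual"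
  by (rule dualI[where B = 0]) auto

lemma dual_diff_mem: "g \<in> dual \<Longrightarrow> h \<in> dual \<Longrightarrow> (\<lambda>f. g f - h f) \<in> dual"
  using dual_add_mem[of g "\<lambda>f. (-1) * h f"] dual_cmult_mem[of h "-1"] by simp

lemma dual_sum_mem: "(\<And>i. i \<in> I \<Longrightarrow> g i \<in> dual) \<Longrightarrow> (\<lambda>f. \<Sum>i\<in>I. g i f) \<in> dual"
  by (induction I rule: infinite_finite_induct) (auto simp: dual_zero_mem dual_add_mem)

lemma bidual_add: "\<phi> \<in> bidual \<Longrightarrow> g \<in> dual \<Longrightarrow> h \<in> dual \<Longrightarrow> \<phi> (\<lambda>f. g f + h f) = \<phi> g + \<phi> h"
  by (auto simp: bidual_space_def)

lemma bidual_cmult: "\<phi> \<in> bidual \<Longrightarrow> g \<in> dual \<Longrightarrow> \<phi> (\<lambda>f. c * g f) = c * \<phi> g"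
  by (auto simp: bidual_space_def)

lemma bidual_sum: "\<phi> \<in> bidual \<Longrightarrow> (\<And>i. i \<in> I \<Longrightarrow> g i \<in> dual) \<Longrightarrow> \<phi> (\<lambda>f. \<Sum>i\<in>I. g i f) = (\<Sum>i\<in>I. \<phi> (g i))"
proof (induction I rule: infinite_finite_induct)
  case (insert x F)
  then show ?case using bidual_add[of \<phi> "g x" "\<lambda>f. \<Sum>i\<in>F. g i f"] dual_sum_mem[of F g] by simp
qed (use bidual_cmult[OF _ dual_zero_mem, of \<phi> 0] in auto)

lemma eval_bidual: assumes "f \<in> X" shows "(\<lambda>g. g f) \<in> bidual"
  unfolding bidual_space_def
proof (intro CollectI conjI ballI allI)
  show "\<exists>B. \<forall>g\<in>dual. cmod (g f) \<le> B * dnorm g"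
    using dnorm_bound[OF _ assms] by (intro exI[of _ "N f"]) (auto simp: mult.commute)
qed auto

text \<open>Helly's lemma by least squares: at an almost minimiser \<open>f\<close> of the squared error on the ball,
  the first order condition compares \<open>\<phi>\<close> with the functional \<open>H\<close> whose coefficients are
  the conjugated errors.\<close>

lemma helly:
  assumes \<phi>: "\<phi> \<in> bidual" and R: "R > 0" "\<And>g. g \<in> dual \<Longrightarrow> cmod (\<phi> g) \<le> R * dnorm g"
    and G: "finite G" "G \<subseteq> dual" and \<epsilon>: "\<epsilon> > 0"
  obtains f where "f \<in> X" "N f \<le> R" "\<And>g. g \<in> G \<Longrightarrow> cmod (g f - \<phi> g) \<le> \<epsilon>"
proof -
  define S where "S = {f \<in> X. N f \<le> R}"
  define D where "D f = (\<Sum>g\<in>G. (cmod (g f - \<phi> g))\<^sup>2)" for f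
  define d where "d = Inf (D ` S)"
  define C where "C = (\<Sum>g\<in>G. (dnorm g * (2 * R))\<^sup>2)"
  have C0: "C \<ge> 0" unfolding C_def by (simp add: sum_nonneg)
  \<comment> \<open>Step length for the variation from \<open>f\<close> towards \<open>u\<close>:
    \<open>D\<close> changes by \<open>2 * t * Re (H u - H f)\<close> plus at most
    \<open>t\<^sup>2 * C\<close>. The slack \<open>t * \<epsilon>\<^sup>2\<close> in the choice of
    \<open>f\<close> is of the same order, so that division by \<open>t\<close> leaves
    \<open>Re (H u - H f) \<ge> - \<epsilon>\<^sup>2\<close>.\<close>
  define t where "t = min 1 (\<epsilon>\<^sup>2 / (C + 1))"
  have t: "0 < t" "t \<le> 1" "t * C \<le> \<epsilon>\<^sup>2"
  proof -
    show "0 < t" using C0 \<epsilon> by (simp add: t_def)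
    show "t \<le> 1" by (simp add: t_def)
    have "t * C \<le> \<epsilon>\<^sup>2 / (C + 1) * C" using C0 by (intro mult_right_mono) (auto simp: t_def)
    also have "\<dots> \<le> \<epsilon>\<^sup>2" using C0 by (simp add: field_simps)
    finally show "t * C \<le> \<epsilon>\<^sup>2" .
  qed
  have zS: "(\<lambda>_. 0) \<in> S" using X_zero N_zero R by (simp add: S_def)
  have bdd: "bdd_below (D ` S)" by (rule bdd_belowI[of _ 0]) (auto simp: D_def sum_nonneg)
  have "\<exists>x\<in>D ` S. x < d + t * \<epsilon>\<^sup>2"
    using zS t \<epsilon> bdd by (subst cInf_less_iff[symmetric]) (auto simp: d_def)
  then obtain f where f: "f \<in> S" "D f < d + t * \<epsilon>\<^sup>2" by auto
  have fX: "f \<in> X" "N f \<le> R" using f by (auto simp: S_def)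
  define e where "e g = g f - \<phi> g" for g
  define H where "H v = (\<Sum>g\<in>G. cnj (e g) * g v)" for v
  have H: "H \<in> dual" unfolding H_def using G by (intro dual_sum_mem dual_cmult_mem) auto
  have first: "Re (H u - H f) \<ge> - \<epsilon>\<^sup>2" if u: "u \<in> S" for u
  proof -
    have uX: "u \<in> X" "N u \<le> R" using u by (auto simp: S_def)
    define w where "w = (\<lambda>\<omega>. of_real (1 - t) * f \<omega> + of_real t * u \<omega>)"
    have wX: "w \<in> X" unfolding w_def using fX uX by (intro X_add X_cmult)
    have "N w \<le> (1 - t) * N f + t * N u"
      using N_add[OF X_cmult[OF fX(1), of "of_real (1-t)"] X_cmult[OF uX(1), of "of_real t"]] t
      unfolding w_def N_cmult[OF fX(1)] N_cmult[OF uX(1)] norm_of_real by simp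
    also have "\<dots> \<le> (1 - t) * R + t * R" using fX uX t by (intro add_mono mult_left_mono) auto
    finally have "w \<in> S" using wX by (simp add: S_def algebra_simps)
    then have "d \<le> D w" unfolding d_def using bdd by (intro cInf_lower) auto
    also have "D w = D f + 2 * t * Re (H u - H f) + t\<^sup>2 * (\<Sum>g\<in>G. (cmod (g u - g f))\<^sup>2)"
    proof -
      have "(cmod (g w - \<phi> g))\<^sup>2 = (cmod (e g))\<^sup>2 + 2 * t * Re (cnj (e g) * (g u - g f)) + t\<^sup>2 * (cmod (g u - g f))\<^sup>2"
        if "g \<in> G" for g
      proof -
        have gd: "g \<in> dual" using that G by auto
        have "g w = of_real (1 - t) * g f + of_real t * g u"
          unfolding w_def using dual_add[OF gd X_cmult[OF fX(1)] X_cmult[OF uX(1)]]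
            dual_cmult[OF gd fX(1)] dual_cmult[OF gd uX(1)] by simp
        then have eq: "g w - \<phi> g = e g + of_real t * (g u - g f)" by (simp add: e_def algebra_simps)
        show ?thesis unfolding eq cmod_power2 by (simp add: power2_eq_square algebra_simps)
      qed
      then have "D w = (\<Sum>g\<in>G. (cmod (e g))\<^sup>2 + 2 * t * Re (cnj (e g) * (g u - g f)) + t\<^sup>2 * (cmod (g u - g f))\<^sup>2)"
        by (simp add: D_def)
      also have "\<dots> = D f + 2 * t * (\<Sum>g\<in>G. Re (cnj (e g) * (g u - g f))) + t\<^sup>2 * (\<Sum>g\<in>G. (cmod (g u - g f))\<^sup>2)"
        by (simp only: sum.distrib sum_distrib_left D_def e_def)
      also have "(\<Sum>g\<in>G. Re (cnj (e g) * (g u - g f))) = Re (H u - H f)"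
        unfolding H_def by (simp only: Re_sum[symmetric] right_diff_distrib sum_subtractf)
      finally show ?thesis .
    qed
    also have "(\<Sum>g\<in>G. (cmod (g u - g f))\<^sup>2) \<le> C"
      unfolding C_def
    proof (intro sum_mono power_mono)
      fix g assume "g \<in> G"
      then have gd: "g \<in> dual" using G by auto
      have "cmod (g u - g f) = cmod (g (\<lambda>\<omega>. u \<omega> - f \<omega>))" using gd fX uX by (simp add: dual_diff)
      also have "\<dots> \<le> dnorm g * N (\<lambda>\<omega>. u \<omega> - f \<omega>)" using gd fX uX by (intro dnorm_bound X_diff)
      also have "N (\<lambda>\<omega>. u \<omega> - f \<omega>) \<le> 2 * R"
        using N_add[OF uX(1) X_cmult[OF fX(1), of "-1"]] fX uX by (simp add: N_cmult[OF fX(1), of "-1", simplified])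
      finally show "cmod (g u - g f) \<le> dnorm g * (2 * R)" using dnorm_nonneg[OF gd] by (simp add: mult_left_mono)
    qed auto
    finally have "d \<le> D f + 2 * t * Re (H u - H f) + t\<^sup>2 * C" by (simp add: mult_left_mono)
    with f(2) have "0 \<le> t * \<epsilon>\<^sup>2 + 2 * t * Re (H u - H f) + t\<^sup>2 * C" by linarith
    also have "\<dots> = t * (\<epsilon>\<^sup>2 + 2 * Re (H u - H f) + t * C)" by (simp add: power2_eq_square algebra_simps)
    finally have "0 \<le> \<epsilon>\<^sup>2 + 2 * Re (H u - H f) + t * C" using t(1) by (simp add: zero_le_mult_iff)
    with t(3) show ?thesis by linarith
  qed
  \<comment> \<open>Testing \<open>first\<close> at the rotated multiples of \<open>v\<close> with
    seminorm \<open>R\<close> gives \<open>R * dnorm H \<le> c\<close>. As \<open>D f\<close> equals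
    \<open>Re (H f - \<phi> H)\<close>, the bound \<open>R\<close> for \<open>\<phi>\<close> then
    yields \<open>D f \<le> \<epsilon>\<^sup>2\<close>.\<close>
  define c where "c = \<epsilon>\<^sup>2 - Re (H f)"
  have c0: "c \<ge> 0" using first[OF zS] dual_zero[OF H] by (simp add: c_def)
  have "dnorm H \<le> c / R"
  proof (rule dnorm_le)
    fix v assume v: "v \<in> X"
    show "cmod (H v) \<le> c / R * N v"
    proof (cases "N v = 0 \<or> H v = 0")
      case True
      then show ?thesis using dnorm_bound[OF H v] c0 R N_nonneg[OF v] by auto
    next
      case False
      then have Nv: "N v > 0" using N_nonneg[OF v] by auto
      define k where "k = - of_real (R / N v) * cnj (sgn (H v))"
      have "cmod k = R / N v" using False Nv R by (simp add: k_def norm_mult norm_sgn norm_divide)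
      then have "(\<lambda>\<omega>. k * v \<omega>) \<in> S" using v Nv X_cmult by (simp add: S_def N_cmult)
      then have "Re (k * H v) \<ge> - c" using first[of "\<lambda>\<omega>. k * v \<omega>"] dual_cmult[OF H v] by (simp add: c_def)
      moreover have "cnj (sgn (H v)) * H v = of_real (cmod (H v))"
        using False by (simp add: sgn_eq complex_norm_square power2_eq_square field_simps
            flip: complex_norm_square)
      then have "k * H v = - of_real (R / N v * cmod (H v))" unfolding k_def by (simp add: algebra_simps)
      ultimately have "R / N v * cmod (H v) \<le> c" by simp
      then show ?thesis using Nv R by (simp add: field_simps)
    qed
  qed (use c0 R in auto)
  then have Rn: "R * dnorm H \<le> c" using R by (simp add: field_simps)
  have "\<phi> H = (\<Sum>g\<in>G. cnj (e g) * \<phi> g)"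
  proof -
    have Gd: "g \<in> dual" if "g \<in> G" for g using that G by auto
    have "\<phi> H = (\<Sum>g\<in>G. \<phi> (\<lambda>v. cnj (e g) * g v))"
      unfolding H_def by (rule bidual_sum[OF \<phi> dual_cmult_mem[OF Gd]])
    then show ?thesis using bidual_cmult[OF \<phi> Gd] by simp
  qed
  then have "H f - \<phi> H = (\<Sum>g\<in>G. cnj (e g) * e g)"
    by (simp add: H_def e_def sum_subtractf[symmetric] right_diff_distrib)
  also have "\<dots> = of_real (D f)"
    unfolding D_def of_real_sum e_def by (intro sum.cong refl) (simp only: complex_norm_square mult.commute)
  finally have "D f = Re (H f) - Re (\<phi> H)" by (metis Re_complex_of_real minus_complex.sel(1))
  also have "\<dots> \<le> Re (H f) + R * dnorm H" using R(2)[OF H] abs_Re_le_cmod[of "\<phi> H"] by linarith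
  also have "\<dots> \<le> \<epsilon>\<^sup>2" using Rn by (simp add: c_def)
  finally have Df: "D f \<le> \<epsilon>\<^sup>2" .
  have "cmod (g f - \<phi> g) \<le> \<epsilon>" if "g \<in> G" for g
  proof -
    have "(cmod (g f - \<phi> g))\<^sup>2 \<le> D f" unfolding D_def using that G by (intro member_le_sum) auto
    then show ?thesis using Df \<epsilon> by (meson less_imp_le order_trans power2_le_imp_le)
  qed
  then show ?thesis using that fX by blast
qed

section \<open>Relative weak compactness in the dual\<close>

text \<open>An element of the dual as the family of its values under the bidual, padded with \<open>0\<close> off the
  bidual, so that weak compactness can be tested in the product topology of a full function type.\<close>

definition weak_eval :: "(('a \<Rightarrow> complex) \<Rightarrow> complex) \<Rightarrow> ((('a \<Rightarrow> complex) \<Rightarrow> complex) \<Rightarrow> complex) \<Rightarrow> complex" where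
  "weak_eval g = (\<lambda>\<phi>. if \<phi> \<in> bidual then \<phi> g else 0)"

lemma topspace_weak: "topspace (weak_topology_dual X N) = dual"
proof -
  have "(\<Union> {{g. \<phi> g \<in> U} | \<phi> U. \<phi> \<in> bidual \<and> open U}) = UNIV"
    using eval_bidual[OF X_zero] by (auto intro!: exI[of _ UNIV])
  then show ?thesis
    unfolding weak_topology_dual_def topspace_subtopology topology_generated_by_topspace by simp
qed

text \<open>The induction comes down to the subbasic sets, which are preimages of open sets under a
  coordinate of \<open>weak_eval\<close>. Compactness can thus be checked in a product of copies of
  the complex plane.\<close>

lemma openin_weak_imp:
  assumes "openin (weak_topology_dual X N) U"
  obtains V where "open V" "U = dual \<inter> weak_eval -` V"
proof -
  from assms obtain T where T: "generate_topology_on {{g. \<phi> g \<in> U} | \<phi> U. \<phi> \<in> bidual \<and> open U} T" "U = T \<inter> dual"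
    unfolding weak_topology_dual_def openin_subtopology openin_topology_generated_by_iff by auto
  from T(1) have "\<exists>V. open V \<and> T = weak_eval -` V"
  proof induction
    case Empty
    then show ?case by (intro exI[of _ "{}"]) auto
  next
    case (Int a b)
    then obtain V W where "open V" "a = weak_eval -` V" "open W" "b = weak_eval -` W" by auto
    then show ?case by (intro exI[of _ "V \<inter> W"]) auto
  next
    case (UN K)
    then obtain V where "\<And>k. k \<in> K \<Longrightarrow> open (V k) \<and> k = weak_eval -` V k" by metis
    then show ?case by (intro exI[of _ "\<Union>k\<in>K. V k"]) auto
  next
    case (Basis s)
    then obtain \<phi> U where s: "s = {g. \<phi> g \<in> U}" "\<phi> \<in> bidual" "open U" by auto
    have "continuous_on UNIV (\<lambda>L::((('a \<Rightarrow> complex) \<Rightarrow> complex) \<Rightarrow> complex) \<Rightarrow> complex. L \<phi>)"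
      by (rule continuous_on_product_coordinates)
    then have "open ((\<lambda>L. L \<phi>) -` U)" using s(3) by (rule open_vimage[rotated])
    then show ?case using s by (intro exI[of _ "(\<lambda>L. L \<phi>) -` U"]) (auto simp: weak_eval_def)
  qed
  then show ?thesis using that T(2) by auto
qed

lemma weak_closure_subset:
  assumes "A \<subseteq> dual"
  shows "dual \<inter> weak_eval -` closure (weak_eval ` A) \<subseteq> weak_topology_dual X N closure_of A"
proof
  fix g assume g: "g \<in> dual \<inter> weak_eval -` closure (weak_eval ` A)"
  show "g \<in> weak_topology_dual X N closure_of A"
    unfolding in_closure_of topspace_weak
  proof (intro conjI allI impI)
    fix T assume T: "g \<in> T \<and> openin (weak_topology_dual X N) T"
    then obtain V where V: "open V" "T = dual \<inter> weak_eval -` V" using openin_weak_imp by blast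
    then have "weak_eval g \<in> V \<inter> closure (weak_eval ` A)" using g T by auto
    then have "V \<inter> weak_eval ` A \<noteq> {}" using V(1) open_Int_closure_eq_empty by blast
    then show "\<exists>y. y \<in> A \<and> y \<in> T" using V assms by auto
  qed (use g in auto)
qed

lemma weak_closure_eval:
  assumes "g \<in> weak_topology_dual X N closure_of A"
  shows "weak_eval g \<in> closure (weak_eval ` A)"
proof -
  have "continuous_map (weak_topology_dual X N) euclidean weak_eval"
    unfolding euclidean_product_topology[symmetric] continuous_map_componentwise_UNIV
  proof
    fix \<phi>
    show "continuous_map (weak_topology_dual X N) euclidean (\<lambda>g. weak_eval g \<phi>)"
    proof (cases "\<phi> \<in> bidual")
      case True
      have "openin (weak_topology_dual X N) {g \<in> dual. \<phi> g \<in> U}" if "open U" for U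
      proof -
        have "openin (topology_generated_by {{g. \<phi> g \<in> U} | \<phi> U. \<phi> \<in> bidual \<and> open U}) {g. \<phi> g \<in> U}"
          by (rule topology_generated_by_Basis) (use True that in auto)
        moreover have "{g \<in> dual. \<phi> g \<in> U} = {g. \<phi> g \<in> U} \<inter> dual" by auto
        ultimately show ?thesis unfolding weak_topology_dual_def openin_subtopology by blast
      qed
      then show ?thesis using True by (auto simp: continuous_map_def topspace_weak weak_eval_def)
    qed (auto simp: weak_eval_def)
  qed
  from continuous_map_image_closure_subset[OF this, of A] assms show ?thesis by auto
qed

text \<open>The bound places the image of \<open>A\<close> in a product of discs, compact by
  Tychonoff. A limit of that image is in general an element of the third dual; \<open>lim\<close>
  brings all limits back into the dual, so a weakly open cover of the closure of \<open>A\<close>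
  also covers the compact closure of the image.\<close>

lemma rel_weakly_compact_dualI:
  assumes A: "A \<subseteq> dual" and B: "\<And>g f. g \<in> A \<Longrightarrow> f \<in> X \<Longrightarrow> cmod (g f) \<le> B * N f" and B0: "B \<ge> 0"
    and lim: "\<And>L. L \<in> closure (weak_eval ` A) \<Longrightarrow> \<exists>g\<in>dual. L = weak_eval g"
  shows "rel_weakly_compact_dual X N A"
proof -
  let ?W = "weak_topology_dual X N"
  let ?K = "closure (weak_eval ` A)"
  have "\<exists>r. \<forall>g\<in>A. cmod (weak_eval g \<phi>) \<le> r" for \<phi>
  proof (cases "\<phi> \<in> bidual")
    case True
    then obtain b where b: "\<And>g. g \<in> dual \<Longrightarrow> cmod (\<phi> g) \<le> b * dnorm g" unfolding bidual_space_def by blast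
    have "cmod (weak_eval g \<phi>) \<le> \<bar>b\<bar> * B" if "g \<in> A" for g
    proof -
      have g: "g \<in> dual" using that A by auto
      have "cmod (\<phi> g) \<le> b * dnorm g" using b[OF g] .
      also have "\<dots> \<le> \<bar>b\<bar> * dnorm g" using dnorm_nonneg[OF g] by (intro mult_right_mono) auto
      also have "\<dots> \<le> \<bar>b\<bar> * B" using B[OF that] B0 by (intro mult_left_mono dnorm_le) auto
      finally show ?thesis using True by (simp add: weak_eval_def)
    qed
    then show ?thesis by blast
  qed (auto simp: weak_eval_def)
  then obtain r where r: "\<And>g \<phi>. g \<in> A \<Longrightarrow> cmod (weak_eval g \<phi>) \<le> r \<phi>" by metis
  have "compactin (product_topology (\<lambda>_. euclidean) UNIV) (PiE UNIV (\<lambda>\<phi>. cball (0::complex) (r \<phi>)))"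
    by (subst compactin_PiE) auto
  then have 1: "compact (PiE UNIV (\<lambda>\<phi>. cball (0::complex) (r \<phi>)))"
    unfolding euclidean_product_topology by simp
  have "closedin (product_topology (\<lambda>_. euclidean) UNIV) (PiE UNIV (\<lambda>\<phi>. cball (0::complex) (r \<phi>)))"
    by (subst closedin_product_topology) auto
  then have 2: "closed (PiE UNIV (\<lambda>\<phi>. cball (0::complex) (r \<phi>)))"
    unfolding euclidean_product_topology by simp
  have "weak_eval ` A \<subseteq> PiE UNIV (\<lambda>\<phi>. cball (0::complex) (r \<phi>))" using r by (auto simp: PiE_def)
  then have sub: "?K \<subseteq> PiE UNIV (\<lambda>\<phi>. cball (0::complex) (r \<phi>))" using 2 by (rule closure_minimal)
  have K: "compact ?K" using compact_Int_closed[OF 1 closed_closure, of "weak_eval ` A"] sub by (simp only: inf.absorb2)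
  show ?thesis unfolding rel_weakly_compact_dual_def compactin_def
  proof (intro conjI allI impI)
    show "?W closure_of A \<subseteq> topspace ?W" by (rule closure_of_subset_topspace)
    fix \<U> assume U: "Ball \<U> (openin ?W) \<and> ?W closure_of A \<subseteq> \<Union> \<U>"
    have "\<exists>V. open V \<and> (\<forall>g. g \<in> u \<longleftrightarrow> g \<in> dual \<and> weak_eval g \<in> V)" if "u \<in> \<U>" for u
    proof -
      from that have "openin ?W u" using U by blast
      then obtain V where "open V" "u = dual \<inter> weak_eval -` V" by (rule openin_weak_imp)
      then show ?thesis by (intro exI[of _ V]) auto
    qed
    then obtain V where V: "\<And>u. u \<in> \<U> \<Longrightarrow> open (V u)"
      "\<And>u g. u \<in> \<U> \<Longrightarrow> g \<in> u \<longleftrightarrow> g \<in> dual \<and> weak_eval g \<in> V u"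
      by metis
    have "?K \<subseteq> (\<Union>u\<in>\<U>. V u)"
    proof
      fix L assume L: "L \<in> ?K"
      then obtain g where g: "g \<in> dual" "L = weak_eval g" using lim by blast
      then have "g \<in> ?W closure_of A" using weak_closure_subset[OF A] L by auto
      then obtain u where "u \<in> \<U>" "g \<in> u" using U by auto
      then show "L \<in> (\<Union>u\<in>\<U>. V u)" using V g by blast
    qed
    then obtain \<F> where F: "\<F> \<subseteq> \<U>" "finite \<F>" "?K \<subseteq> (\<Union>u\<in>\<F>. V u)"
      using compactE_image[OF K, of \<U> V] V by blast
    have "?W closure_of A \<subseteq> \<Union>\<F>"
    proof
      fix g assume g: "g \<in> ?W closure_of A"
      then have "weak_eval g \<in> ?K" "g \<in> dual"
        using weak_closure_eval closure_of_subset_topspace[of ?W A] topspace_weak by auto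
      then show "g \<in> \<Union>\<F>" using F V by blast
    qed
    then show "\<exists>\<F>. finite \<F> \<and> \<F> \<subseteq> \<U> \<and> ?W closure_of A \<subseteq> \<Union>\<F>" using F by blast
  qed
qed

lemma weak_eval_approx:
  assumes "L \<in> closure (weak_eval ` A)" "finite I" "\<epsilon> > 0"
  obtains g where "g \<in> A" "\<And>\<phi>. \<phi> \<in> I \<Longrightarrow> cmod (weak_eval g \<phi> - L \<phi>) < \<epsilon>"
proof -
  let ?V = "\<Inter>\<phi>\<in>I. (\<lambda>L'. L' \<phi>) -` ball (L \<phi>) \<epsilon>"
  have "open ?V"
    using assms(2) by (intro open_INT ballI open_vimage continuous_on_product_coordinates) auto
  moreover have "L \<in> ?V" using assms(3) by auto
  ultimately have "?V \<inter> weak_eval ` A \<noteq> {}" using assms(1) open_Int_closure_eq_empty by blast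
  then obtain g where "g \<in> A" "weak_eval g \<in> ?V" by blast
  then show ?thesis using that by (auto simp: dist_norm norm_minus_commute)
qed

text \<open>Linearity and the bound concern finitely many coordinates at a time, so they survive a
  pointwise limit. Only the values of \<open>L\<close> at evaluations are read off: they determine
  the sole candidate for an element of the dual that represents \<open>L\<close>.\<close>

lemma closure_weak_eval_limit:
  assumes A: "A \<subseteq> dual" and B: "\<And>g f. g \<in> A \<Longrightarrow> f \<in> X \<Longrightarrow> cmod (g f) \<le> B * N f"
    and L: "L \<in> closure (weak_eval ` A)"
  shows "(\<lambda>f. if f \<in> X then L (\<lambda>g. g f) else 0) \<in> dual"
proof -
  have approx: "\<exists>g\<in>A. \<forall>f\<in>F. cmod (g f - L (\<lambda>g. g f)) < \<epsilon>" if F: "finite F" "F \<subseteq> X" and \<epsilon>: "\<epsilon> > 0" for F \<epsilon>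
  proof -
    obtain g where "g \<in> A" "\<And>\<phi>. \<phi> \<in> (\<lambda>f g. g f) ` F \<Longrightarrow> cmod (weak_eval g \<phi> - L \<phi>) < \<epsilon>"
      using weak_eval_approx[OF L _ \<epsilon>, of "(\<lambda>f g. g f) ` F"] F by blast
    then have "cmod (weak_eval g (\<lambda>g. g f) - L (\<lambda>g. g f)) < \<epsilon>" if "f \<in> F" for f using that by blast
    then show ?thesis using \<open>g \<in> A\<close> F eval_bidual by (intro bexI[of _ g]) (auto simp: weak_eval_def subset_iff)
  qed
  have zeroI: "z = 0" if "\<And>e. e > 0 \<Longrightarrow> cmod z \<le> k * e" for z :: complex and k :: real
  proof -
    have "cmod z \<le> e" if "e > 0" for e
    proof -
      have "cmod z \<le> k * (e / (\<bar>k\<bar> + 1))" by (rule \<open>\<And>e. e > 0 \<Longrightarrow> cmod z \<le> k * e\<close>) (use that in auto)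
      also have "\<dots> \<le> (\<bar>k\<bar> + 1) * (e / (\<bar>k\<bar> + 1))" using that by (intro mult_right_mono) auto
      finally show ?thesis by (simp add: add_nonneg_pos)
    qed
    then show ?thesis using field_le_epsilon[of "cmod z" 0] by simp
  qed
  show ?thesis
  proof (rule dualI[where B = B])
    fix f h assume fh: "f \<in> X" "h \<in> X"
    have "L (\<lambda>g. g (\<lambda>\<omega>. f \<omega> + h \<omega>)) - (L (\<lambda>g. g f) + L (\<lambda>g. g h)) = 0"
    proof (rule zeroI[where k = 3])
      fix e :: real assume "e > 0"
      then obtain g where g: "g \<in> A" "\<forall>f\<in>{f, h, (\<lambda>\<omega>. f \<omega> + h \<omega>)}. cmod (g f - L (\<lambda>g. g f)) < e"
        using approx[of "{f, h, (\<lambda>\<omega>. f \<omega> + h \<omega>)}" e] fh X_add by auto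
      have "g (\<lambda>\<omega>. f \<omega> + h \<omega>) = g f + g h" using g A fh dual_add by auto
      then have "L (\<lambda>g. g (\<lambda>\<omega>. f \<omega> + h \<omega>)) - (L (\<lambda>g. g f) + L (\<lambda>g. g h)) =
          (g f - L (\<lambda>g. g f)) + (g h - L (\<lambda>g. g h)) - (g (\<lambda>\<omega>. f \<omega> + h \<omega>) - L (\<lambda>g. g (\<lambda>\<omega>. f \<omega> + h \<omega>)))"
        by simp
      also have "cmod \<dots> \<le> cmod (g f - L (\<lambda>g. g f)) + cmod (g h - L (\<lambda>g. g h)) + cmod (g (\<lambda>\<omega>. f \<omega> + h \<omega>) - L (\<lambda>g. g (\<lambda>\<omega>. f \<omega> + h \<omega>)))"
        by (rule order_trans[OF norm_triangle_ineq4 add_right_mono[OF norm_triangle_ineq]])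
      also have "\<dots> \<le> 3 * e" using g(2) by auto
      finally show "cmod (L (\<lambda>g. g (\<lambda>\<omega>. f \<omega> + h \<omega>)) - (L (\<lambda>g. g f) + L (\<lambda>g. g h))) \<le> 3 * e" .
    qed
    then show "(if (\<lambda>\<omega>. f \<omega> + h \<omega>) \<in> X then L (\<lambda>g. g (\<lambda>\<omega>. f \<omega> + h \<omega>)) else 0) =
      (if f \<in> X then L (\<lambda>g. g f) else 0) + (if h \<in> X then L (\<lambda>g. g h) else 0)"
      using fh X_add[OF fh] by simp
  next
    fix c f assume f: "f \<in> X"
    have "L (\<lambda>g. g (\<lambda>\<omega>. c * f \<omega>)) - c * L (\<lambda>g. g f) = 0"
    proof (rule zeroI[where k = "1 + cmod c"])
      fix e :: real assume "e > 0"
      then obtain g where g: "g \<in> A" "\<forall>f\<in>{f, (\<lambda>\<omega>. c * f \<omega>)}. cmod (g f - L (\<lambda>g. g f)) < e"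
        using approx[of "{f, (\<lambda>\<omega>. c * f \<omega>)}" e] f X_cmult by auto
      have "g (\<lambda>\<omega>. c * f \<omega>) = c * g f" using g A f dual_cmult by auto
      then have "L (\<lambda>g. g (\<lambda>\<omega>. c * f \<omega>)) - c * L (\<lambda>g. g f) =
          c * (g f - L (\<lambda>g. g f)) - (g (\<lambda>\<omega>. c * f \<omega>) - L (\<lambda>g. g (\<lambda>\<omega>. c * f \<omega>)))"
        by (simp add: algebra_simps)
      also have "cmod \<dots> \<le> cmod c * cmod (g f - L (\<lambda>g. g f)) + cmod (g (\<lambda>\<omega>. c * f \<omega>) - L (\<lambda>g. g (\<lambda>\<omega>. c * f \<omega>)))"
        by (metis norm_triangle_ineq4 norm_mult)
      also have "\<dots> \<le> cmod c * e + e" using g(2) by (intro add_mono mult_left_mono) auto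
      finally show "cmod (L (\<lambda>g. g (\<lambda>\<omega>. c * f \<omega>)) - c * L (\<lambda>g. g f)) \<le> (1 + cmod c) * e"
        by (simp add: algebra_simps)
    qed
    then show "(if (\<lambda>\<omega>. c * f \<omega>) \<in> X then L (\<lambda>g. g (\<lambda>\<omega>. c * f \<omega>)) else 0) = c * (if f \<in> X then L (\<lambda>g. g f) else 0)"
      using f X_cmult[OF f] by simp
  next
    fix f assume f: "f \<in> X"
    have "cmod (L (\<lambda>g. g f)) \<le> B * N f"
    proof (rule field_le_epsilon)
      fix e :: real assume "e > 0"
      then obtain g where g: "g \<in> A" "cmod (g f - L (\<lambda>g. g f)) < e" using approx[of "{f}" e] f by auto
      have "cmod (L (\<lambda>g. g f)) \<le> cmod (g f) + cmod (g f - L (\<lambda>g. g f))"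
        by (metis norm_minus_commute norm_triangle_sub)
      then show "cmod (L (\<lambda>g. g f)) \<le> B * N f + e" using B[OF g(1) f] g(2) by linarith
    qed
    then show "cmod (if f \<in> X then L (\<lambda>g. g f) else 0) \<le> B * N f" using f by simp
  qed auto
qed

text \<open>Grothendieck's double limit argument: a weak cluster point outside the dual produces
  a bounded double sequence whose iterated limits differ by \<open>c\<close>.\<close>

lemma rel_weakly_compact_double_limit:
  assumes A: "A \<subseteq> dual" and B: "\<And>g f. g \<in> A \<Longrightarrow> f \<in> X \<Longrightarrow> cmod (g f) \<le> B * N f"
    and DL: "\<And>g g0 f c \<epsilon>. (\<And>n::nat. g n \<in> A) \<Longrightarrow> g0 \<in> dual \<Longrightarrow> (\<And>n::nat. f n \<in> X) \<Longrightarrow> (\<And>n. N (f n) \<le> 1 / 2) \<Longrightarrow>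
      \<epsilon> > 0 \<Longrightarrow> 10 * \<epsilon> \<le> cmod c \<Longrightarrow>
      (\<And>n m. m \<le> n \<Longrightarrow> cmod (g n (f m) - g0 (f m)) \<le> \<epsilon>) \<Longrightarrow>
      (\<And>n m. n < m \<Longrightarrow> cmod (g n (f m) - g0 (f m) - c) \<le> \<epsilon>) \<Longrightarrow> False"
  shows "rel_weakly_compact_dual X N A"
proof (rule rel_weakly_compact_dualI[OF A, where B = "\<bar>B\<bar>"])
  fix g :: "('a \<Rightarrow> complex) \<Rightarrow> complex" and f assume "g \<in> A" "f \<in> X"
  then show "cmod (g f) \<le> \<bar>B\<bar> * N f"
    using B[of g f] mult_right_mono[OF abs_ge_self N_nonneg[of f], of B] by linarith
next
  fix L assume L: "L \<in> closure (weak_eval ` A)"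
  define g0 where "g0 f = (if f \<in> X then L (\<lambda>g. g f) else 0)" for f
  have g0: "g0 \<in> dual" unfolding g0_def by (rule closure_weak_eval_limit[where B = B, OF A _ L]) (rule B)
  have "L \<phi> = weak_eval g0 \<phi>" for \<phi>
  proof (cases "\<phi> \<in> bidual")
    case False
    have "cmod (L \<phi>) \<le> 0 + e" if e: "e > 0" for e
    proof -
      obtain g where "cmod (weak_eval g \<phi> - L \<phi>) < e" using weak_eval_approx[OF L, of "{\<phi>}" e] e by blast
      then show ?thesis using False by (simp add: weak_eval_def)
    qed
    then have "cmod (L \<phi>) \<le> 0" by (rule field_le_epsilon)
    then show ?thesis using False by (simp add: weak_eval_def)
  next
    case \<phi>: True
    then obtain b where b: "\<And>g. g \<in> dual \<Longrightarrow> cmod (\<phi> g) \<le> b * dnorm g" unfolding bidual_space_def by blast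
    define R where "R = \<bar>b\<bar> + 1"
    have R: "R > 0" by (simp add: R_def)
    have R': "cmod (\<phi> g) \<le> R * dnorm g" if "g \<in> dual" for g
      by (rule order_trans[OF b[OF that]]) (use dnorm_nonneg[OF that] in \<open>auto simp: R_def intro!: mult_right_mono\<close>)
    show ?thesis
    proof (rule ccontr)
      assume "L \<phi> \<noteq> weak_eval g0 \<phi>"
      then have ne: "L \<phi> - \<phi> g0 \<noteq> 0" using \<phi> by (simp add: weak_eval_def)
      define c where "c = L \<phi> - \<phi> g0"
      \<comment> \<open>Three errors of size \<open>\<eta>\<close> occur when \<open>n < m\<close>;
        the factor 10 demanded by \<open>DL\<close> makes 30.\<close>
      define \<eta> where "\<eta> = cmod c / 30"
      have \<eta>: "\<eta> > 0" using ne by (simp add: \<eta>_def c_def)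
      \<comment> \<open>The order of choice produces the two limits: \<open>fst (s n)\<close> is
        taken by \<open>helly\<close> after all earlier functionals, on which it imitates
        \<open>\<phi>\<close>; \<open>snd (s n)\<close> is taken after it, close to \<open>L\<close>
        at \<open>\<phi>\<close> and close to \<open>g0\<close> at all functions chosen so far, the
        current one included.\<close>
      define P where "P s n p \<longleftrightarrow> fst p \<in> X \<and> N (fst p) \<le> R \<and> cmod (g0 (fst p) - \<phi> g0) \<le> \<eta> \<and>
        (\<forall>i<n. cmod (snd (s i) (fst p) - \<phi> (snd (s i))) \<le> \<eta>) \<and> snd p \<in> A \<and> cmod (\<phi> (snd p) - L \<phi>) \<le> \<eta> \<and>
        cmod (snd p (fst p) - g0 (fst p)) \<le> \<eta> \<and> (\<forall>i<n. cmod (snd p (fst (s i)) - g0 (fst (s i))) \<le> \<eta>)"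
        for s :: "nat \<Rightarrow> ('a \<Rightarrow> complex) \<times> (('a \<Rightarrow> complex) \<Rightarrow> complex)" and n p
      have "\<exists>s. \<forall>n. P s n (s n)"
      proof (rule dependent_wellorder_choice)
        show "P s n r = P t n r" if "\<And>y. y < n \<Longrightarrow> s y = t y" for s t r n
          using that by (simp add: P_def cong: conj_cong)
      next
        fix n s assume IH: "\<And>y. y < n \<Longrightarrow> P s y (s y)"
        have inX: "fst (s i) \<in> X" "snd (s i) \<in> A" if "i < n" for i using IH[OF that] by (auto simp: P_def)
        obtain f where f: "f \<in> X" "N f \<le> R" "\<And>g. g \<in> insert g0 ((\<lambda>i. snd (s i)) ` {..<n}) \<Longrightarrow> cmod (g f - \<phi> g) \<le> \<eta>"
          using helly[OF \<phi> R R', of "insert g0 ((\<lambda>i. snd (s i)) ` {..<n})" \<eta>] inX A g0 \<eta> by blast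
        let ?F = "insert f ((\<lambda>i. fst (s i)) ` {..<n})"
        obtain g where g: "g \<in> A" "\<And>\<psi>. \<psi> \<in> insert \<phi> ((\<lambda>f g. g f) ` ?F) \<Longrightarrow> cmod (weak_eval g \<psi> - L \<psi>) < \<eta>"
          using weak_eval_approx[OF L _ \<eta>, of "insert \<phi> ((\<lambda>f g. g f) ` ?F)"] by blast
        have FX: "?F \<subseteq> X" using f inX by auto
        have gF: "cmod (g v - g0 v) \<le> \<eta>" if "v \<in> ?F" for v
        proof -
          have "v \<in> X" using that FX by auto
          moreover have "cmod (weak_eval g (\<lambda>g. g v) - L (\<lambda>g. g v)) < \<eta>" using that by (intro g(2)) auto
          ultimately show ?thesis using eval_bidual[of v] by (simp add: weak_eval_def g0_def)
        qed
        have "cmod (\<phi> g - L \<phi>) \<le> \<eta>" using g(2)[of \<phi>] \<phi> by (simp add: weak_eval_def)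
        then have "P s n (f, g)" using f g(1) gF by (simp add: P_def)
        then show "\<exists>r. P s n r" by blast
      qed
      then obtain s where s: "\<And>n. P s n (s n)" by blast
      define g where "g n = snd (s n)" for n
      \<comment> \<open>Rescaling from radius \<open>R\<close> to 1/2; \<open>c\<close> and the
        errors shrink by the same factor.\<close>
      define f where "f n = (\<lambda>\<omega>. of_real (1 / (2 * R)) * fst (s n) \<omega>)" for n
      have s': "g n \<in> A" "fst (s n) \<in> X" "N (fst (s n)) \<le> R" for n :: nat using s[of n] by (auto simp: P_def g_def)
      have gd: "g n \<in> dual" for n :: nat using s' A by auto
      have sc: "h (f n) = of_real (1 / (2 * R)) * h (fst (s n))" if "h \<in> dual" for h and n :: nat
        unfolding f_def using dual_cmult[OF that s'(2)] .
      have scn: "cmod (of_real (1 / (2 * R)) * z) = cmod z / (2 * R)" for z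
        using R by (simp add: norm_mult norm_divide)
      show False
      proof (rule DL[of g g0 f "3 * \<eta> / (2 * R)" "of_real (1 / (2 * R)) * c"])
        show "f n \<in> X" for n :: nat unfolding f_def using s' X_cmult by blast
        show "N (f n) \<le> 1 / 2" for n :: nat
          unfolding f_def N_cmult[OF s'(2)] using s'(3)[of n] R by (simp add: norm_divide field_simps)
        show "10 * (3 * \<eta> / (2 * R)) \<le> cmod (of_real (1 / (2 * R)) * c)" unfolding scn by (simp add: \<eta>_def)
        show "cmod (g n (f m) - g0 (f m)) \<le> 3 * \<eta> / (2 * R)" if "m \<le> n" for n m :: nat
        proof -
          have "cmod (g n (fst (s m)) - g0 (fst (s m))) \<le> \<eta>"
            using s[of n] that by (cases "m = n") (auto simp: P_def g_def)
          then have "cmod (of_real (1 / (2 * R)) * (g n (fst (s m)) - g0 (fst (s m)))) \<le> 3 * \<eta> / (2 * R)"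
            unfolding scn using R \<eta> by (intro divide_right_mono) auto
          then show ?thesis unfolding sc[OF gd] sc[OF g0] by (simp only: right_diff_distrib)
        qed
        show "cmod (g n (f m) - g0 (f m) - of_real (1 / (2 * R)) * c) \<le> 3 * \<eta> / (2 * R)" if "n < m" for n m :: nat
        proof -
          have "cmod (g n (fst (s m)) - \<phi> (g n)) \<le> \<eta>" "cmod (g0 (fst (s m)) - \<phi> g0) \<le> \<eta>" "cmod (\<phi> (g n) - L \<phi>) \<le> \<eta>"
            using s[of m] s[of n] that by (auto simp: P_def g_def)
          moreover have eq: "g n (fst (s m)) - g0 (fst (s m)) - c =
              (g n (fst (s m)) - \<phi> (g n)) + (\<phi> (g n) - L \<phi>) - (g0 (fst (s m)) - \<phi> g0)" by (simp add: c_def)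
          ultimately have "cmod (g n (fst (s m)) - g0 (fst (s m)) - c) \<le> 3 * \<eta>"
            using norm_triangle_ineq4[of "(g n (fst (s m)) - \<phi> (g n)) + (\<phi> (g n) - L \<phi>)" "g0 (fst (s m)) - \<phi> g0"]
              norm_triangle_ineq[of "g n (fst (s m)) - \<phi> (g n)" "\<phi> (g n) - L \<phi>"] unfolding eq by linarith
          then have "cmod (of_real (1 / (2 * R)) * (g n (fst (s m)) - g0 (fst (s m)) - c)) \<le> 3 * \<eta> / (2 * R)"
            unfolding scn using R by (intro divide_right_mono) auto
          then show ?thesis unfolding sc[OF gd] sc[OF g0] by (simp only: right_diff_distrib)
        qed
      qed (use s' g0 \<eta> R in auto)
    qed
  qed
  then show "\<exists>g\<in>dual. L = weak_eval g" using g0 by blast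
qed simp

end

section \<open>Iterated midpoints\<close>

text \<open>The same tree can be evaluated in several sequences at once, which gives the same convex
  combination of each of them.\<close>

datatype mtree = Leaf nat | Mid mtree mtree

primrec leaves :: "mtree \<Rightarrow> nat set" where
  "leaves (Leaf n) = {n}"
| "leaves (Mid S T) = leaves S \<union> leaves T"

primrec tval :: "(nat \<Rightarrow> complex) \<Rightarrow> mtree \<Rightarrow> complex" where
  "tval z (Leaf n) = z n"
| "tval z (Mid S T) = (tval z S + tval z T) / 2"

definition teval :: "(nat \<Rightarrow> 'a \<Rightarrow> complex) \<Rightarrow> mtree \<Rightarrow> 'a \<Rightarrow> complex" where
  "teval f T = (\<lambda>\<omega>. tval (\<lambda>n. f n \<omega>) T)"

lemma teval_Leaf: "teval f (Leaf n) = f n"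
  by (simp add: teval_def)

lemma teval_Mid: "teval f (Mid S T) = (\<lambda>\<omega>. (1/2) * teval f S \<omega> + (1/2) * teval f T \<omega>)"
  by (simp add: teval_def add_divide_distrib)

lemma finite_leaves: "finite (leaves T)"
  by (induction T) auto

lemma tval_near:
  "(\<And>n. n \<in> leaves T \<Longrightarrow> cmod (z n - c) \<le> r) \<Longrightarrow> cmod (tval z T - c) \<le> r"
proof (induction T)
  case (Mid S T)
  have "tval z (Mid S T) - c = ((tval z S - c) + (tval z T - c)) / 2" by (simp add: field_simps)
  then have "cmod (tval z (Mid S T) - c) = cmod ((tval z S - c) + (tval z T - c)) / 2"
    by (simp only: norm_divide norm_numeral)
  also have "\<dots> \<le> (r + r) / 2"
    using Mid by (intro divide_right_mono norm_triangle_mono) auto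
  finally show ?case by simp
qed auto

lemma tval_diff: "tval (\<lambda>n. z n - w n) T = tval z T - tval w T"
  by (induction T) (auto simp: diff_divide_distrib add_divide_distrib)

text \<open>The infima \<open>m k\<close> over trees with leaves beyond \<open>k\<close> increase to
  \<open>mm\<close>. Almost minimal trees beyond \<open>K\<close> have \<open>J\<close> hardly above
  \<open>mm\<close>, while their midpoint, again a tree beyond \<open>K\<close>, has
  \<open>J\<close> at least \<open>m K\<close>. The midpoint defect is therefore small, and a
  uniformly convex \<open>J\<close> turns this into a Cauchy property.\<close>

lemma midpoint_minimise:
  fixes J :: "mtree \<Rightarrow> real"
  assumes J0: "\<And>T. 0 \<le> J T" and JC: "\<And>T. J T \<le> C"
  shows "\<exists>T. (\<forall>k. leaves (T k) \<subseteq> {k..}) \<and>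
    (\<forall>\<eta>>0. \<exists>K. \<forall>k\<ge>K. \<forall>l\<ge>K. (J (T k) + J (T l)) / 2 - J (Mid (T k) (T l)) \<le> \<eta>)"
proof -
  define S where "S k = {T. leaves T \<subseteq> {k..}}" for k
  define m where "m k = Inf (J ` S k)" for k
  have ne: "S k \<noteq> {}" for k by (auto simp: S_def intro!: exI[of _ "Leaf k"])
  have bdd: "bdd_below (J ` S k)" for k by (rule bdd_belowI[of _ 0]) (use J0 in auto)
  have m_le: "m k \<le> J T" if "T \<in> S k" for k T
    unfolding m_def using that bdd by (intro cInf_lower) auto
  have m_mono: "m k \<le> m l" if "k \<le> l" for k l
    unfolding m_def using ne bdd that by (intro cInf_superset_mono image_mono) (auto simp: S_def)
  have m_C: "m k \<le> C" for k using m_le[of "Leaf k" k] JC[of "Leaf k"] by (auto simp: S_def)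
  define mm where "mm = (SUP k. m k)"
  have bddm: "bdd_above (range m)" by (rule bdd_aboveI[of _ C]) (use m_C in auto)
  have m_lim: "m \<longlonglongrightarrow> mm" unfolding mm_def
    by (rule LIMSEQ_incseq_SUP[OF bddm]) (use m_mono in \<open>auto simp: incseq_def\<close>)
  have m_mm: "m k \<le> mm" for k unfolding mm_def using bddm by (intro cSUP_upper) auto
  have "\<exists>T\<in>S k. J T < m k + 1 / real (Suc k)" for k
  proof -
    have "Inf (J ` S k) < m k + 1 / real (Suc k)" by (simp add: m_def)
    then have "\<exists>a\<in>J ` S k. a < m k + 1 / real (Suc k)" using ne[of k] bdd[of k] by (subst (asm) cInf_less_iff) simp_all
    then show ?thesis by blast
  qed
  then obtain T where T: "\<And>k. T k \<in> S k" "\<And>k. J (T k) < m k + 1 / real (Suc k)"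
    unfolding Bex_def by metis
  show ?thesis
  proof (intro exI[of _ T] conjI allI impI)
    show "leaves (T k) \<subseteq> {k..}" for k using T(1)[of k] by (simp add: S_def)
    fix \<eta> :: real assume "\<eta> > 0"
    have "(\<lambda>k. mm + 1 / real (Suc k) - m k) \<longlonglongrightarrow> mm + 0 - mm"
      by (intro tendsto_intros m_lim LIMSEQ_Suc lim_1_over_n)
    then have "\<forall>\<^sub>F k in sequentially. mm + 1 / real (Suc k) - m k < \<eta>"
      using \<open>\<eta> > 0\<close> by (intro order_tendstoD) auto
    from eventually_happens'[OF sequentially_bot this]
    obtain K where K: "mm + 1 / real (Suc K) - m K < \<eta>" by (rule exE)
    show "\<exists>K. \<forall>k\<ge>K. \<forall>l\<ge>K. (J (T k) + J (T l)) / 2 - J (Mid (T k) (T l)) \<le> \<eta>"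
    proof (intro exI allI impI)
      fix k l assume kl: "K \<le> k" "K \<le> l"
      have J: "J (T i) \<le> mm + 1 / real (Suc K)" if "K \<le> i" for i
      proof -
        have "1 / real (Suc i) \<le> 1 / real (Suc K)" using that by (simp add: frac_le)
        then show ?thesis using T(2)[of i] m_mm[of i] by linarith
      qed
      have "Mid (T k) (T l) \<in> S K" using T(1)[of k] T(1)[of l] kl by (auto simp: S_def)
      define e where "e = mm + 1 / real (Suc K)"
      have Jk: "J (T k) \<le> e" and Jl: "J (T l) \<le> e" and Ke: "e - m K < \<eta>"
        using J[OF kl(1)] J[OF kl(2)] K unfolding e_def by blast+
      have Jm: "m K \<le> J (Mid (T k) (T l))" by (rule m_le) fact
      have "(J (T k) + J (T l)) / 2 \<le> (e + e) / 2" using Jk Jl by (intro divide_right_mono add_mono) auto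
      then have "(J (T k) + J (T l)) / 2 \<le> e" by simp
      then show "(J (T k) + J (T l)) / 2 - J (Mid (T k) (T l)) \<le> \<eta>" using Jm Ke by (meson diff_mono order_trans less_imp_le)
    qed
  qed
qed

context function_lattice
begin

lemma teval_X: "(\<And>n. f n \<in> X) \<Longrightarrow> teval f T \<in> X"
proof (induction T)
  case (Mid S T)
  then show ?case unfolding teval_Mid by (intro X_add X_cmult) auto
qed (auto simp: teval_Leaf)

lemma dual_teval: "g \<in> dual \<Longrightarrow> (\<And>n. f n \<in> X) \<Longrightarrow> g (teval f T) = tval (\<lambda>n. g (f n)) T"
proof (induction T)
  case (Mid S T)
  have "g (teval f (Mid S T)) = g (\<lambda>\<omega>. (1/2) * teval f S \<omega>) + g (\<lambda>\<omega>. (1/2) * teval f T \<omega>)"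
    unfolding teval_Mid using Mid.prems by (intro dual_add X_cmult teval_X)
  also have "\<dots> = (1/2) * g (teval f S) + (1/2) * g (teval f T)"
    using Mid.prems by (simp only: dual_cmult teval_X)
  finally show ?case using Mid by (simp add: add_divide_distrib)
qed (auto simp: teval_Leaf)

lemma N_teval: "(\<And>n. f n \<in> X) \<Longrightarrow> (\<And>n. N (f n) \<le> r) \<Longrightarrow> N (teval f T) \<le> r"
proof (induction T)
  case (Mid S T)
  have "N (teval f (Mid S T)) \<le> N (\<lambda>\<omega>. (1/2) * teval f S \<omega>) + N (\<lambda>\<omega>. (1/2) * teval f T \<omega>)"
    unfolding teval_Mid using Mid.prems by (intro N_add X_cmult teval_X)
  also have "\<dots> = (1/2) * N (teval f S) + (1/2) * N (teval f T)"
    using N_cmult[of "teval f S" "1/2"] N_cmult[of "teval f T" "1/2"] teval_X Mid.prems by simp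
  finally show ?case using Mid by simp
qed (auto simp: teval_Leaf)

section \<open>Positive elements, wuc sequences and V-sets\<close>

definition pos :: "('a \<Rightarrow> real) set" where
  "pos = {u. (\<forall>\<omega>. 0 \<le> u \<omega>) \<and> (\<lambda>\<omega>. complex_of_real (u \<omega>)) \<in> X}"

abbreviation NR :: "('a \<Rightarrow> real) \<Rightarrow> real" where
  "NR u \<equiv> N (\<lambda>\<omega>. complex_of_real (u \<omega>))"

lemma pos_nonneg: "u \<in> pos \<Longrightarrow> 0 \<le> u \<omega>"
  by (simp add: pos_def)

lemma pos_X: "u \<in> pos \<Longrightarrow> (\<lambda>\<omega>. complex_of_real (u \<omega>)) \<in> X"
  by (simp add: pos_def)

lemma pos_meas: assumes "u \<in> pos" shows "u \<in> borel_measurable M"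
proof -
  have "(\<lambda>\<omega>. Re (complex_of_real (u \<omega>))) \<in> borel_measurable M"
    using X_meas[OF pos_X[OF assms]] by measurable
  then show ?thesis by simp
qed

lemma dominated_X:
  assumes "u \<in> pos" "v \<in> borel_measurable M" "\<And>\<omega>. cmod (v \<omega>) \<le> u \<omega>"
  shows "v \<in> X" "N v \<le> NR u"
proof -
  have "cmod (v \<omega>) \<le> cmod (complex_of_real (u \<omega>))" for \<omega>
    using assms(3)[of \<omega>] by simp
  then show "v \<in> X" "N v \<le> NR u" using X_solid[OF pos_X] N_solid[OF pos_X] assms by auto
qed

lemma pos_le:
  assumes "u \<in> pos" "v \<in> borel_measurable M" "\<And>\<omega>. 0 \<le> v \<omega>" "\<And>\<omega>. v \<omega> \<le> u \<omega>"
  shows "v \<in> pos" "NR v \<le> NR u"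
  using dominated_X[OF assms(1), of "\<lambda>\<omega>. complex_of_real (v \<omega>)"] assms by (auto simp: pos_def)

lemma pos_add: "u \<in> pos \<Longrightarrow> v \<in> pos \<Longrightarrow> (\<lambda>\<omega>. u \<omega> + v \<omega>) \<in> pos"
  using X_add[of "\<lambda>\<omega>. complex_of_real (u \<omega>)" "\<lambda>\<omega>. complex_of_real (v \<omega>)"] by (auto simp: pos_def)

lemma pos_cmult: "u \<in> pos \<Longrightarrow> 0 \<le> t \<Longrightarrow> (\<lambda>\<omega>. t * u \<omega>) \<in> pos"
  using X_cmult[of "\<lambda>\<omega>. complex_of_real (u \<omega>)" "complex_of_real t"] by (auto simp: pos_def)

lemma pos_abs: assumes "f \<in> X" shows "(\<lambda>\<omega>. cmod (f \<omega>)) \<in> pos"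
proof -
  have "(\<lambda>\<omega>. complex_of_real (cmod (f \<omega>))) \<in> X"
    using X_meas[OF assms] by (intro X_solid[OF assms]) auto
  then show ?thesis by (simp add: pos_def)
qed

lemma pos_zero: "(\<lambda>_. 0) \<in> pos"
  using X_zero by (simp add: pos_def)

lemma pos_sum: "(\<And>i. i \<in> I \<Longrightarrow> u i \<in> pos) \<Longrightarrow> (\<lambda>\<omega>. \<Sum>i\<in>I. u i \<omega>) \<in> pos"
proof (induction I rule: infinite_finite_induct)
  case (insert i I)
  then show ?case using pos_add[of "u i" "\<lambda>\<omega>. \<Sum>i\<in>I. u i \<omega>"] by simp
qed (auto simp: pos_zero)

text \<open>Rotating each \<open>f i\<close> by the conjugate sign of \<open>g (f i)\<close> makes
  all terms of \<open>g v\<close> nonnegative, while \<open>v\<close> stays below the sum of the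
  moduli. A lattice bound thus replaces the usual supremum over signs.\<close>

lemma wuc_sequenceI:
  assumes f: "\<And>n. f n \<in> X" and C: "\<And>n. NR (\<lambda>\<omega>. \<Sum>i<n. cmod (f i \<omega>)) \<le> C"
  shows "wuc_sequence X N f"
  unfolding wuc_sequence_def
proof (intro conjI allI ballI)
  fix g assume g: "g \<in> dual"
  show "summable (\<lambda>n. cmod (g (f n)))"
  proof (rule summableI_nonneg_bounded)
    fix n
    define v where "v = (\<lambda>\<omega>. \<Sum>i<n. cnj (sgn (g (f i))) * f i \<omega>)"
    have v: "v \<in> X" unfolding v_def using f by (intro X_sum X_cmult)
    have "g v = (\<Sum>i<n. cnj (sgn (g (f i))) * g (f i))"
      unfolding v_def using dual_sum[OF g, of "{..<n}" "\<lambda>i \<omega>. cnj (sgn (g (f i))) * f i \<omega>"] X_cmult[OF f] dual_cmult[OF g f]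
      by simp
    also have "\<dots> = (\<Sum>i<n. complex_of_real (cmod (g (f i))))"
    proof (intro sum.cong refl)
      fix i
      have "cnj (g (f i)) * g (f i) = (complex_of_real (cmod (g (f i))))\<^sup>2"
        by (metis complex_norm_square mult.commute of_real_power)
      then show "cnj (sgn (g (f i))) * g (f i) = complex_of_real (cmod (g (f i)))"
        by (cases "g (f i) = 0") (simp_all add: sgn_eq field_simps power2_eq_square)
    qed
    finally have "(\<Sum>i<n. cmod (g (f i))) = cmod (g v)"
      by (simp add: sum_nonneg flip: of_real_sum)
    also have "\<dots> \<le> dnorm g * N v" using g v by (rule dnorm_bound)
    also have "\<dots> \<le> dnorm g * C"
    proof (intro mult_left_mono dnorm_nonneg[OF g])
      have "cmod (v \<omega>) \<le> (\<Sum>i<n. cmod (f i \<omega>))" for \<omega>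
        unfolding v_def by (rule order_trans[OF norm_sum sum_mono]) (auto simp: norm_mult norm_sgn)
      then have "N v \<le> NR (\<lambda>\<omega>. \<Sum>i<n. cmod (f i \<omega>))"
        using f X_meas[OF v] by (intro dominated_X(2) pos_sum pos_abs)
      then show "N v \<le> C" using C[of n] by linarith
    qed
    finally show "(\<Sum>i<n. cmod (g (f i))) \<le> dnorm g * C" .
  qed auto
qed (rule f)

text \<open>The premise of \<open>property_V\<close>; such sets are usually called V-sets.\<close>

definition V_set :: "(('a \<Rightarrow> complex) \<Rightarrow> complex) set \<Rightarrow> bool" where
  "V_set A \<longleftrightarrow> A \<subseteq> dual \<and> (\<forall>x. wuc_sequence X N x \<longrightarrow>
     (\<forall>\<epsilon>>0. \<exists>n0. \<forall>n\<ge>n0. \<forall>g\<in>A. cmod (g (x n)) \<le> \<epsilon>))"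

lemma V_setD:
  assumes "V_set A" "wuc_sequence X N x" "\<epsilon> > 0"
  obtains n0 where "\<And>n g. n \<ge> n0 \<Longrightarrow> g \<in> A \<Longrightarrow> cmod (g (x n)) \<le> \<epsilon>"
  using assms unfolding V_set_def by meson

lemma V_set_dual: "V_set A \<Longrightarrow> g \<in> A \<Longrightarrow> g \<in> dual"
  unfolding V_set_def by blast

lemma V_set_mono: "V_set A \<Longrightarrow> A' \<subseteq> A \<Longrightarrow> V_set A'"
  unfolding V_set_def by (meson subset_iff)

text \<open>A single functional tends to 0 along a wuc sequence, its values being absolutely
  summable.\<close>

lemma V_set_translate:
  assumes A: "V_set A" and h: "h \<in> dual"
  shows "V_set ((\<lambda>g f. g f - h f) ` A)"
  unfolding V_set_def
proof (intro conjI allI impI)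
  show "(\<lambda>g f. g f - h f) ` A \<subseteq> dual" using V_set_dual[OF A] dual_diff_mem[OF _ h] by auto
  fix x and \<epsilon> :: real assume x: "wuc_sequence X N x" and \<epsilon>: "\<epsilon> > 0"
  obtain n0 where n0: "\<And>n g. n \<ge> n0 \<Longrightarrow> g \<in> A \<Longrightarrow> cmod (g (x n)) \<le> \<epsilon> / 2"
    using V_setD[OF A x, of "\<epsilon> / 2"] \<epsilon> by auto
  have "summable (\<lambda>n. cmod (h (x n)))" using x h by (auto simp: wuc_sequence_def)
  then have "\<forall>\<^sub>F n in sequentially. cmod (h (x n)) < \<epsilon> / 2"
    using \<epsilon> by (intro order_tendstoD(2)[OF summable_LIMSEQ_zero]) auto
  then obtain n1 where n1: "\<And>n. n \<ge> n1 \<Longrightarrow> cmod (h (x n)) < \<epsilon> / 2" by (auto simp: eventually_sequentially)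
  have "cmod (g (x n) - h (x n)) \<le> \<epsilon>" if "n \<ge> max n0 n1" "g \<in> A" for n g
    using norm_triangle_ineq4[of "g (x n)" "h (x n)"] n0[of n g] n1[of n] that by auto
  then show "\<exists>n0. \<forall>n\<ge>n0. \<forall>g\<in>(\<lambda>g f. g f - h f) ` A. cmod (g (x n)) \<le> \<epsilon>" by blast
qed

text \<open>Normalised to seminorm \<open>(1 / 2) ^ n\<close>, counterexamples to the bound
  \<open>4 ^ n\<close> form a wuc sequence because their seminorms are summable; yet the functionals
  exceed \<open>2 ^ n\<close> on them.\<close>

lemma V_set_bounded:
  assumes A: "V_set A"
  obtains B where "B \<ge> 0" "\<And>g f. g \<in> A \<Longrightarrow> f \<in> X \<Longrightarrow> cmod (g f) \<le> B * N f"
proof (rule ccontr)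
  assume "\<not> thesis"
  then have "\<exists>g\<in>A. \<exists>f\<in>X. cmod (g f) > 4 ^ n * N f" for n :: nat
    using that[of "4 ^ n"] by (meson not_le zero_le_numeral zero_le_power)
  then obtain g f where gf: "\<And>n. g n \<in> A" "\<And>n. f n \<in> X" "\<And>n::nat. cmod (g n (f n)) > 4 ^ n * N (f n)" by metis
  have Nf: "N (f n) > 0" for n :: nat
  proof (rule ccontr)
    assume "\<not> N (f n) > 0"
    then have "N (f n) = 0" using N_nonneg[OF gf(2)[of n]] by simp
    then show False using gf(3)[of n] dnorm_bound[OF V_set_dual[OF A gf(1)] gf(2), of n n] by simp
  qed
  define x where "x n = (\<lambda>\<omega>. complex_of_real (1 / (2 ^ n * N (f n))) * f n \<omega>)" for n
  have xX: "x n \<in> X" for n unfolding x_def by (rule X_cmult[OF gf(2)])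
  have Nx: "N (x n) = (1 / 2) ^ n" for n
    unfolding x_def N_cmult[OF gf(2)] using Nf[of n] by (simp add: norm_divide norm_mult norm_power power_one_over)
  have "wuc_sequence X N x" unfolding wuc_sequence_def
  proof (intro conjI allI ballI xX)
    fix h assume h: "h \<in> dual"
    show "summable (\<lambda>n. cmod (h (x n)))"
    proof (rule summable_comparison_test')
      show "summable (\<lambda>n. dnorm h * (1 / 2) ^ n)" by (intro summable_mult summable_geometric) auto
      show "norm (cmod (h (x n))) \<le> dnorm h * (1 / 2) ^ n" for n
        using dnorm_bound[OF h xX, of n] by (simp add: Nx)
    qed
  qed
  then obtain n0 where n0: "\<And>n h. n \<ge> n0 \<Longrightarrow> h \<in> A \<Longrightarrow> cmod (h (x n)) \<le> 1 / 2"
    by (rule V_setD[OF A, of x "1/2"]) auto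
  have "g n0 (x n0) = complex_of_real (1 / (2 ^ n0 * N (f n0))) * g n0 (f n0)"
    unfolding x_def by (rule dual_cmult[OF V_set_dual[OF A gf(1)] gf(2)])
  then have "cmod (g n0 (x n0)) = cmod (g n0 (f n0)) / (2 ^ n0 * N (f n0))"
    using Nf[of n0] by (simp add: norm_divide norm_mult norm_power)
  also have "\<dots> > 4 ^ n0 * N (f n0) / (2 ^ n0 * N (f n0))"
    using gf(3) Nf[of n0] by (intro divide_strict_right_mono) auto
  also have "4 ^ n0 * N (f n0) / (2 ^ n0 * N (f n0)) = 2 ^ n0"
    using Nf[of n0] by (simp add: power_divide[symmetric])
  finally have "cmod (g n0 (x n0)) > 2 ^ n0" .
  moreover have "(2::real) ^ n0 \<ge> 1" by simp
  ultimately show False using n0[OF order_refl gf(1), of n0] by linarith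
qed

section \<open>The modulus of a functional\<close>

text \<open>\<open>absf h\<close> is the lattice modulus of the functional \<open>h\<close>.\<close>

definition absf :: "(('a \<Rightarrow> complex) \<Rightarrow> complex) \<Rightarrow> ('a \<Rightarrow> real) \<Rightarrow> real" where
  "absf h u = (SUP v\<in>{v \<in> borel_measurable M. \<forall>\<omega>. cmod (v \<omega>) \<le> u \<omega>}. cmod (h v))"

lemma absf_bdd:
  assumes "h \<in> dual" "u \<in> pos"
  shows "bdd_above ((\<lambda>v. cmod (h v)) ` {v \<in> borel_measurable M. \<forall>\<omega>. cmod (v \<omega>) \<le> u \<omega>})"
proof (rule bdd_aboveI2)
  fix v assume "v \<in> {v \<in> borel_measurable M. \<forall>\<omega>. cmod (v \<omega>) \<le> u \<omega>}"
  then have "v \<in> X" "N v \<le> NR u" using dominated_X[OF assms(2)] by auto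
  then show "cmod (h v) \<le> dnorm h * NR u"
    using dnorm_bound[OF assms(1)] mult_left_mono[OF _ dnorm_nonneg[OF assms(1)]] order_trans by blast
qed

lemma absf_upper:
  "h \<in> dual \<Longrightarrow> u \<in> pos \<Longrightarrow> v \<in> borel_measurable M \<Longrightarrow> (\<And>\<omega>. cmod (v \<omega>) \<le> u \<omega>) \<Longrightarrow> cmod (h v) \<le> absf h u"
  unfolding absf_def by (rule cSUP_upper[OF _ absf_bdd]) auto

lemma absf_least:
  assumes "u \<in> pos" "\<And>v. v \<in> borel_measurable M \<Longrightarrow> (\<And>\<omega>. cmod (v \<omega>) \<le> u \<omega>) \<Longrightarrow> cmod (h v) \<le> c"
  shows "absf h u \<le> c"
  unfolding absf_def
proof (rule cSUP_least)
  show "{v \<in> borel_measurable M. \<forall>\<omega>. cmod (v \<omega>) \<le> u \<omega>} \<noteq> {}"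
    using pos_nonneg[OF assms(1)] by (auto intro!: exI[of _ "\<lambda>_. 0"])
qed (use assms(2) in auto)

lemma absf_nonneg: "h \<in> dual \<Longrightarrow> u \<in> pos \<Longrightarrow> 0 \<le> absf h u"
  using absf_upper[of h u "\<lambda>_. 0"] pos_nonneg[of u] by (simp add: dual_zero)

lemma absf_mono:
  assumes "h \<in> dual" "u \<in> pos" "v \<in> pos" "\<And>\<omega>. u \<omega> \<le> v \<omega>"
  shows "absf h u \<le> absf h v"
  by (rule absf_least[OF assms(2)], rule absf_upper[OF assms(1,3)]) (use assms(4) order_trans in blast)+

lemma absf_bound:
  assumes h: "h \<in> dual" and B: "\<And>f. f \<in> X \<Longrightarrow> cmod (h f) \<le> B * N f" "B \<ge> 0" and u: "u \<in> pos"
  shows "absf h u \<le> B * NR u"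
proof (rule absf_least[OF u])
  fix v assume "v \<in> borel_measurable M" "\<And>\<omega>. cmod (v \<omega>) \<le> u \<omega>"
  then have "v \<in> X" "N v \<le> NR u" using dominated_X[OF u] by auto
  then show "cmod (h v) \<le> B * NR u" using B mult_left_mono order_trans by blast
qed

lemma absf_cmult:
  assumes h: "h \<in> dual" and u: "u \<in> pos" and t: "t > 0"
  shows "absf h (\<lambda>\<omega>. t * u \<omega>) = t * absf h u"
proof -
  have le: "t * absf h u \<le> absf h (\<lambda>\<omega>. t * u \<omega>)" if u: "u \<in> pos" and t: "t > 0" for u t
  proof -
    have "absf h u \<le> absf h (\<lambda>\<omega>. t * u \<omega>) / t"
    proof (rule absf_least[OF u])
      fix v assume v: "v \<in> borel_measurable M" "\<And>\<omega>. cmod (v \<omega>) \<le> u \<omega>"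
      have "cmod (h (\<lambda>\<omega>. of_real t * v \<omega>)) \<le> absf h (\<lambda>\<omega>. t * u \<omega>)"
        using v t pos_cmult[OF u] by (intro absf_upper[OF h]) (auto simp: norm_mult)
      moreover have "h (\<lambda>\<omega>. of_real t * v \<omega>) = of_real t * h v"
        using dominated_X(1)[OF u v] by (rule dual_cmult[OF h])
      ultimately show "cmod (h v) \<le> absf h (\<lambda>\<omega>. t * u \<omega>) / t" using t by (simp add: norm_mult field_simps)
    qed
    then show ?thesis using t by (simp add: field_simps)
  qed
  have "(1 / t) * absf h (\<lambda>\<omega>. t * u \<omega>) \<le> absf h (\<lambda>\<omega>. (1 / t) * (t * u \<omega>))"
    using u t pos_cmult by (intro le) auto
  moreover have "(\<lambda>\<omega>. (1 / t) * (t * u \<omega>)) = u" using t by auto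
  ultimately show ?thesis using le[OF u t] t by (simp add: field_simps)
qed

text \<open>Riesz decomposition: a function below \<open>u + w\<close> splits in proportion to
  \<open>u\<close> and \<open>w\<close>. For the converse, \<open>v1\<close> and \<open>v2\<close>
  are rotated so that the two values of \<open>h\<close> add up without cancellation.\<close>

lemma absf_add:
  assumes h: "h \<in> dual" and u: "u \<in> pos" and w: "w \<in> pos"
  shows "absf h (\<lambda>\<omega>. u \<omega> + w \<omega>) = absf h u + absf h w"
proof (rule antisym)
  have uw: "(\<lambda>\<omega>. u \<omega> + w \<omega>) \<in> pos" by (rule pos_add[OF u w])
  note [measurable] = pos_meas[OF u] pos_meas[OF w]
  have u0: "0 \<le> u \<omega>" and w0: "0 \<le> w \<omega>" for \<omega> using u w by (auto simp: pos_nonneg)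
  show "absf h (\<lambda>\<omega>. u \<omega> + w \<omega>) \<le> absf h u + absf h w"
  proof (rule absf_least[OF uw])
    fix v assume v [measurable]: "v \<in> borel_measurable M" and vb: "\<And>\<omega>. cmod (v \<omega>) \<le> u \<omega> + w \<omega>"
    \<comment> \<open>Where \<open>u + w\<close> vanishes so does \<open>v\<close>, hence the value
      0 of the quotient there is the right one.\<close>
    define v1 where "v1 = (\<lambda>\<omega>. of_real (u \<omega> / (u \<omega> + w \<omega>)) * v \<omega>)"
    define v2 where "v2 = (\<lambda>\<omega>. of_real (w \<omega> / (u \<omega> + w \<omega>)) * v \<omega>)"
    have [measurable]: "v1 \<in> borel_measurable M" "v2 \<in> borel_measurable M" unfolding v1_def v2_def by measurable
    have part: "cmod (of_real (a / (a + b)) * z) \<le> a" if "0 \<le> a" "0 \<le> b" "cmod z \<le> a + b" for a b and z :: complex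
    proof (cases "a + b = 0")
      case False
      then have "a + b > 0" using that by linarith
      have "cmod (of_real (a / (a + b)) * z) = a / (a + b) * cmod z" using that by (simp add: norm_mult norm_divide flip: of_real_add)
      also have "\<dots> \<le> a / (a + b) * (a + b)" using that by (intro mult_left_mono) auto
      finally show ?thesis using \<open>a + b > 0\<close> by simp
    qed (use that in auto)
    have b1: "cmod (v1 \<omega>) \<le> u \<omega>" for \<omega> unfolding v1_def by (rule part[OF u0 w0 vb])
    have b2: "cmod (v2 \<omega>) \<le> w \<omega>" for \<omega>
      unfolding v2_def using part[OF w0 u0, of "v \<omega>" \<omega> \<omega>] vb[of \<omega>] by (simp add: add.commute)
    have "v = (\<lambda>\<omega>. v1 \<omega> + v2 \<omega>)"
    proof
      fix \<omega> show "v \<omega> = v1 \<omega> + v2 \<omega>"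
      proof (cases "u \<omega> + w \<omega> = 0")
        case True
        then show ?thesis using vb[of \<omega>] by (simp add: v1_def v2_def)
      next
        case False
        then have "u \<omega> / (u \<omega> + w \<omega>) + w \<omega> / (u \<omega> + w \<omega>) = 1" by (simp add: add_divide_distrib[symmetric])
        then show ?thesis unfolding v1_def v2_def by (metis distrib_right mult_1 of_real_1 of_real_add)
      qed
    qed
    then have "h v = h v1 + h v2"
      using dual_add[OF h, of v1 v2] dominated_X(1)[OF u, of v1] dominated_X(1)[OF w, of v2] b1 b2 by simp
    then have "cmod (h v) \<le> cmod (h v1) + cmod (h v2)" by (simp add: norm_triangle_ineq)
    also have "\<dots> \<le> absf h u + absf h w" using b1 b2 by (intro add_mono absf_upper[OF h] u w) auto
    finally show "cmod (h v) \<le> absf h u + absf h w" .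
  qed
  have both: "cmod (h v1) + cmod (h v2) \<le> absf h (\<lambda>\<omega>. u \<omega> + w \<omega>)"
    if v1: "v1 \<in> borel_measurable M" "\<And>\<omega>. cmod (v1 \<omega>) \<le> u \<omega>"
      and v2: "v2 \<in> borel_measurable M" "\<And>\<omega>. cmod (v2 \<omega>) \<le> w \<omega>" for v1 v2
  proof -
    note [measurable] = v1(1) v2(1)
    define a where "a v = (if h v = 0 then 0 else cnj (sgn (h v)))" for v
    have a: "a v * h v = of_real (cmod (h v))" "cmod (a v) \<le> 1" for v
    proof -
      have "cnj (h v) * h v = (complex_of_real (cmod (h v)))\<^sup>2"
        by (metis complex_norm_square mult.commute of_real_power)
      then show "a v * h v = of_real (cmod (h v))"
        by (simp add: a_def sgn_eq field_simps power2_eq_square)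
    qed (simp add: a_def norm_sgn)
    have X12: "v1 \<in> X" "v2 \<in> X" using dominated_X(1)[OF u v1] dominated_X(1)[OF w v2] by auto
    define v where "v = (\<lambda>\<omega>. a v1 * v1 \<omega> + a v2 * v2 \<omega>)"
    have "h v = a v1 * h v1 + a v2 * h v2"
      unfolding v_def using dual_add[OF h X_cmult[OF X12(1)] X_cmult[OF X12(2)]] dual_cmult[OF h X12(1)] dual_cmult[OF h X12(2)]
      by simp
    then have "h v = of_real (cmod (h v1) + cmod (h v2))" by (simp add: a)
    then have "cmod (h v1) + cmod (h v2) = cmod (h v)" by (simp flip: of_real_add)
    also have "\<dots> \<le> absf h (\<lambda>\<omega>. u \<omega> + w \<omega>)"
    proof (rule absf_upper[OF h uw])
      show "v \<in> borel_measurable M" unfolding v_def by measurable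
      fix \<omega>
      have "cmod (a v1 * v1 \<omega>) \<le> u \<omega>" "cmod (a v2 * v2 \<omega>) \<le> w \<omega>"
        unfolding norm_mult using mult_mono[OF a(2)[of v1] v1(2)[of \<omega>]] mult_mono[OF a(2)[of v2] v2(2)[of \<omega>]] by auto
      then show "cmod (v \<omega>) \<le> u \<omega> + w \<omega>" unfolding v_def by (intro norm_triangle_mono)
    qed
    finally show ?thesis .
  qed
  have "absf h u \<le> absf h (\<lambda>\<omega>. u \<omega> + w \<omega>) - absf h w"
  proof (rule absf_least[OF u])
    fix v1 assume v1: "v1 \<in> borel_measurable M" "\<And>\<omega>. cmod (v1 \<omega>) \<le> u \<omega>"
    have "absf h w \<le> absf h (\<lambda>\<omega>. u \<omega> + w \<omega>) - cmod (h v1)"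
      by (rule absf_least[OF w]) (use both[OF v1] in \<open>simp add: le_diff_eq add.commute\<close>)
    then show "cmod (h v1) \<le> absf h (\<lambda>\<omega>. u \<omega> + w \<omega>) - absf h w" by simp
  qed
  then show "absf h u + absf h w \<le> absf h (\<lambda>\<omega>. u \<omega> + w \<omega>)" by simp
qed

lemma absf_sum:
  assumes h: "h \<in> dual" and "\<And>i. i \<in> I \<Longrightarrow> u i \<in> pos"
  shows "absf h (\<lambda>\<omega>. \<Sum>i\<in>I. u i \<omega>) = (\<Sum>i\<in>I. absf h (u i))"
proof -
  have z: "absf h (\<lambda>_. 0) = 0" using absf_add[OF h pos_zero pos_zero] by simp
  show ?thesis using assms(2)
  proof (induction I rule: infinite_finite_induct)
    case (insert i I)
    then show ?case using absf_add[OF h, of "u i" "\<lambda>\<omega>. \<Sum>i\<in>I. u i \<omega>"] pos_sum[of I u] by simp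
  qed (auto simp: z)
qed

text \<open>The increments of a monotone order bounded sequence form a weakly unconditionally Cauchy
  series, so a V-set is uniformly order continuous along such sequences.\<close>

lemma V_set_monotone:
  assumes h: "V_set (range h)" and x: "x \<in> pos"
    and w: "\<And>l. w l \<in> borel_measurable M" "\<And>l \<omega>. 0 \<le> w l \<omega>" "\<And>l \<omega>. w l \<omega> \<le> w (Suc l) \<omega>" "\<And>l \<omega>. w l \<omega> \<le> x \<omega>"
    and \<epsilon>: "\<epsilon> > 0"
  shows "\<exists>L. \<forall>l\<ge>L. \<forall>n. absf (h n) (\<lambda>\<omega>. w l \<omega> - w L \<omega>) \<le> \<epsilon>"
proof (rule ccontr)
  have hd: "h n \<in> dual" for n using V_set_dual[OF h] by auto
  note [measurable] = w(1)
  have w_mono: "w k \<omega> \<le> w l \<omega>" if "k \<le> l" for k l \<omega> using that w(3) by (rule lift_Suc_mono_le[rotated])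
  have pos_d: "(\<lambda>\<omega>. w l \<omega> - w k \<omega>) \<in> pos" if "k \<le> l" for k l
  proof (rule pos_le(1)[OF x])
    show "(\<lambda>\<omega>. w l \<omega> - w k \<omega>) \<in> borel_measurable M" by measurable
    show "0 \<le> w l \<omega> - w k \<omega>" for \<omega> using w_mono[OF that] by simp
    show "w l \<omega> - w k \<omega> \<le> x \<omega>" for \<omega> using w(2)[of k \<omega>] w(4)[of l \<omega>] by linarith
  qed
  assume "\<not> ?thesis"
  then have "\<forall>L. \<exists>l n. l \<ge> L \<and> \<epsilon> < absf (h n) (\<lambda>\<omega>. w l \<omega> - w L \<omega>)" by (auto simp: not_le)
  then obtain s n where s: "\<And>L. s L \<ge> L" "\<And>L. \<epsilon> < absf (h (n L)) (\<lambda>\<omega>. w (s L) \<omega> - w L \<omega>)" by metis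
  have "\<exists>v. v \<in> borel_measurable M \<and> (\<forall>\<omega>. cmod (v \<omega>) \<le> w (s L) \<omega> - w L \<omega>) \<and> \<epsilon> < cmod (h (n L) v)" for L
  proof (rule ccontr)
    assume "\<not> ?thesis"
    then have "absf (h (n L)) (\<lambda>\<omega>. w (s L) \<omega> - w L \<omega>) \<le> \<epsilon>"
      by (intro absf_least pos_d s(1)) (auto simp: not_less)
    then show False using s(2)[of L] by simp
  qed
  then obtain v where v: "\<And>L. v L \<in> borel_measurable M" "\<And>L \<omega>. cmod (v L \<omega>) \<le> w (s L) \<omega> - w L \<omega>"
    "\<And>L. \<epsilon> < cmod (h (n L) (v L))" by metis
  \<comment> \<open>Following \<open>s\<close> from 0 chains the index intervals from
    \<open>L\<close> to \<open>s L\<close>: the functions \<open>v (r k)\<close> are bounded by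
    consecutive increments of \<open>w\<close>, and the sums of their moduli telescope below
    \<open>x\<close>.\<close>
  define r where "r k = (s ^^ k) 0" for k
  have r: "r (Suc k) = s (r k)" for k by (simp add: r_def)
  have "wuc_sequence X N (\<lambda>k. v (r k))"
  proof (rule wuc_sequenceI)
    show vX: "v (r k) \<in> X" for k by (rule dominated_X(1)[OF pos_d[OF s(1)] v(1,2)])
    fix m
    have "(\<Sum>k<m. cmod (v (r k) \<omega>)) \<le> x \<omega>" for \<omega>
    proof -
      have "(\<Sum>k<m. cmod (v (r k) \<omega>)) \<le> (\<Sum>k<m. w (r (Suc k)) \<omega> - w (r k) \<omega>)"
        using v(2) by (intro sum_mono) (simp add: r)
      also have "\<dots> = w (r m) \<omega> - w (r 0) \<omega>" by (rule sum_lessThan_telescope)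
      also have "\<dots> \<le> x \<omega>" using w(2)[of "r 0" \<omega>] w(4)[of "r m" \<omega>] by linarith
      finally show ?thesis .
    qed
    then show "NR (\<lambda>\<omega>. \<Sum>k<m. cmod (v (r k) \<omega>)) \<le> NR x"
      using v(1) by (intro pos_le(2)[OF x]) (auto intro!: sum_nonneg)
  qed
  from V_setD[OF h this \<epsilon>] obtain n0 where "\<And>k g. k \<ge> n0 \<Longrightarrow> g \<in> range h \<Longrightarrow> cmod (g (v (r k))) \<le> \<epsilon>" by blast
  from this[OF order_refl rangeI, of "n (r n0)"] v(3)[of "r n0"] show False by simp
qed

lemma V_set_antimono:
  assumes h: "V_set (range h)" and x: "x \<in> pos"
    and w: "\<And>l. w l \<in> borel_measurable M" "\<And>l \<omega>. 0 \<le> w l \<omega>" "\<And>l \<omega>. w (Suc l) \<omega> \<le> w l \<omega>" "\<And>l \<omega>. w l \<omega> \<le> x \<omega>"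
    and \<epsilon>: "\<epsilon> > 0"
  shows "\<exists>L. \<forall>l\<ge>L. \<forall>n. absf (h n) (\<lambda>\<omega>. w L \<omega> - w l \<omega>) \<le> \<epsilon>"
proof -
  have "\<exists>L. \<forall>l\<ge>L. \<forall>n. absf (h n) (\<lambda>\<omega>. (x \<omega> - w l \<omega>) - (x \<omega> - w L \<omega>)) \<le> \<epsilon>"
    using w pos_meas[OF x] by (intro V_set_monotone[OF h x _ _ _ _ \<epsilon>]) auto
  then show ?thesis by simp
qed

end

section \<open>Convex compactness of order intervals\<close>

locale dual_sequence = function_lattice +
  fixes h :: "nat \<Rightarrow> ('a \<Rightarrow> complex) \<Rightarrow> complex"
  assumes V: "V_set (range h)"
begin

lemma h_dual: "h n \<in> dual"
  using V_set_dual[OF V] by auto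

text \<open>One positive functional that controls every modulus \<open>absf (h n)\<close>, at the
  price of the factor \<open>2 ^ n\<close> in \<open>lam_ge\<close>. The series converges because a
  V-set is bounded.\<close>

definition lam :: "('a \<Rightarrow> real) \<Rightarrow> real" where
  "lam u = (\<Sum>n. (1 / 2) ^ n * absf (h n) u)"

lemma lam_summable: assumes u: "u \<in> pos" shows "summable (\<lambda>n. (1 / 2) ^ n * absf (h n) u)"
proof -
  obtain B where B: "B \<ge> 0" "\<And>g f. g \<in> range h \<Longrightarrow> f \<in> X \<Longrightarrow> cmod (g f) \<le> B * N f"
    using V_set_bounded[OF V] by blast
  show ?thesis
  proof (rule summable_comparison_test')
    show "summable (\<lambda>n. (1 / 2 :: real) ^ n * (B * NR u))" by (intro summable_mult2 summable_geometric) auto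
    show "norm ((1 / 2) ^ n * absf (h n) u) \<le> (1 / 2) ^ n * (B * NR u)" for n
      using absf_nonneg[OF h_dual u, of n] absf_bound[OF h_dual _ B(1) u, of n] B(2)[of "h n"] by (simp add: abs_mult)
  qed
qed

lemma lam_ge: assumes u: "u \<in> pos" shows "absf (h n) u \<le> 2 ^ n * lam u"
proof -
  have "(\<Sum>k\<in>{n}. (1 / 2) ^ k * absf (h k) u) \<le> lam u"
    unfolding lam_def using lam_summable[OF u] absf_nonneg[OF h_dual u] by (intro sum_le_suminf) auto
  then have "2 ^ n * ((1 / 2) ^ n * absf (h n) u) \<le> 2 ^ n * lam u" by (intro mult_left_mono) auto
  moreover have "2 ^ n * ((1 / 2) ^ n * absf (h n) u) = absf (h n) u"
    by (simp add: power_one_over)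
  ultimately show ?thesis by simp
qed

lemma lam_nonneg: "u \<in> pos \<Longrightarrow> 0 \<le> lam u"
  unfolding lam_def by (intro suminf_nonneg lam_summable mult_nonneg_nonneg absf_nonneg h_dual) auto

lemma lam_add: "u \<in> pos \<Longrightarrow> v \<in> pos \<Longrightarrow> lam (\<lambda>\<omega>. u \<omega> + v \<omega>) = lam u + lam v"
  unfolding lam_def by (subst suminf_add[OF lam_summable lam_summable]) (auto simp: absf_add[OF h_dual] distrib_left)

lemma lam_cmult: "u \<in> pos \<Longrightarrow> t > 0 \<Longrightarrow> lam (\<lambda>\<omega>. t * u \<omega>) = t * lam u"
  unfolding lam_def by (subst suminf_mult[OF lam_summable, symmetric]) (auto simp: absf_cmult[OF h_dual] mult_ac)

lemma lam_mono: "u \<in> pos \<Longrightarrow> v \<in> pos \<Longrightarrow> (\<And>\<omega>. u \<omega> \<le> v \<omega>) \<Longrightarrow> lam u \<le> lam v"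
  unfolding lam_def by (intro suminf_le lam_summable mult_left_mono absf_mono h_dual) auto

lemma lam_sum: "(\<And>i. i \<in> I \<Longrightarrow> u i \<in> pos) \<Longrightarrow> lam (\<lambda>\<omega>. \<Sum>i\<in>I. u i \<omega>) = (\<Sum>i\<in>I. lam (u i))"
proof (induction I rule: infinite_finite_induct)
  case (insert i I)
  then show ?case using lam_add[of "u i" "\<lambda>\<omega>. \<Sum>i\<in>I. u i \<omega>"] pos_sum[of I u] by simp
qed (use lam_add[OF pos_zero pos_zero] in auto)

text \<open>Order intervals are convexly compact for the seminorm \<open>SUP n. absf (h n)\<close>.
  Minimising the Hilbert seminorm \<open>lam (|y|^2 / x)\<close> gives convex combinations that are
  Cauchy for \<open>lam\<close>; order continuity upgrades this to uniformity in \<open>n\<close>, because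
  all later differences are dominated by partial sums that increase in one index
  and whose minima decrease in the other.\<close>

lemma order_interval_lam_Cauchy:
  assumes x: "x \<in> pos" and xp: "\<And>\<omega>. 0 < x \<omega>"
    and y: "\<And>l. y l \<in> borel_measurable M" "\<And>l \<omega>. cmod (y l \<omega>) \<le> x \<omega>"
  shows "\<exists>T. (\<forall>k. leaves (T k) \<subseteq> {k..}) \<and>
    (\<forall>\<eta>>0. \<exists>K. \<forall>k\<ge>K. \<forall>l\<ge>K. lam (\<lambda>\<omega>. cmod (teval y (T k) \<omega> - teval y (T l) \<omega>)) \<le> \<eta>)"
proof -
  note [measurable] = pos_meas[OF x]
  have yX: "y l \<in> X" for l using dominated_X(1)[OF x y] .
  have te [measurable]: "teval y T \<in> borel_measurable M" for T using X_meas[OF teval_X[OF yX]] .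
  have tb: "cmod (teval y T \<omega>) \<le> x \<omega>" for T \<omega>
    using tval_near[of T "\<lambda>n. y n \<omega>" 0 "x \<omega>"] y(2) by (simp add: teval_def)
  \<comment> \<open>Dividing by \<open>x\<close> keeps the square inside the lattice, below
    \<open>x\<close>; its \<open>lam\<close> is a quadratic form, so the parallelogram identity
    gives the midpoint defect as \<open>lam (d k l)\<close> exactly.\<close>
  define q where "q T = (\<lambda>\<omega>. (cmod (teval y T \<omega>))\<^sup>2 / x \<omega>)" for T
  have q_le: "q T \<omega> \<le> x \<omega>" for T \<omega>
  proof -
    have "(cmod (teval y T \<omega>))\<^sup>2 \<le> (x \<omega>)\<^sup>2" using tb by (intro power_mono) auto
    then show ?thesis using xp[of \<omega>] by (simp add: q_def power2_eq_square field_simps)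
  qed
  have q_pos: "q T \<in> pos" for T
  proof (rule pos_le(1)[OF x _ _ q_le])
    show "q T \<in> borel_measurable M" unfolding q_def by measurable
    show "0 \<le> q T \<omega>" for \<omega> using xp[of \<omega>] by (simp add: q_def)
  qed
  define J where "J T = lam (q T)" for T
  have J0: "0 \<le> J T" and Jx: "J T \<le> lam x" for T
    using lam_nonneg[OF q_pos] lam_mono[OF q_pos x q_le] by (auto simp: J_def)
  obtain T where T: "\<And>k. leaves (T k) \<subseteq> {k..}"
    "\<And>\<eta>. \<eta> > 0 \<Longrightarrow> \<exists>K. \<forall>k\<ge>K. \<forall>l\<ge>K. (J (T k) + J (T l)) / 2 - J (Mid (T k) (T l)) \<le> \<eta>"
    using midpoint_minimise[of J "lam x", OF J0 Jx] by blast
  define d where "d k l = (\<lambda>\<omega>. (cmod (teval y (T k) \<omega> - teval y (T l) \<omega>))\<^sup>2 / (4 * x \<omega>))" for k l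
  have d_eq: "(1/2) * q (T k) \<omega> + (1/2) * q (T l) \<omega> = q (Mid (T k) (T l)) \<omega> + d k l \<omega>" for k l \<omega>
  proof -
    define a where "a = teval y (T k) \<omega>"
    define b where "b = teval y (T l) \<omega>"
    have "(cmod a)\<^sup>2 / 2 + (cmod b)\<^sup>2 / 2 = (cmod ((1/2) * a + (1/2) * b))\<^sup>2 + (cmod (a - b))\<^sup>2 / 4"
      unfolding cmod_power2 by (simp add: power2_eq_square field_simps)
    then have "((cmod a)\<^sup>2 / 2 + (cmod b)\<^sup>2 / 2) / x \<omega> = ((cmod ((1/2) * a + (1/2) * b))\<^sup>2 + (cmod (a - b))\<^sup>2 / 4) / x \<omega>"
      by simp
    then show ?thesis by (simp add: q_def d_def teval_Mid a_def[symmetric] b_def[symmetric] add_divide_distrib)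
  qed
  have d_pos: "d k l \<in> pos" for k l
  proof (rule pos_le(1)[OF x])
    show "d k l \<in> borel_measurable M" unfolding d_def by measurable
    show "0 \<le> d k l \<omega>" for \<omega> using xp[of \<omega>] by (simp add: d_def)
    show "d k l \<omega> \<le> x \<omega>" for \<omega>
      using d_eq[of k \<omega> l] q_le[of "T k" \<omega>] q_le[of "T l" \<omega>] pos_nonneg[OF q_pos, of "Mid (T k) (T l)" \<omega>] by linarith
  qed
  have lam_d: "(J (T k) + J (T l)) / 2 - J (Mid (T k) (T l)) = lam (d k l)" for k l
  proof -
    have "(1/2) * J (T k) + (1/2) * J (T l) = lam (\<lambda>\<omega>. (1/2) * q (T k) \<omega> + (1/2) * q (T l) \<omega>)"
    proof -
      have half: "lam (\<lambda>\<omega>. (1/2) * q T \<omega>) = (1/2) * lam (q T)" for T by (rule lam_cmult[OF q_pos]) simp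
      show ?thesis unfolding J_def half[symmetric] by (rule lam_add[symmetric]; rule pos_cmult[OF q_pos]; simp)
    qed
    also have "\<dots> = J (Mid (T k) (T l)) + lam (d k l)"
      unfolding d_eq J_def by (rule lam_add[OF q_pos d_pos])
    finally show ?thesis by (simp add: add_divide_distrib)
  qed
  show ?thesis
  proof (intro exI[of _ T] conjI allI impI T(1))
    fix \<eta> :: real assume \<eta>: "\<eta> > 0"
    \<comment> \<open>Young's inequality
      \<open>e \<le> \<tau> * x + e\<^sup>2 / (4 * \<tau> * x)\<close> passes from the quadratic
      quantity back to the modulus; each of the two terms is allotted
      \<open>\<eta> / 2\<close>.\<close>
    define \<tau> where "\<tau> = \<eta> / (2 * (lam x + 1))"
    have lx: "lam x \<ge> 0" by (rule lam_nonneg[OF x])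
    have \<tau>: "\<tau> > 0" using \<eta> lx by (simp add: \<tau>_def)
    have "\<tau> * lam x \<le> \<eta> / 2" using \<eta> lx by (simp add: \<tau>_def field_simps)
    obtain K where K: "\<And>k l. k \<ge> K \<Longrightarrow> l \<ge> K \<Longrightarrow> lam (d k l) \<le> \<tau> * \<eta> / 2"
      using T(2)[of "\<tau> * \<eta> / 2"] \<tau> \<eta> unfolding lam_d by (meson half_gt_zero mult_pos_pos)
    have "lam (\<lambda>\<omega>. cmod (teval y (T k) \<omega> - teval y (T l) \<omega>)) \<le> \<eta>" if "k \<ge> K" "l \<ge> K" for k l
    proof -
      have "cmod (teval y (T k) \<omega> - teval y (T l) \<omega>) \<le> \<tau> * x \<omega> + (1 / \<tau>) * d k l \<omega>" for \<omega>
      proof -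
        define e where "e = cmod (teval y (T k) \<omega> - teval y (T l) \<omega>)"
        have "0 \<le> (e - 2 * \<tau> * x \<omega>)\<^sup>2 / (4 * \<tau> * x \<omega>)" using \<tau> xp[of \<omega>] by (intro divide_nonneg_nonneg) auto
        also have "\<dots> = e\<^sup>2 / (4 * \<tau> * x \<omega>) - e + \<tau> * x \<omega>"
          using \<tau> xp[of \<omega>] by (simp add: power2_eq_square field_simps)
        finally show ?thesis by (simp add: d_def e_def mult.assoc mult.left_commute)
      qed
      then have "lam (\<lambda>\<omega>. cmod (teval y (T k) \<omega> - teval y (T l) \<omega>)) \<le> lam (\<lambda>\<omega>. \<tau> * x \<omega> + (1 / \<tau>) * d k l \<omega>)"
        using \<tau> by (intro lam_mono pos_abs X_diff teval_X yX pos_add pos_cmult x d_pos) auto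
      also have "\<dots> = \<tau> * lam x + (1 / \<tau>) * lam (d k l)"
        using \<tau> lam_add[OF pos_cmult[OF x] pos_cmult[OF d_pos], of \<tau> "1 / \<tau>" k l] lam_cmult[OF x \<tau>]
          lam_cmult[OF d_pos, of "1 / \<tau>" k l] by simp
      also have "\<dots> \<le> \<eta> / 2 + (1 / \<tau>) * (\<tau> * \<eta> / 2)"
        using K[OF that] \<tau> \<open>\<tau> * lam x \<le> \<eta> / 2\<close> by (intro add_mono mult_left_mono) auto
      finally show ?thesis using \<tau> by simp
    qed
    then show "\<exists>K. \<forall>k\<ge>K. \<forall>l\<ge>K. lam (\<lambda>\<omega>. cmod (teval y (T k) \<omega> - teval y (T l) \<omega>)) \<le> \<eta>" by blast
  qed
qed

text \<open>For fixed \<open>n\<close> the tail beyond \<open>i\<close> has modulus at most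
  \<open>2 ^ n * (2 * (1 / 2) ^ i)\<close>, which is not uniform in \<open>n\<close>. Tails increase
  in their upper index, so each can be cut at some \<open>L i\<close> with an error uniform in
  \<open>n\<close>; the minima \<open>H\<close> of the cut tails decrease, so they are stationary up
  to \<open>e\<close> from some \<open>J\<close> on, again uniformly in \<open>n\<close>. Letting
  the index tend to infinity for each \<open>n\<close> separately then shows that \<open>H J\<close>
  itself is small for all \<open>n\<close>.\<close>

lemma lam_summable_uniform_Cauchy:
  assumes x: "x \<in> pos" and z: "\<And>j. z j \<in> borel_measurable M" "\<And>j \<omega>. cmod (z j \<omega>) \<le> x \<omega>"
    and s: "\<And>j. lam (\<lambda>\<omega>. cmod (z (Suc j) \<omega> - z j \<omega>)) \<le> (1 / 2) ^ j" and \<epsilon>: "\<epsilon> > 0"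
  shows "\<exists>K. \<forall>k\<ge>K. \<forall>l\<ge>K. \<forall>n. cmod (h n (z k) - h n (z l)) \<le> \<epsilon>"
proof -
  note [measurable] = pos_meas[OF x] z(1)
  have zX: "z j \<in> X" for j using dominated_X(1)[OF x z] .
  define u where "u j = (\<lambda>\<omega>. cmod (z (Suc j) \<omega> - z j \<omega>))" for j
  have [measurable]: "u j \<in> borel_measurable M" for j unfolding u_def by measurable
  have u_pos: "u j \<in> pos" for j unfolding u_def by (intro pos_abs X_diff zX)
  have u0: "0 \<le> u j \<omega>" for j \<omega> by (simp add: u_def)
  have x0: "0 \<le> x \<omega>" for \<omega> using pos_nonneg[OF x] .
  have x2: "(\<lambda>\<omega>. 2 * x \<omega>) \<in> pos" using pos_cmult[OF x, of 2] by simp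
  \<comment> \<open>Truncation at \<open>2 * x\<close> provides the order bound that
    \<open>V_set_monotone\<close> asks for; nothing is lost, since \<open>z l - z J\<close> has
    modulus at most \<open>2 * x\<close> anyway.\<close>
  define G where "G i l = (\<lambda>\<omega>. min (2 * x \<omega>) (\<Sum>j\<in>{i..<l}. u j \<omega>))" for i l
  have G_meas [measurable]: "G i l \<in> borel_measurable M" for i l unfolding G_def by measurable
  have G0: "0 \<le> G i l \<omega>" for i l \<omega> using u0 x0 by (simp add: G_def sum_nonneg)
  have G_x: "G i l \<omega> \<le> 2 * x \<omega>" for i l \<omega> by (simp add: G_def)
  have G_pos: "G i l \<in> pos" for i l by (rule pos_le(1)[OF x2 G_meas G0 G_x])
  have G_mono: "G i l \<omega> \<le> G i l' \<omega>" if "l \<le> l'" for i l l' \<omega>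
    unfolding G_def using that u0 by (intro min.mono order_refl sum_mono2) auto
  have G_anti: "G j l \<omega> \<le> G i l \<omega>" if "i \<le> j" for i j l \<omega>
    unfolding G_def using that u0 by (intro min.mono order_refl sum_mono2) auto
  have lam_G: "lam (G i l) \<le> 2 * (1 / 2) ^ i" for i l
  proof -
    have "lam (G i l) \<le> lam (\<lambda>\<omega>. \<Sum>j\<in>{i..<l}. u j \<omega>)"
      by (rule lam_mono[OF G_pos pos_sum[OF u_pos]]) (simp add: G_def)
    also have "\<dots> = (\<Sum>j\<in>{i..<l}. lam (u j))" by (rule lam_sum[OF u_pos])
    also have "\<dots> \<le> (\<Sum>j\<in>{i..<l}. (1 / 2) ^ j)" using s by (intro sum_mono) (simp add: u_def)
    also have "\<dots> \<le> 2 * (1 / 2) ^ i"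
    proof (cases "i \<le> l")
      case True
      then have "(\<Sum>j\<in>{i..<l}. (1 / 2 :: real) ^ j) = 2 * (1 / 2) ^ i - 2 * (1 / 2) ^ l"
      proof (induction l rule: dec_induct)
        case (step l) then show ?case by (simp add: sum.atLeastLessThan_Suc)
      qed simp
      then show ?thesis by simp
    qed simp
    finally show ?thesis .
  qed
  define e where "e = \<epsilon> / 4"
  have e: "e > 0" using \<epsilon> by (simp add: e_def)
  have "\<exists>L. \<forall>l\<ge>L. \<forall>n. absf (h n) (\<lambda>\<omega>. G i l \<omega> - G i L \<omega>) \<le> e * (1 / 2) ^ Suc i" for i
    using G_mono e by (intro V_set_monotone[OF V x2 G_meas G0 _ G_x]) auto
  then obtain L where L: "\<And>i l n. l \<ge> L i \<Longrightarrow> absf (h n) (\<lambda>\<omega>. G i l \<omega> - G i (L i) \<omega>) \<le> e * (1 / 2) ^ Suc i"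
    by metis
  \<comment> \<open>The cut tails \<open>G i (L i)\<close> may fail to decrease in \<open>i\<close>,
    as the cut \<open>L i\<close> varies; running minima do decrease.\<close>
  define H where "H = rec_nat (G 0 (L 0)) (\<lambda>j Hj \<omega>. min (Hj \<omega>) (G (Suc j) (L (Suc j)) \<omega>))"
  have H_0: "H 0 = G 0 (L 0)" and H_Suc: "H (Suc j) = (\<lambda>\<omega>. min (H j \<omega>) (G (Suc j) (L (Suc j)) \<omega>))" for j
    by (simp_all add: H_def)
  have H_meas [measurable]: "H j \<in> borel_measurable M" for j by (induction j) (auto simp: H_0 H_Suc)
  have H0: "0 \<le> H j \<omega>" for j \<omega> by (induction j) (auto simp: H_0 H_Suc G0)
  have H_G: "H j \<omega> \<le> G j (L j) \<omega>" for j \<omega> by (cases j) (auto simp: H_0 H_Suc)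
  have H_x: "H j \<omega> \<le> 2 * x \<omega>" for j \<omega> using H_G G_x order_trans by blast
  have H_pos: "H j \<in> pos" for j by (rule pos_le(1)[OF x2 H_meas H0 H_x])
  have H_anti: "H j \<omega> \<le> H i \<omega>" if "i \<le> j" for i j \<omega>
    using that by (rule lift_Suc_antimono_le[rotated]) (simp add: H_Suc)
  have "\<exists>J. \<forall>l\<ge>J. \<forall>n. absf (h n) (\<lambda>\<omega>. H J \<omega> - H l \<omega>) \<le> e"
    by (rule V_set_antimono[OF V x2 H_meas H0 _ H_x e]) (rule H_anti[OF le_SucI[OF order_refl]])
  then obtain J where J: "\<And>l n. l \<ge> J \<Longrightarrow> absf (h n) (\<lambda>\<omega>. H J \<omega> - H l \<omega>) \<le> e" by blast
  have HJ: "absf (h n) (H J) \<le> e" for n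
  proof (rule field_le_epsilon)
    fix \<delta> :: real assume \<delta>: "\<delta> > 0"
    have "(\<lambda>i. 2 ^ n * (2 * (1 / 2 :: real) ^ i)) \<longlonglongrightarrow> 2 ^ n * (2 * 0)"
      by (intro tendsto_intros LIMSEQ_realpow_zero) auto
    then have "\<forall>\<^sub>F i in sequentially. 2 ^ n * (2 * (1 / 2 :: real) ^ i) < \<delta> \<and> J \<le> i"
      using \<delta> by (intro eventually_conj order_tendstoD(2) eventually_ge_at_top) auto
    from eventually_happens'[OF sequentially_bot this]
    obtain i where i: "2 ^ n * (2 * (1 / 2 :: real) ^ i) < \<delta>" "J \<le> i" by blast
    have d: "(\<lambda>\<omega>. H J \<omega> - H i \<omega>) \<in> pos"
      using H_anti[OF i(2)] H0 by (intro pos_le(1)[OF H_pos[of J]]) auto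
    have "absf (h n) (H J) = absf (h n) (\<lambda>\<omega>. (H J \<omega> - H i \<omega>) + H i \<omega>)" by simp
    also have "\<dots> = absf (h n) (\<lambda>\<omega>. H J \<omega> - H i \<omega>) + absf (h n) (H i)" by (rule absf_add[OF h_dual d H_pos])
    also have "absf (h n) (H i) \<le> 2 ^ n * lam (H i)" by (rule lam_ge[OF H_pos])
    also have "lam (H i) \<le> 2 * (1 / 2) ^ i" using lam_mono[OF H_pos G_pos H_G] lam_G order_trans by blast
    finally show "absf (h n) (H J) \<le> e + \<delta>" using J[OF i(2), of n] i(1) by simp
  qed
  \<comment> \<open>With \<open>max l (L i)\<close> the error beyond the cut stays nonnegative also
    for \<open>l < L i\<close>, where it is 0.\<close>
  define D where "D i l = (\<lambda>\<omega>. G i (max l (L i)) \<omega> - G i (L i) \<omega>)" for i l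
  have D_pos: "D i l \<in> pos" for i l
  proof (rule pos_le(1)[OF x2])
    show "D i l \<in> borel_measurable M" unfolding D_def by measurable
    show "0 \<le> D i l \<omega>" for \<omega> using G_mono[of "L i" "max l (L i)" i \<omega>] by (simp add: D_def)
    show "D i l \<omega> \<le> 2 * x \<omega>" for \<omega> using G_x[of i "max l (L i)" \<omega>] G0[of i "L i" \<omega>] by (simp add: D_def)
  qed
  \<comment> \<open>Undoes the minimum: whichever cut tail attains it, replacing uncut tails by cut
    ones costs at most the sum of all cutting errors, which the factors
    \<open>(1 / 2) ^ Suc i\<close> keep below \<open>e\<close>.\<close>
  have G_H: "g \<le> H j \<omega> + (\<Sum>i\<le>j. D i l \<omega>)" if "\<And>i. i \<le> j \<Longrightarrow> g \<le> G i l \<omega>" for g j l \<omega>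
    using that
  proof (induction j)
    case 0
    then show ?case using G_mono[of l "max l (L 0)" 0 \<omega>] by (fastforce simp: H_0 D_def)
  next
    case (Suc j)
    have "g \<le> G (Suc j) (L (Suc j)) \<omega> + D (Suc j) l \<omega>"
      using Suc.prems[of "Suc j"] G_mono[of l "max l (L (Suc j))" "Suc j" \<omega>] by (simp add: D_def)
    moreover have "g \<le> H j \<omega> + (\<Sum>i\<le>j. D i l \<omega>)" using Suc by simp
    moreover have "0 \<le> D (Suc j) l \<omega>" "0 \<le> (\<Sum>i\<le>j. D i l \<omega>)"
      using pos_nonneg[OF D_pos] by (auto intro: sum_nonneg)
    ultimately show ?case by (auto simp: H_Suc min_def)
  qed
  have G_small: "absf (h n) (G J l) \<le> 2 * e" for n l
  proof -
    have "absf (h n) (G J l) \<le> absf (h n) (\<lambda>\<omega>. H J \<omega> + (\<Sum>i\<le>J. D i l \<omega>))"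
      by (intro absf_mono[OF h_dual G_pos] pos_add H_pos pos_sum D_pos G_H G_anti)
    also have "\<dots> = absf (h n) (H J) + absf (h n) (\<lambda>\<omega>. \<Sum>i\<le>J. D i l \<omega>)"
      by (rule absf_add[OF h_dual H_pos pos_sum[OF D_pos]])
    also have "absf (h n) (\<lambda>\<omega>. \<Sum>i\<le>J. D i l \<omega>) = (\<Sum>i\<le>J. absf (h n) (D i l))" by (rule absf_sum[OF h_dual D_pos])
    also have "\<dots> \<le> (\<Sum>i\<le>J. e * (1 / 2) ^ Suc i)"
      using L unfolding D_def by (intro sum_mono) auto
    also have "\<dots> = e * (1 - (1 / 2) ^ Suc J)"
      by (induction J) (auto simp: algebra_simps)
    also have "\<dots> \<le> e" using e by (simp add: algebra_simps)
    finally show ?thesis using HJ[of n] by simp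
  qed
  have near: "cmod (h n (z l) - h n (z J)) \<le> 2 * e" if "l \<ge> J" for n l
  proof -
    have "cmod (z l \<omega> - z J \<omega>) \<le> G J l \<omega>" for \<omega>
    proof -
      have "z l \<omega> - z J \<omega> = (\<Sum>j\<in>{J..<l}. z (Suc j) \<omega> - z j \<omega>)" using sum_Suc_diff'[OF that, of "\<lambda>j. z j \<omega>"] by (rule sym)
      then have "cmod (z l \<omega> - z J \<omega>) \<le> (\<Sum>j\<in>{J..<l}. u j \<omega>)" unfolding u_def by (metis norm_sum)
      moreover have "cmod (z l \<omega> - z J \<omega>) \<le> 2 * x \<omega>"
        using norm_triangle_ineq4[of "z l \<omega>" "z J \<omega>"] z(2)[of l \<omega>] z(2)[of J \<omega>] by linarith
      ultimately show ?thesis by (simp add: G_def)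
    qed
    then have "cmod (h n (\<lambda>\<omega>. z l \<omega> - z J \<omega>)) \<le> absf (h n) (G J l)"
      by (intro absf_upper[OF h_dual G_pos]) auto
    then show ?thesis using G_small[of n l] dual_diff[OF h_dual zX zX, of n l J] by simp
  qed
  have "cmod (h n (z k) - h n (z l)) \<le> \<epsilon>" if "k \<ge> J" "l \<ge> J" for k l n
    using norm_triangle_ineq4[of "h n (z k) - h n (z J)" "h n (z l) - h n (z J)"] near[OF that(1), of n] near[OF that(2), of n]
    by (simp add: e_def)
  then show ?thesis by blast
qed

lemma order_interval_convex_Cauchy:
  assumes x: "x \<in> pos" and xp: "\<And>\<omega>. 0 < x \<omega>"
    and y: "\<And>l. y l \<in> borel_measurable M" "\<And>l \<omega>. cmod (y l \<omega>) \<le> x \<omega>"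
  shows "\<exists>T. (\<forall>k. leaves (T k) \<subseteq> {k..}) \<and>
    (\<forall>\<epsilon>>0. \<exists>K. \<forall>k\<ge>K. \<forall>l\<ge>K. \<forall>n. cmod (h n (teval y (T k)) - h n (teval y (T l))) \<le> \<epsilon>)"
proof -
  obtain T where T: "\<And>k. leaves (T k) \<subseteq> {k..}"
    "\<And>\<eta>. \<eta> > 0 \<Longrightarrow> \<exists>K. \<forall>k\<ge>K. \<forall>l\<ge>K. lam (\<lambda>\<omega>. cmod (teval y (T k) \<omega> - teval y (T l) \<omega>)) \<le> \<eta>"
    using order_interval_lam_Cauchy[OF x xp, of y, OF y] by blast
  have yX: "y l \<in> X" for l using dominated_X(1)[OF x y] .
  have "\<exists>K. \<forall>k\<ge>K. \<forall>l\<ge>K. lam (\<lambda>\<omega>. cmod (teval y (T k) \<omega> - teval y (T l) \<omega>)) \<le> (1 / 2) ^ j" for j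
    by (rule T(2)) simp
  then obtain K where K: "\<And>j k l. k \<ge> K j \<Longrightarrow> l \<ge> K j \<Longrightarrow>
      lam (\<lambda>\<omega>. cmod (teval y (T k) \<omega> - teval y (T l) \<omega>)) \<le> (1 / 2) ^ j" by metis
  \<comment> \<open>Both \<open>r j\<close> and \<open>r (Suc j)\<close> are at least
    \<open>K j\<close>, so consecutive terms are \<open>(1 / 2) ^ j\<close> close; the summand
    \<open>j\<close> keeps the leaves beyond \<open>j\<close>.\<close>
  define r where "r j = j + (\<Sum>i\<le>j. K i)" for j
  have r: "K j \<le> r j" "K j \<le> r (Suc j)" "j \<le> r j" for j
    unfolding r_def using member_le_sum[of j "{..j}" K] by auto
  show ?thesis
  proof (intro exI[of _ "\<lambda>j. T (r j)"] conjI allI impI)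
    show "leaves (T (r k)) \<subseteq> {k..}" for k using T(1)[of "r k"] r(3)[of k] by fastforce
    fix \<epsilon> :: real assume "\<epsilon> > 0"
    show "\<exists>K. \<forall>k\<ge>K. \<forall>l\<ge>K. \<forall>n. cmod (h n (teval y (T (r k))) - h n (teval y (T (r l)))) \<le> \<epsilon>"
    proof (rule lam_summable_uniform_Cauchy[OF x _ _ _ \<open>\<epsilon> > 0\<close>])
      show "teval y (T (r j)) \<in> borel_measurable M" for j using X_meas[OF teval_X[OF yX]] .
      show "cmod (teval y (T (r j)) \<omega>) \<le> x \<omega>" for j \<omega>
        using tval_near[of "T (r j)" "\<lambda>n. y n \<omega>" 0 "x \<omega>"] y(2) by (simp add: teval_def)
      show "lam (\<lambda>\<omega>. cmod (teval y (T (r (Suc j))) \<omega> - teval y (T (r j)) \<omega>)) \<le> (1 / 2) ^ j" for j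
        using r by (intro K)
    qed
  qed
qed

end

section \<open>Growth of Orlicz functions\<close>

text \<open>Mean value theorem on the two halves of the interval: the derivative is larger on the
  right one.\<close>

lemma powr_midpoint_strict:
  fixes a b q :: real
  assumes "0 \<le> a" "a < b" "q > 1"
  shows "((a + b) / 2) powr q < (a powr q + b powr q) / 2"
proof (cases "a = 0")
  case True
  have "(2::real) powr 1 < 2 powr q" using assms by (intro powr_less_mono) auto
  then have "b powr q / 2 powr q < b powr q / 2" using assms by (intro divide_strict_left_mono) auto
  then show ?thesis using True assms by (simp add: powr_divide)
next
  case False
  define m where "m = (a + b) / 2"
  have m: "0 < a" "a < m" "m < b" using assms False by (auto simp: m_def)
  have der: "((\<lambda>x. x powr q) has_real_derivative q * x powr (q - 1)) (at x)" if "0 < x" for x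
    using that by (rule has_real_derivative_powr)
  obtain x where x: "a < x" "x < m" "m powr q - a powr q = (m - a) * (q * x powr (q - 1))"
    using MVT2[OF m(2), of "\<lambda>x. x powr q" "\<lambda>x. q * x powr (q - 1)"] der m(1) by force
  obtain y where y: "m < y" "y < b" "b powr q - m powr q = (b - m) * (q * y powr (q - 1))"
    using MVT2[OF m(3), of "\<lambda>x. x powr q" "\<lambda>x. q * x powr (q - 1)"] der m(1,2) by force
  have "x powr (q - 1) < y powr (q - 1)" using x y m assms by (intro powr_less_mono2) auto
  then have "(m - a) * (q * x powr (q - 1)) < (m - a) * (q * y powr (q - 1))"
    using m assms by (intro mult_strict_left_mono) auto
  then have "m powr q - a powr q < (m - a) * (q * y powr (q - 1))" unfolding x(3) .
  also have "m - a = b - m" by (simp add: m_def field_simps)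
  finally have "m powr q - a powr q < b powr q - m powr q" unfolding y(3) .
  then show ?thesis unfolding m_def[symmetric] by simp
qed

text \<open>Equal moduli: the parallelogram law makes \<open>u + v\<close> shorter than
  \<open>2 * cmod u\<close>. Different moduli: strict convexity of the power.\<close>

lemma cmod_midpoint_powr_strict:
  fixes u v :: complex
  assumes "u \<noteq> v" "q > 1"
  shows "(cmod (u + v) / 2) powr q < (cmod u powr q + cmod v powr q) / 2"
proof (cases "cmod u = cmod v")
  case True
  have 1: "(cmod (u + v))\<^sup>2 + (cmod (u - v))\<^sup>2 = 2 * (cmod u)\<^sup>2 + 2 * (cmod v)\<^sup>2"
    unfolding cmod_power2 by (simp add: power2_eq_square algebra_simps)
  have "(cmod (u - v))\<^sup>2 > 0" using assms by simp
  then have "(cmod (u + v))\<^sup>2 < 4 * (cmod u)\<^sup>2" using 1 unfolding True by linarith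
  then have "(cmod (u + v))\<^sup>2 < (2 * cmod u)\<^sup>2" by (simp add: power_mult_distrib)
  then have "cmod (u + v) < 2 * cmod u" using power_less_imp_less_base by fastforce
  then have "(cmod (u + v) / 2) powr q < cmod u powr q" using assms by (intro powr_less_mono2) auto
  then show ?thesis using True by simp
next
  case False
  have "(cmod (u + v) / 2) powr q \<le> ((cmod u + cmod v) / 2) powr q"
    using assms norm_triangle_ineq[of u v] by (intro powr_mono2) auto
  also have "\<dots> < (cmod u powr q + cmod v powr q) / 2"
  proof (cases "cmod u < cmod v")
    case True
    then show ?thesis using powr_midpoint_strict[of "cmod u" "cmod v" q] assms by simp
  next
    case F: False
    then show ?thesis using powr_midpoint_strict[of "cmod v" "cmod u" q] assms False by (simp add: add.commute)
  qed
  finally show ?thesis .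
qed

text \<open>By homogeneity the larger modulus may be normalised to 1. The admissible pairs then form
  a compact set, on which the strict midpoint gap has a positive minimum; as the mean of the powers
  is at most 1 there, this absolute gap is also a relative one.\<close>

lemma cmod_powr_uniformly_convex:
  assumes q: "q > 1" and \<epsilon>: "\<epsilon> > 0"
  shows "\<exists>\<delta>>0. \<delta> \<le> 1 \<and> (\<forall>u v. \<epsilon> * max (cmod u) (cmod v) \<le> cmod (u - v) \<longrightarrow>
    (cmod (u + v) / 2) powr q \<le> (1 - \<delta>) * ((cmod u powr q + cmod v powr q) / 2))"
proof -
  define K where "K = {p :: complex \<times> complex. max (cmod (fst p)) (cmod (snd p)) = 1 \<and> \<epsilon> \<le> cmod (fst p - snd p)}"
  define F where "F p = (cmod (fst p) powr q + cmod (snd p) powr q) / 2 - (cmod (fst p + snd p) / 2) powr q" for p :: "complex \<times> complex"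
  have "closed K" unfolding K_def
    by (intro closed_Collect_conj closed_Collect_eq closed_Collect_le continuous_intros)
  moreover have "K \<subseteq> cball 0 1 \<times> cball 0 1" unfolding K_def by (auto simp: max_def split: if_splits)
  then have "bounded K" using bounded_subset bounded_Times bounded_cball by metis
  ultimately have K: "compact K" by (simp add: compact_eq_bounded_closed)
  have F_cont: "continuous_on K F" unfolding F_def
    by (intro continuous_on_diff continuous_on_divide continuous_on_add continuous_on_powr' continuous_on_norm
        continuous_on_fst continuous_on_snd continuous_on_id continuous_on_const ballI conjI impI) (use q in auto)
  have F_pos: "F p > 0" if "p \<in> K" for p
  proof -
    have "cmod (fst p - snd p) > 0" using that \<epsilon> by (auto simp: K_def)
    then have "fst p \<noteq> snd p" by auto
    from cmod_midpoint_powr_strict[OF this q] show ?thesis by (simp add: F_def)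
  qed
  obtain m where m: "m > 0" "\<And>p. p \<in> K \<Longrightarrow> m \<le> F p"
  proof (cases "K = {}")
    case False
    then obtain p where "p \<in> K" "\<And>p'. p' \<in> K \<Longrightarrow> F p \<le> F p'" using continuous_attains_inf[OF K _ F_cont] by blast
    then show ?thesis using that F_pos by blast
  qed (use that[of 1] in auto)
  define \<delta> where "\<delta> = min 1 m"
  have \<delta>: "\<delta> > 0" "\<delta> \<le> 1" "\<delta> \<le> m" using m by (auto simp: \<delta>_def)
  have "(cmod (u + v) / 2) powr q \<le> (1 - \<delta>) * ((cmod u powr q + cmod v powr q) / 2)"
    if uv: "\<epsilon> * max (cmod u) (cmod v) \<le> cmod (u - v)" for u v
  proof (cases "max (cmod u) (cmod v) = 0")
    case True
    then have "u = 0" "v = 0" by (auto simp: max_def split: if_splits)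
    then show ?thesis by simp
  next
    case False
    define r where "r = max (cmod u) (cmod v)"
    have r: "r > 0" using False norm_ge_zero[of u] unfolding r_def by linarith
    define u' where "u' = u / of_real r"
    define v' where "v' = v / of_real r"
    have sc: "cmod u' = cmod u / r" "cmod v' = cmod v / r" "cmod (u' + v') = cmod (u + v) / r" "cmod (u' - v') = cmod (u - v) / r"
      using r by (auto simp: u'_def v'_def norm_divide add_divide_distrib[symmetric] diff_divide_distrib[symmetric])
    have "max (cmod u / r) (cmod v / r) = 1" using r by (auto simp: r_def max_def)
    moreover have "\<epsilon> \<le> cmod (u - v) / r" using uv r by (simp add: r_def[symmetric] field_simps)
    ultimately have "(u', v') \<in> K" by (simp add: K_def sc)
    then have "m \<le> F (u', v')" by (rule m(2))
    moreover have le1: "cmod u' \<le> 1" "cmod v' \<le> 1" using r by (auto simp: sc r_def)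
    then have "cmod u' powr q \<le> 1" "cmod v' powr q \<le> 1" using q by (auto intro!: powr_le1)
    then have "\<delta> * ((cmod u' powr q + cmod v' powr q) / 2) \<le> \<delta> * 1" using \<delta> by (intro mult_left_mono) auto
    ultimately have "(cmod (u' + v') / 2) powr q \<le> (1 - \<delta>) * ((cmod u' powr q + cmod v' powr q) / 2)"
      using \<delta>(3) by (simp add: F_def algebra_simps)
    then have "r powr q * (cmod (u' + v') / 2) powr q \<le> r powr q * ((1 - \<delta>) * ((cmod u' powr q + cmod v' powr q) / 2))"
      by (rule mult_left_mono) simp
    moreover have "r powr q * (cmod (u' + v') / 2) powr q = (cmod (u + v) / 2) powr q"
      using r by (simp add: sc powr_mult[symmetric])
    moreover have "r powr q * cmod u' powr q = cmod u powr q" "r powr q * cmod v' powr q = cmod v powr q"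
      using r by (simp_all add: sc powr_mult[symmetric])
    then have "r powr q * ((1 - \<delta>) * ((cmod u' powr q + cmod v' powr q) / 2)) = (1 - \<delta>) * ((cmod u powr q + cmod v powr q) / 2)"
      by (simp only: distrib_left mult.left_commute times_divide_eq_right)
    ultimately show ?thesis by (simp only:)
  qed
  then show ?thesis using \<delta> by blast
qed

section \<open>From Delta_2 of the complementary function to uniform convexity\<close>

locale orlicz =
  fixes \<Psi> :: "real \<Rightarrow> real"
  assumes orl: "orlicz_function \<Psi>"
begin

lemma Psi_0: "\<Psi> 0 = 0"
  using orl by (simp add: orlicz_function_def)

lemma Psi_mono: "0 \<le> x \<Longrightarrow> x \<le> y \<Longrightarrow> \<Psi> x \<le> \<Psi> y"
  using orl by (auto simp: orlicz_function_def mono_on_def)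

lemma Psi_nonneg: "0 \<le> x \<Longrightarrow> 0 \<le> \<Psi> x"
  using Psi_mono[of 0 x] Psi_0 by simp

lemma Psi_convex: "convex_on {0..} \<Psi>"
  using orl by (simp add: orlicz_function_def)

lemma Psi_scale: "0 \<le> t \<Longrightarrow> t \<le> 1 \<Longrightarrow> 0 \<le> x \<Longrightarrow> \<Psi> (t * x) \<le> t * \<Psi> x"
  using convex_onD[OF Psi_convex, of t 0 x] Psi_0 by simp

lemma Psi_superlinear:
  obtains Y where "Y \<ge> 1" "\<And>y. y \<ge> Y \<Longrightarrow> z * y \<le> \<Psi> y"
proof -
  have "\<forall>\<^sub>F y in at_top. z \<le> \<Psi> y / y"
    using orl by (auto simp: orlicz_function_def filterlim_at_top)
  then obtain Y where Y: "\<And>y. y \<ge> Y \<Longrightarrow> z \<le> \<Psi> y / y" by (auto simp: eventually_at_top_linorder)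
  show ?thesis
  proof (rule that[of "max 1 Y"])
    show "z * y \<le> \<Psi> y" if "y \<ge> max 1 Y" for y
      using Y[of y] that by (simp add: field_simps)
  qed simp
qed

text \<open>A real \<open>SUP\<close> is sure to bound its members only if they are bounded above;
  superlinear growth of \<open>\<Psi>\<close> ensures this.\<close>

lemma complementary_ge: assumes "y \<ge> 0" shows "z * y - \<Psi> y \<le> complementary \<Psi> z"
proof -
  obtain Y where Y: "Y \<ge> 1" "\<And>y. y \<ge> Y \<Longrightarrow> z * y \<le> \<Psi> y" using Psi_superlinear by blast
  have "bdd_above ((\<lambda>y. z * y - \<Psi> y) ` {0..})"
  proof (rule bdd_aboveI2)
    fix y :: real assume y: "y \<in> {0..}"
    show "z * y - \<Psi> y \<le> \<bar>z\<bar> * Y"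
    proof (cases "y \<ge> Y")
      case True
      then have "z * y - \<Psi> y \<le> 0" using Y(2) by simp
      also have "0 \<le> \<bar>z\<bar> * Y" using Y(1) by simp
      finally show ?thesis .
    next
      case False
      have "z * y \<le> \<bar>z\<bar> * Y" using y False by (intro mult_mono) auto
      then show ?thesis using Psi_nonneg[of y] y by auto
    qed
  qed
  then show ?thesis unfolding complementary_def using assms by (intro cSUP_upper) auto
qed

lemma Psi_subgradient:
  assumes "y > 0"
  obtains s where "\<And>z. z \<ge> 0 \<Longrightarrow> \<Psi> y + s * (z - y) \<le> \<Psi> z"
proof -
  have "y \<in> interior {0..}" using assms by simp
  then have "\<Psi> z \<ge> \<Psi> y + Inf ((\<lambda>t. (\<Psi> y - \<Psi> t) / (y - t)) ` ({y<..} \<inter> {0..})) * (z - y)" if "z \<ge> 0" for z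
    using convex_le_Inf_differential[OF Psi_convex, of y z] that by simp
  then show ?thesis using that by blast
qed

text \<open>If \<open>s\<close> is a slope of \<open>\<Psi>\<close> at \<open>y\<close> then \<open>\<Phi> s = s y - \<Psi> y\<close> and \<open>\<Phi> (2 s) \<ge> 2 s y - \<Psi> y \<ge> s y\<close>,
  so \<open>\<Phi> (2 s) \<le> K \<Phi> s\<close> forces \<open>\<Psi> y \<le> (1 - 1 / K) s y\<close>.\<close>

lemma Delta2_doubling:
  assumes "Delta2 (complementary \<Psi>)"
  obtains a y1 where "a > 2" "y1 > 0" "\<And>y. y \<ge> y1 \<Longrightarrow> a * \<Psi> y \<le> \<Psi> (2 * y)"
proof -
  obtain K0 x0 where K0: "x0 > 0" "\<And>x. x \<ge> x0 \<Longrightarrow> complementary \<Psi> (2 * x) \<le> K0 * complementary \<Psi> x"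
    using assms by (auto simp: Delta2_def)
  \<comment> \<open>\<open>K > 1\<close> permits the division by \<open>K - 1\<close>. The
    subgradient inequality at \<open>2 * y\<close> gives
    \<open>\<Psi> (2 * y) \<ge> \<Psi> y + s * y\<close>, whose second term is at least
    \<open>K / (K - 1) * \<Psi> y\<close>; hence the value of \<open>a\<close>.\<close>
  define K where "K = max 2 K0"
  have K: "K \<ge> 2" by (simp add: K_def)
  define a where "a = 1 + K / (K - 1)"
  have a: "a > 2" using K by (simp add: a_def field_simps)
  \<comment> \<open>Beyond \<open>Y\<close> every slope satisfies
    \<open>s * y \<ge> \<Psi> y \<ge> x0 * y\<close>, so Delta_2 applies at
    \<open>s\<close>.\<close>
  obtain Y where Y: "Y \<ge> 1" "\<And>y. y \<ge> Y \<Longrightarrow> x0 * y \<le> \<Psi> y" using Psi_superlinear by blast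
  have "a * \<Psi> y \<le> \<Psi> (2 * y)" if y: "y \<ge> Y" for y
  proof -
    have y0: "y > 0" using y Y by simp
    obtain s where s: "\<And>z. z \<ge> 0 \<Longrightarrow> \<Psi> y + s * (z - y) \<le> \<Psi> z" using Psi_subgradient[OF y0] by blast
    have sy: "\<Psi> y \<le> s * y" using s[of 0] Psi_0 by simp
    then have "x0 * y \<le> s * y" using Y(2)[OF y] by simp
    then have sx: "s \<ge> x0" using y0 by simp
    have c1: "complementary \<Psi> s \<le> s * y - \<Psi> y"
      unfolding complementary_def
    proof (rule cSUP_least)
      fix z :: real assume "z \<in> {0..}"
      then show "s * z - \<Psi> z \<le> s * y - \<Psi> y" using s[of z] by (simp add: algebra_simps)
    qed auto
    have c0: "complementary \<Psi> s \<ge> 0" using complementary_ge[of 0 s] Psi_0 by simp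
    have "s * y \<le> 2 * s * y - \<Psi> y" using sy by simp
    also have "\<dots> \<le> complementary \<Psi> (2 * s)" using complementary_ge[of y "2 * s"] y0 by simp
    also have "\<dots> \<le> K0 * complementary \<Psi> s" using K0(2)[OF sx] .
    also have "\<dots> \<le> K * complementary \<Psi> s" using c0 by (intro mult_right_mono) (auto simp: K_def)
    also have "\<dots> \<le> K * (s * y - \<Psi> y)" using c1 K by (intro mult_left_mono) auto
    finally have "K * \<Psi> y \<le> (K - 1) * (s * y)" by (simp add: algebra_simps)
    then have "K / (K - 1) * \<Psi> y \<le> s * y" using K by (simp add: field_simps)
    moreover have "\<Psi> y + s * y \<le> \<Psi> (2 * y)" using s[of "2 * y"] y0 by simp
    ultimately show ?thesis by (simp add: a_def distrib_right)
  qed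
  then show ?thesis using that[of a Y] a Y(1) by auto
qed

text \<open>Doubling the argument multiplies \<open>x powr log 2 a\<close> by exactly
  \<open>a\<close>, and \<open>\<Psi>\<close> by at least \<open>a\<close>; what remains is at most
  one doubling and costs the factor \<open>a\<close>. The exponent is above 1 because
  \<open>a > 2\<close>.\<close>

lemma doubling_powr_growth:
  assumes a: "a > 2" and y1: "y1 > 0" and dbl: "\<And>y. y \<ge> y1 \<Longrightarrow> a * \<Psi> y \<le> \<Psi> (2 * y)"
    and t: "y1 \<le> t" "t \<le> x"
  shows "\<Psi> t * (x / t) powr log 2 a \<le> a * \<Psi> x"
proof -
  have t0: "t > 0" using t y1 by simp
  have a2: "2 powr log 2 a = a" using a by simp
  have q0: "log 2 a \<ge> 0" using a by simp
  have *: "\<Psi> t * (x / t) powr log 2 a \<le> a * \<Psi> x" if "t \<le> x" "x \<le> 2 ^ Suc j * t" for j x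
    using that
  proof (induction j arbitrary: x)
    case 0
    have "(x / t) powr log 2 a \<le> 2 powr log 2 a" using 0 t0 q0 by (intro powr_mono2) (auto simp: field_simps)
    then have "\<Psi> t * (x / t) powr log 2 a \<le> \<Psi> t * a"
      unfolding a2 using Psi_nonneg[of t] t0 by (intro mult_left_mono) auto
    also have "\<dots> \<le> \<Psi> x * a" using Psi_mono[of t x] 0 t0 a by (intro mult_right_mono) auto
    finally show ?case by (simp add: mult.commute)
  next
    case (Suc j)
    show ?case
    proof (cases "x \<le> 2 ^ Suc j * t")
      case True
      then show ?thesis using Suc by blast
    next
      case False
      have "2 * t \<le> 2 ^ Suc j * t" using t0 by simp
      then have x2: "t \<le> x / 2" using False by simp
      have "(x / t) powr log 2 a = (2 * (x / 2 / t)) powr log 2 a" by simp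
      also have "\<dots> = a * (x / 2 / t) powr log 2 a"
        using x2 t0 by (subst powr_mult) (auto simp: a2)
      finally have "\<Psi> t * (x / t) powr log 2 a = a * (\<Psi> t * (x / 2 / t) powr log 2 a)" by simp
      also have "\<dots> \<le> a * (a * \<Psi> (x / 2))" using Suc.IH[of "x / 2"] x2 Suc.prems a by (intro mult_left_mono) auto
      also have "\<dots> \<le> a * \<Psi> x" using dbl[of "x / 2"] x2 t a by (intro mult_left_mono) auto
      finally show ?thesis .
    qed
  qed
  obtain j where "x / t < 2 ^ j" using real_arch_pow[of 2 "x / t"] by auto
  also have "(2::real) ^ j \<le> 2 ^ Suc j" by simp
  finally have "x \<le> 2 ^ Suc j * t" using t0 by (simp add: field_simps)
  then show ?thesis using * t by blast
qed

text \<open>As \<open>\<Psi> x / x powr q\<close> is almost increasing for some \<open>q > 1\<close>, \<open>\<Psi>\<close> is equivalent at infinity to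
  \<open>Q x = (SUP t. \<Psi> t / t powr q * max 0 (x powr q - t powr q))\<close>, a convex function of \<open>x powr q\<close>
  vanishing at \<open>0\<close>, which inherits the uniform convexity of the \<open>q\<close>-th power.\<close>

lemma uniformly_convex_equivalent:
  assumes "Delta2 (complementary \<Psi>)"
  obtains Q :: "real \<Rightarrow> real" and a b :: real where "mono Q" "\<And>x. 0 \<le> Q x" "b \<ge> 0"
    "\<And>x. x \<ge> 0 \<Longrightarrow> Q x \<le> a * \<Psi> x" "\<And>x. x \<ge> 0 \<Longrightarrow> \<Psi> (x / 2) \<le> Q x + b"
    "\<And>u v :: complex. Q (cmod (u + v) / 2) \<le> (Q (cmod u) + Q (cmod v)) / 2"
    "\<And>\<epsilon>. \<epsilon> > 0 \<Longrightarrow> \<exists>\<delta>>0. \<forall>u v. \<epsilon> * max (cmod u) (cmod v) \<le> cmod (u - v) \<longrightarrow>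
       Q (cmod (u + v) / 2) \<le> (1 - \<delta>) * ((Q (cmod u) + Q (cmod v)) / 2)"
proof -
  obtain a y1 where ay: "a > 2" "y1 > 0" "\<And>y. y \<ge> y1 \<Longrightarrow> a * \<Psi> y \<le> \<Psi> (2 * y)"
    using Delta2_doubling[OF assms] by blast
  define q where "q = log 2 a"
  have q: "q > 1" using ay(1) by (simp add: q_def)
  define \<kappa> where "\<kappa> t = \<Psi> t / t powr q" for t
  have \<kappa>0: "\<kappa> t \<ge> 0" if "t \<ge> y1" for t using that ay(2) Psi_nonneg[of t] by (simp add: \<kappa>_def)
  \<comment> \<open>The inner \<open>max 0 x\<close> makes \<open>Q\<close> monotone on the whole
    line, hence Borel.\<close>
  define E where "E x t = \<kappa> t * max 0 (max 0 x powr q - t powr q)" for x t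
  define Q where "Q x = (SUP t\<in>{y1..}. E x t)" for x
  have E0: "E x t \<ge> 0" if "t \<ge> y1" for x t using \<kappa>0[OF that] by (simp add: E_def)
  have E_le: "E x t \<le> a * \<Psi> (max 0 x)" if t: "t \<ge> y1" for x t
  proof (cases "t \<le> x")
    case True
    have t0: "t > 0" using t ay(2) by simp
    have "E x t \<le> \<kappa> t * x powr q" using \<kappa>0[OF t] True t0 by (auto simp: E_def intro!: mult_left_mono)
    also have "\<dots> = \<Psi> t * (x / t) powr q" using t0 True by (simp add: \<kappa>_def powr_divide)
    also have "\<dots> \<le> a * \<Psi> x" unfolding q_def using doubling_powr_growth[OF ay t True] .
    finally show ?thesis using True t0 by simp
  next
    case False
    then have "max 0 x powr q \<le> t powr q" using t ay(2) q by (intro powr_mono2) auto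
    then have "E x t = 0" by (simp add: E_def)
    then show ?thesis using ay(1) Psi_nonneg[of "max 0 x"] by simp
  qed
  have bdd: "bdd_above (E x ` {y1..})" for x by (rule bdd_aboveI2[of _ _ "a * \<Psi> (max 0 x)"]) (use E_le in auto)
  have Q_ge: "E x t \<le> Q x" if "t \<ge> y1" for x t unfolding Q_def using that bdd by (intro cSUP_upper) auto
  have Q_least: "Q x \<le> c" if "\<And>t. t \<ge> y1 \<Longrightarrow> E x t \<le> c" for x c
    unfolding Q_def using that by (intro cSUP_least) auto
  have Q_mono: "mono Q"
  proof (rule monoI, rule Q_least)
    fix x y t :: real assume xy: "x \<le> y" and t: "t \<ge> y1"
    have "max 0 x powr q \<le> max 0 y powr q" using xy q by (intro powr_mono2) auto
    then have "E x t \<le> E y t" unfolding E_def using \<kappa>0[OF t] by (intro mult_left_mono) auto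
    also have "\<dots> \<le> Q y" by (rule Q_ge[OF t])
    finally show "E x t \<le> Q y" .
  qed
  have Q0: "0 \<le> Q x" for x using E0[of y1 x] Q_ge[of y1 x] by simp
  \<comment> \<open>For \<open>c \<le> 1\<close> an inequality between powers survives subtraction
    of the threshold \<open>\<theta>\<close>, since \<open>c * \<theta> \<le> \<theta>\<close>, and
    then positive parts and suprema. Plain midpoint convexity is \<open>c = 1\<close>, uniform
    convexity \<open>c = 1 - \<delta>\<close>.\<close>
  have Q_conv: "Q m \<le> c * ((Q \<alpha> + Q \<beta>) / 2)"
    if "0 \<le> m" "0 \<le> \<alpha>" "0 \<le> \<beta>" "0 \<le> c" "c \<le> 1" "m powr q \<le> c * ((\<alpha> powr q + \<beta> powr q) / 2)" for m \<alpha> \<beta> c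
  proof (rule Q_least)
    fix t assume t: "t \<ge> y1"
    define \<theta> where "\<theta> = t powr q"
    have \<theta>: "c * \<theta> \<le> \<theta>" unfolding \<theta>_def using that(4,5) by (intro mult_left_le_one_le) auto
    have p: "max 0 (\<alpha> powr q - \<theta>) \<ge> \<alpha> powr q - \<theta>" "max 0 (\<beta> powr q - \<theta>) \<ge> \<beta> powr q - \<theta>"
      "max 0 (\<alpha> powr q - \<theta>) \<ge> 0" "max 0 (\<beta> powr q - \<theta>) \<ge> 0" by auto
    have "m powr q - \<theta> \<le> c * ((\<alpha> powr q - \<theta> + (\<beta> powr q - \<theta>)) / 2)"
      using that(6) \<theta> by (simp add: algebra_simps)
    also have "\<dots> \<le> c * ((max 0 (\<alpha> powr q - \<theta>) + max 0 (\<beta> powr q - \<theta>)) / 2)"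
      using p that(4) by (intro mult_left_mono divide_right_mono add_mono) auto
    finally have "max 0 (m powr q - \<theta>) \<le> c * ((max 0 (\<alpha> powr q - \<theta>) + max 0 (\<beta> powr q - \<theta>)) / 2)"
      using p that(4) by (intro max.boundedI mult_nonneg_nonneg divide_nonneg_nonneg add_nonneg_nonneg) auto
    then have "E m t \<le> \<kappa> t * (c * ((max 0 (\<alpha> powr q - \<theta>) + max 0 (\<beta> powr q - \<theta>)) / 2))"
      unfolding E_def \<theta>_def using \<kappa>0[OF t] that(1) by (intro mult_left_mono) auto
    also have "\<dots> = c * ((E \<alpha> t + E \<beta> t) / 2)"
      using that(2,3) by (simp add: E_def \<theta>_def algebra_simps)
    also have "\<dots> \<le> c * ((Q \<alpha> + Q \<beta>) / 2)"
      using Q_ge[OF t] that(4) by (intro mult_left_mono divide_right_mono add_mono) auto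
    finally show "E m t \<le> c * ((Q \<alpha> + Q \<beta>) / 2)" .
  qed
  show ?thesis
  proof (rule that[OF Q_mono Q0])
    show "\<Psi> y1 \<ge> 0" using Psi_nonneg ay(2) by simp
    show "Q x \<le> a * \<Psi> x" if "x \<ge> 0" for x using Q_least[of x "a * \<Psi> x"] E_le[of _ x] that by (simp add: max_absorb2)
    \<comment> \<open>The competitor \<open>t = x / 2\<close> works because
      \<open>2 powr q \<ge> 2\<close>; the constant \<open>\<Psi> y1\<close> covers small
      \<open>x\<close>.\<close>
    show "\<Psi> (x / 2) \<le> Q x + \<Psi> y1" if x: "x \<ge> 0" for x
    proof (cases "x / 2 \<ge> y1")
      case True
      have p: "(x / 2) powr q > 0" using True ay(2) by simp
      have "(2::real) powr 1 \<le> 2 powr q" using q by (intro powr_mono) auto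
      then have "2 * (x / 2) powr q \<le> 2 powr q * (x / 2) powr q" using p by (intro mult_right_mono) auto
      also have "\<dots> = x powr q" using x by (simp add: powr_mult[symmetric])
      finally have "(x / 2) powr q \<le> x powr q - (x / 2) powr q" by simp
      then have "\<kappa> (x / 2) * (x / 2) powr q \<le> E x (x / 2)"
        unfolding E_def using \<kappa>0[OF True] x by (intro mult_left_mono) auto
      then have "\<Psi> (x / 2) \<le> E x (x / 2)" using p by (simp add: \<kappa>_def)
      then show ?thesis using Q_ge[OF True, of x] Psi_nonneg[of y1] ay(2) by simp
    next
      case False
      then show ?thesis using Psi_mono[of "x / 2" y1] x Q0[of x] by simp
    qed
    show "Q (cmod (u + v) / 2) \<le> (Q (cmod u) + Q (cmod v)) / 2" for u v :: complex
    proof -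
      have "(cmod (u + v) / 2) powr q \<le> (cmod u powr q + cmod v powr q) / 2"
        using cmod_midpoint_powr_strict[of u v q] q by (cases "u = v") (auto simp: norm_mult mult_2[symmetric])
      then show ?thesis using Q_conv[of "cmod (u + v) / 2" "cmod u" "cmod v" 1] by simp
    qed
    show "\<exists>\<delta>>0. \<forall>u v. \<epsilon> * max (cmod u) (cmod v) \<le> cmod (u - v) \<longrightarrow>
       Q (cmod (u + v) / 2) \<le> (1 - \<delta>) * ((Q (cmod u) + Q (cmod v)) / 2)" if \<epsilon>: "\<epsilon> > 0" for \<epsilon>
    proof -
      obtain \<delta> where \<delta>: "\<delta> > 0" "\<delta> \<le> 1" "\<And>u v. \<epsilon> * max (cmod u) (cmod v) \<le> cmod (u - v) \<Longrightarrow>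
          (cmod (u + v) / 2) powr q \<le> (1 - \<delta>) * ((cmod u powr q + cmod v powr q) / 2)"
        using cmod_powr_uniformly_convex[OF q \<epsilon>] by blast
      then show ?thesis by (intro exI[of _ \<delta>] conjI allI impI Q_conv) auto
    qed
  qed
qed

end

section \<open>Orlicz spaces\<close>

locale orlicz_prob = orlicz \<Psi> + prob_space M for \<Psi> and M :: "'a measure"
begin

lemma Psi_meas:
  assumes "f \<in> borel_measurable M" "C > 0"
  shows "(\<lambda>\<omega>. ennreal (\<Psi> (cmod (f \<omega>) / C))) \<in> borel_measurable M"
proof -
  have "mono (\<lambda>t. \<Psi> (max 0 t))" by (intro monoI Psi_mono) auto
  then have [measurable]: "(\<lambda>t. \<Psi> (max 0 t)) \<in> borel_measurable borel" by (rule borel_measurable_mono)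
  note [measurable] = assms(1)
  have "(\<lambda>\<omega>. ennreal (\<Psi> (max 0 (cmod (f \<omega>) / C)))) \<in> borel_measurable M" by measurable
  then show ?thesis using assms(2) by (simp add: max_absorb2)
qed

definition gauges :: "('a \<Rightarrow> complex) \<Rightarrow> real set" where
  "gauges f = {C. C > 0 \<and> (\<integral>\<^sup>+ \<omega>. ennreal (\<Psi> (cmod (f \<omega>) / C)) \<partial>M) \<le> 1}"

lemma norm_gauges: "luxemburg_norm M \<Psi> f = Inf (gauges f)"
  by (simp add: luxemburg_norm_def gauges_def)

lemma gauges_solid:
  assumes "C \<in> gauges f" "C \<le> C'" "\<And>\<omega>. cmod (g \<omega>) \<le> cmod (f \<omega>)"
  shows "C' \<in> gauges g"
proof -
  have C: "C > 0" "C' > 0" using assms by (auto simp: gauges_def)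
  have "(\<integral>\<^sup>+ \<omega>. ennreal (\<Psi> (cmod (g \<omega>) / C')) \<partial>M) \<le> (\<integral>\<^sup>+ \<omega>. ennreal (\<Psi> (cmod (f \<omega>) / C)) \<partial>M)"
    using C assms by (intro nn_integral_mono ennreal_leI Psi_mono frac_le) auto
  then show ?thesis using assms(1) C by (auto simp: gauges_def)
qed

lemma gauges_le: "C \<in> gauges f \<Longrightarrow> luxemburg_norm M \<Psi> f \<le> C"
  unfolding norm_gauges by (rule cInf_lower) (auto simp: gauges_def intro!: bdd_belowI[of _ 0])

lemma gauges_mem: "f \<in> borel_measurable M \<Longrightarrow> C \<in> gauges f \<Longrightarrow> f \<in> orlicz_space M \<Psi>"
  by (auto simp: gauges_def orlicz_space_def intro!: exI[of _ C] intro: le_less_trans)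

text \<open>By convexity and \<open>\<Psi> 0 = 0\<close>, dividing the argument by \<open>I\<close>
  divides the modular by at least \<open>I\<close>.\<close>

lemma gauges_scale:
  assumes f: "f \<in> borel_measurable M" and C: "C > 0" and I: "I \<ge> 1"
    "(\<integral>\<^sup>+ \<omega>. ennreal (\<Psi> (cmod (f \<omega>) / C)) \<partial>M) \<le> ennreal I"
  shows "C * I \<in> gauges f"
proof -
  have "(\<integral>\<^sup>+ \<omega>. ennreal (\<Psi> (cmod (f \<omega>) / (C * I))) \<partial>M) \<le> (\<integral>\<^sup>+ \<omega>. ennreal (1 / I) * ennreal (\<Psi> (cmod (f \<omega>) / C)) \<partial>M)"
  proof (intro nn_integral_mono)
    fix \<omega>
    have "\<Psi> ((1 / I) * (cmod (f \<omega>) / C)) \<le> (1 / I) * \<Psi> (cmod (f \<omega>) / C)" using I C by (intro Psi_scale) auto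
    then show "ennreal (\<Psi> (cmod (f \<omega>) / (C * I))) \<le> ennreal (1 / I) * ennreal (\<Psi> (cmod (f \<omega>) / C))"
      using I C Psi_nonneg by (simp add: ennreal_mult[symmetric] ennreal_leI mult.commute)
  qed
  also have "\<dots> = ennreal (1 / I) * (\<integral>\<^sup>+ \<omega>. ennreal (\<Psi> (cmod (f \<omega>) / C)) \<partial>M)"
    by (rule nn_integral_cmult[OF Psi_meas[OF f C]])
  also have "\<dots> \<le> ennreal (1 / I) * ennreal I" by (intro mult_left_mono I(2)) auto
  also have "\<dots> = 1" using I by (simp add: ennreal_mult[symmetric])
  finally show ?thesis using C I by (simp add: gauges_def)
qed

lemma gauges_nonempty: assumes "f \<in> orlicz_space M \<Psi>" shows "gauges f \<noteq> {}"
proof -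
  obtain C where C: "f \<in> borel_measurable M" "C > 0" "(\<integral>\<^sup>+ \<omega>. ennreal (\<Psi> (cmod (f \<omega>) / C)) \<partial>M) < \<infinity>"
    using assms by (auto simp: orlicz_space_def)
  obtain r where r: "r \<ge> 0" "(\<integral>\<^sup>+ \<omega>. ennreal (\<Psi> (cmod (f \<omega>) / C)) \<partial>M) = ennreal r"
    using C(3) by (cases "\<integral>\<^sup>+ \<omega>. ennreal (\<Psi> (cmod (f \<omega>) / C)) \<partial>M") auto
  have "C * max 1 r \<in> gauges f" using C r by (intro gauges_scale) (auto intro: ennreal_leI)
  then show ?thesis by blast
qed

lemma gauges_gt:
  assumes "f \<in> orlicz_space M \<Psi>" "luxemburg_norm M \<Psi> f < C"
  shows "C \<in> gauges f"
proof -
  obtain C' where "C' \<in> gauges f" "C' < C"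
    using cInf_lessD[OF gauges_nonempty[OF assms(1)]] assms(2) unfolding norm_gauges by blast
  then show ?thesis using gauges_solid[of C' f C f] by simp
qed

text \<open>Convexity with the weights \<open>C / (C + D)\<close> and
  \<open>D / (C + D)\<close>.\<close>

lemma gauges_add:
  assumes f: "f \<in> borel_measurable M" and g: "g \<in> borel_measurable M"
    and C: "C \<in> gauges f" and D: "D \<in> gauges g"
  shows "C + D \<in> gauges (\<lambda>\<omega>. f \<omega> + g \<omega>)"
proof -
  have pos: "C > 0" "D > 0" using C D by (auto simp: gauges_def)
  define t where "t = C / (C + D)"
  have t: "0 \<le> t" "t \<le> 1" "1 - t = D / (C + D)" using pos by (auto simp: t_def field_simps)
  have "(\<integral>\<^sup>+ \<omega>. ennreal (\<Psi> (cmod (f \<omega> + g \<omega>) / (C + D))) \<partial>M) \<le>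
      (\<integral>\<^sup>+ \<omega>. ennreal t * ennreal (\<Psi> (cmod (f \<omega>) / C)) + ennreal (1 - t) * ennreal (\<Psi> (cmod (g \<omega>) / D)) \<partial>M)"
  proof (intro nn_integral_mono)
    fix \<omega>
    have "cmod (f \<omega> + g \<omega>) / (C + D) \<le> (cmod (f \<omega>) + cmod (g \<omega>)) / (C + D)"
      using pos by (intro divide_right_mono norm_triangle_ineq) auto
    also have "\<dots> = t * (cmod (f \<omega>) / C) + (1 - t) * (cmod (g \<omega>) / D)"
      unfolding t(3) unfolding t_def using pos by (simp add: add_divide_distrib)
    finally have "\<Psi> (cmod (f \<omega> + g \<omega>) / (C + D)) \<le> \<Psi> (t * (cmod (f \<omega>) / C) + (1 - t) * (cmod (g \<omega>) / D))"
      using pos by (intro Psi_mono) auto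
    also have "\<dots> \<le> t * \<Psi> (cmod (f \<omega>) / C) + (1 - t) * \<Psi> (cmod (g \<omega>) / D)"
      using convex_onD[OF Psi_convex t(1,2), of "cmod (g \<omega>) / D" "cmod (f \<omega>) / C"] pos by (simp add: add.commute)
    finally show "ennreal (\<Psi> (cmod (f \<omega> + g \<omega>) / (C + D))) \<le>
        ennreal t * ennreal (\<Psi> (cmod (f \<omega>) / C)) + ennreal (1 - t) * ennreal (\<Psi> (cmod (g \<omega>) / D))"
      using t pos Psi_nonneg by (simp add: ennreal_mult[symmetric] ennreal_plus[symmetric] ennreal_leI del: ennreal_plus)
  qed
  also have "\<dots> = ennreal t * (\<integral>\<^sup>+ \<omega>. ennreal (\<Psi> (cmod (f \<omega>) / C)) \<partial>M) + ennreal (1 - t) * (\<integral>\<^sup>+ \<omega>. ennreal (\<Psi> (cmod (g \<omega>) / D)) \<partial>M)"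
    using Psi_meas[OF f pos(1)] Psi_meas[OF g pos(2)] by (simp add: nn_integral_add nn_integral_cmult)
  also have "\<dots> \<le> ennreal t * 1 + ennreal (1 - t) * 1"
    using C D by (intro add_mono mult_left_mono) (auto simp: gauges_def)
  also have "\<dots> = 1" using t by (simp add: ennreal_plus[symmetric] del: ennreal_plus)
  finally show ?thesis using pos by (simp add: gauges_def)
qed

lemma gauges_cmult: "C \<in> gauges f \<Longrightarrow> c \<noteq> 0 \<Longrightarrow> cmod c * C \<in> gauges (\<lambda>\<omega>. c * f \<omega>)"
  by (simp add: gauges_def norm_mult)

lemma orlicz_meas: "f \<in> orlicz_space M \<Psi> \<Longrightarrow> f \<in> borel_measurable M"
  by (simp add: orlicz_space_def)

lemma orlicz_zero: "(\<lambda>_. 0) \<in> orlicz_space M \<Psi>" "luxemburg_norm M \<Psi> (\<lambda>_. 0) = 0"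
proof -
  have g: "C \<in> gauges (\<lambda>_. 0)" if "C > 0" for C using that by (simp add: gauges_def Psi_0)
  then have "gauges (\<lambda>_. 0) = {0<..}" by (auto simp: gauges_def)
  then show "luxemburg_norm M \<Psi> (\<lambda>_. 0) = 0" by (simp add: norm_gauges)
  show "(\<lambda>_. 0) \<in> orlicz_space M \<Psi>" using gauges_mem[OF _ g[of 1]] by simp
qed

lemma orlicz_cmult:
  assumes f: "f \<in> orlicz_space M \<Psi>"
  shows "(\<lambda>\<omega>. c * f \<omega>) \<in> orlicz_space M \<Psi>" "luxemburg_norm M \<Psi> (\<lambda>\<omega>. c * f \<omega>) = cmod c * luxemburg_norm M \<Psi> f"
proof -
  have mem: "(\<lambda>\<omega>. c * f \<omega>) \<in> orlicz_space M \<Psi>" if f: "f \<in> orlicz_space M \<Psi>" "c \<noteq> 0" for f c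
  proof -
    have [measurable]: "f \<in> borel_measurable M" using orlicz_meas[OF f(1)] .
    obtain C where "C \<in> gauges f" using gauges_nonempty[OF f(1)] by blast
    from gauges_cmult[OF this f(2)] show ?thesis by (rule gauges_mem[rotated]) measurable
  qed
  have le: "luxemburg_norm M \<Psi> (\<lambda>\<omega>. c * f \<omega>) \<le> cmod c * luxemburg_norm M \<Psi> f"
    if f: "f \<in> orlicz_space M \<Psi>" "c \<noteq> 0" for f c
  proof (rule field_le_epsilon)
    fix e :: real assume "e > 0"
    then have "luxemburg_norm M \<Psi> f + e / cmod c \<in> gauges f" using f by (intro gauges_gt) auto
    from gauges_le[OF gauges_cmult[OF this f(2)]]
    show "luxemburg_norm M \<Psi> (\<lambda>\<omega>. c * f \<omega>) \<le> cmod c * luxemburg_norm M \<Psi> f + e"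
      using f(2) by (simp add: distrib_left)
  qed
  show "(\<lambda>\<omega>. c * f \<omega>) \<in> orlicz_space M \<Psi>" using mem[OF f, of c] orlicz_zero(1) by (cases "c = 0") auto
  show "luxemburg_norm M \<Psi> (\<lambda>\<omega>. c * f \<omega>) = cmod c * luxemburg_norm M \<Psi> f"
  proof (cases "c = 0")
    case False
    have "luxemburg_norm M \<Psi> (\<lambda>\<omega>. inverse c * (c * f \<omega>)) \<le> cmod (inverse c) * luxemburg_norm M \<Psi> (\<lambda>\<omega>. c * f \<omega>)"
      using False by (intro le mem f) auto
    moreover have "(\<lambda>\<omega>. inverse c * (c * f \<omega>)) = f" using False by auto
    ultimately have "luxemburg_norm M \<Psi> f \<le> luxemburg_norm M \<Psi> (\<lambda>\<omega>. c * f \<omega>) / cmod c"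
      by (simp add: norm_inverse divide_inverse mult.commute)
    then have "cmod c * luxemburg_norm M \<Psi> f \<le> luxemburg_norm M \<Psi> (\<lambda>\<omega>. c * f \<omega>)" using False by (simp add: field_simps)
    then show ?thesis using le[OF f False] by simp
  qed (simp add: orlicz_zero)
qed

sublocale function_lattice M "orlicz_space M \<Psi>" "luxemburg_norm M \<Psi>"
proof
  fix f g :: "'a \<Rightarrow> complex"
  assume f: "f \<in> orlicz_space M \<Psi>"
  then show "f \<in> borel_measurable M" by (rule orlicz_meas)
  note [measurable] = orlicz_meas[OF f]
  obtain C where C: "C \<in> gauges f" using gauges_nonempty[OF f] by blast
  {
    assume g: "g \<in> orlicz_space M \<Psi>"
    note [measurable] = orlicz_meas[OF g]
    obtain D where D: "D \<in> gauges g" using gauges_nonempty[OF g] by blast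
    show "(\<lambda>\<omega>. f \<omega> + g \<omega>) \<in> orlicz_space M \<Psi>"
      by (rule gauges_mem[OF _ gauges_add[OF _ _ C D]]) measurable
    show "luxemburg_norm M \<Psi> (\<lambda>\<omega>. f \<omega> + g \<omega>) \<le> luxemburg_norm M \<Psi> f + luxemburg_norm M \<Psi> g"
    proof (rule field_le_epsilon)
      fix e :: real assume e: "e > 0"
      have "luxemburg_norm M \<Psi> f + e / 2 \<in> gauges f" "luxemburg_norm M \<Psi> g + e / 2 \<in> gauges g"
        using e f g by (auto intro!: gauges_gt)
      from gauges_le[OF gauges_add[OF orlicz_meas[OF f] orlicz_meas[OF g] this]]
      show "luxemburg_norm M \<Psi> (\<lambda>\<omega>. f \<omega> + g \<omega>) \<le> luxemburg_norm M \<Psi> f + luxemburg_norm M \<Psi> g + e" by simp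
    qed
  }
  {
    assume g: "g \<in> borel_measurable M" "\<And>\<omega>. cmod (g \<omega>) \<le> cmod (f \<omega>)"
    show "g \<in> orlicz_space M \<Psi>" by (rule gauges_mem[OF g(1) gauges_solid[OF C order_refl g(2)]])
    show "luxemburg_norm M \<Psi> g \<le> luxemburg_norm M \<Psi> f"
    proof (rule field_le_epsilon)
      fix e :: real assume "e > 0"
      then have "luxemburg_norm M \<Psi> f + e \<in> gauges f" using f by (intro gauges_gt) auto
      then show "luxemburg_norm M \<Psi> g \<le> luxemburg_norm M \<Psi> f + e" by (rule gauges_le[OF gauges_solid[OF _ order_refl g(2)]])
    qed
  }
qed (use orlicz_zero orlicz_cmult in auto)

end

section \<open>Modular estimates and the double limit\<close>

locale uniformly_convex_orlicz = orlicz_prob \<Psi> M for \<Psi> and M :: "'a measure" +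
  fixes Q :: "real \<Rightarrow> real" and a b :: real
  assumes Q_mono: "mono Q" and Q_nonneg: "0 \<le> Q x" and b_nonneg: "b \<ge> 0"
    and Q_le: "x \<ge> 0 \<Longrightarrow> Q x \<le> a * \<Psi> x" and Psi_le_Q: "x \<ge> 0 \<Longrightarrow> \<Psi> (x / 2) \<le> Q x + b"
    and Q_midpoint: "Q (cmod (u + v) / 2) \<le> (Q (cmod u) + Q (cmod v)) / 2"
    and Q_uniform: "\<epsilon> > 0 \<Longrightarrow> \<exists>\<delta>>0. \<forall>u v. \<epsilon> * max (cmod u) (cmod v) \<le> cmod (u - v) \<longrightarrow>
       Q (cmod (u + v) / 2) \<le> (1 - \<delta>) * ((Q (cmod u) + Q (cmod v)) / 2)"
begin

abbreviation X :: "('a \<Rightarrow> complex) set" where "X \<equiv> orlicz_space M \<Psi>"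
abbreviation N :: "('a \<Rightarrow> complex) \<Rightarrow> real" where "N \<equiv> luxemburg_norm M \<Psi>"

lemma Q_meas [measurable]: "Q \<in> borel_measurable borel"
  using Q_mono by (rule borel_measurable_mono)

lemma Q_0: "Q 0 = 0"
  using Q_le[of 0] Q_nonneg[of 0] Psi_0 by simp

lemma Q_ball:
  assumes f: "f \<in> X" "N f \<le> 1 / 2"
  shows "(\<integral>\<^sup>+ \<omega>. ennreal (Q (cmod (f \<omega>))) \<partial>M) \<le> ennreal \<bar>a\<bar>"
proof -
  \<comment> \<open>Radius 1/2 lies strictly below 1, so 1 is an admissible Luxemburg
    constant.\<close>
  have g: "1 \<in> gauges f" using f by (intro gauges_gt) auto
  have "(\<integral>\<^sup>+ \<omega>. ennreal (Q (cmod (f \<omega>))) \<partial>M) \<le> (\<integral>\<^sup>+ \<omega>. ennreal \<bar>a\<bar> * ennreal (\<Psi> (cmod (f \<omega>) / 1)) \<partial>M)"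
  proof (intro nn_integral_mono)
    fix \<omega>
    have "Q (cmod (f \<omega>)) \<le> a * \<Psi> (cmod (f \<omega>))" by (rule Q_le) simp
    also have "\<dots> \<le> \<bar>a\<bar> * \<Psi> (cmod (f \<omega>))" using Psi_nonneg by (intro mult_right_mono) auto
    finally show "ennreal (Q (cmod (f \<omega>))) \<le> ennreal \<bar>a\<bar> * ennreal (\<Psi> (cmod (f \<omega>) / 1))"
      using Psi_nonneg by (simp add: ennreal_mult[symmetric] ennreal_leI)
  qed
  also have "\<dots> = ennreal \<bar>a\<bar> * (\<integral>\<^sup>+ \<omega>. ennreal (\<Psi> (cmod (f \<omega>) / 1)) \<partial>M)"
    by (rule nn_integral_cmult[OF Psi_meas[OF orlicz_meas[OF f(1)]]]) simp
  also have "\<dots> \<le> ennreal \<bar>a\<bar> * 1" using g by (intro mult_left_mono) (auto simp: gauges_def)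
  finally show ?thesis by simp
qed

text \<open>On a probability space the additive constant \<open>b\<close> integrates to
  \<open>b\<close>. However small the modular is, only a fixed bound on the norm results, as
  \<open>\<Psi>\<close> may grow too fast; functions of small modular therefore need
  \<open>V_set_tail\<close>.\<close>

lemma Q_norm:
  assumes f: "f \<in> borel_measurable M" "(\<integral>\<^sup>+ \<omega>. ennreal (Q (cmod (f \<omega>))) \<partial>M) \<le> 1"
  shows "f \<in> X" "N f \<le> 2 * (1 + b)"
proof -
  note [measurable] = f(1)
  have "(\<integral>\<^sup>+ \<omega>. ennreal (\<Psi> (cmod (f \<omega>) / 2)) \<partial>M) \<le> (\<integral>\<^sup>+ \<omega>. ennreal (Q (cmod (f \<omega>))) + ennreal b \<partial>M)"
    using Psi_le_Q Q_nonneg b_nonneg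
    by (intro nn_integral_mono) (simp add: ennreal_plus[symmetric] ennreal_leI del: ennreal_plus)
  also have "\<dots> = (\<integral>\<^sup>+ \<omega>. ennreal (Q (cmod (f \<omega>))) \<partial>M) + ennreal b"
    by (subst nn_integral_add) (auto simp: emeasure_space_1)
  also have "\<dots> \<le> ennreal 1 + ennreal b" using f(2) by (intro add_mono) auto
  also have "\<dots> = ennreal (1 + b)" using b_nonneg by (simp add: ennreal_plus)
  finally have g: "2 * (1 + b) \<in> gauges f" using b_nonneg by (intro gauges_scale f) auto
  show "f \<in> X" "N f \<le> 2 * (1 + b)" using gauges_mem[OF f(1) g] gauges_le[OF g] by auto
qed

text \<open>Otherwise one picks functions \<open>f n\<close> of summable modular, each dominating on its support the sum
  of the moduli of the previous ones. Then \<open>(\<Sum>i<n. |f i|) \<le> 2 max |f i|\<close> is bounded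
  in norm, so \<open>f\<close> is weakly unconditionally Cauchy without having disjoint supports.\<close>

lemma V_set_tail:
  assumes A: "V_set A" and \<epsilon>: "\<epsilon> > 0"
  shows "\<exists>x\<in>pos. \<exists>\<delta>>0. \<forall>g\<in>A. \<forall>f\<in>borel_measurable M.
    (\<integral>\<^sup>+ \<omega>. ennreal (Q (cmod (f \<omega>))) \<partial>M) \<le> ennreal \<delta> \<longrightarrow>
    (\<forall>\<omega>. f \<omega> \<noteq> 0 \<longrightarrow> x \<omega> \<le> cmod (f \<omega>)) \<longrightarrow> cmod (g f) \<le> \<epsilon>"
proof (rule ccontr)
  assume contra: "\<not> ?thesis"
  have ex: "\<exists>g f. g \<in> A \<and> f \<in> borel_measurable M \<and> (\<integral>\<^sup>+ \<omega>. ennreal (Q (cmod (f \<omega>))) \<partial>M) \<le> ennreal \<delta> \<and>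
      (\<forall>\<omega>. f \<omega> \<noteq> 0 \<longrightarrow> x \<omega> \<le> cmod (f \<omega>)) \<and> \<epsilon> < cmod (g f)" if x: "x \<in> pos" and \<delta>: "\<delta> > 0" for x \<delta>
  proof (rule ccontr)
    assume "\<not> ?thesis"
    then have "\<forall>g\<in>A. \<forall>f\<in>borel_measurable M. (\<integral>\<^sup>+ \<omega>. ennreal (Q (cmod (f \<omega>))) \<partial>M) \<le> ennreal \<delta> \<longrightarrow>
      (\<forall>\<omega>. f \<omega> \<noteq> 0 \<longrightarrow> x \<omega> \<le> cmod (f \<omega>)) \<longrightarrow> cmod (g f) \<le> \<epsilon>" by (simp only: not_ex de_Morgan_conj not_less) blast
    with contra x \<delta> show False by blast
  qed
  \<comment> \<open>The modulars \<open>(1 / 2) ^ Suc n\<close> have sum at most 1, the size that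
    \<open>Q_norm\<close> accepts.\<close>
  define P where "P s n p \<longleftrightarrow> fst p \<in> A \<and> snd p \<in> borel_measurable M \<and>
      (\<integral>\<^sup>+ \<omega>. ennreal (Q (cmod (snd p \<omega>))) \<partial>M) \<le> ennreal ((1 / 2) ^ Suc n) \<and>
      (\<forall>\<omega>. snd p \<omega> \<noteq> 0 \<longrightarrow> (\<Sum>i<n. cmod (snd (s i) \<omega>)) \<le> cmod (snd p \<omega>)) \<and> \<epsilon> < cmod (fst p (snd p))"
    for s :: "nat \<Rightarrow> (('a \<Rightarrow> complex) \<Rightarrow> complex) \<times> ('a \<Rightarrow> complex)" and n p
  have P_X: "snd p \<in> X" if "P s n p" for s n p
  proof -
    have "(1 / 2 :: real) ^ Suc n \<le> 1" by (rule power_le_one) auto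
    then have "ennreal ((1 / 2) ^ Suc n) \<le> 1" by (simp only: ennreal_le_1)
    then show ?thesis using that unfolding P_def by (intro Q_norm(1)) (auto intro: order_trans)
  qed
  have "\<exists>s. \<forall>n. P s n (s n)"
  proof (rule dependent_wellorder_choice)
    show "P s n r = P t n r" if "\<And>y. y < n \<Longrightarrow> s y = t y" for s t r n
      using that by (simp add: P_def)
  next
    fix n s assume "\<And>y. y < n \<Longrightarrow> P s y (s y)"
    then have "(\<lambda>\<omega>. \<Sum>i<n. cmod (snd (s i) \<omega>)) \<in> pos"
      by (intro pos_sum pos_abs) (auto intro: P_X)
    from ex[OF this, of "(1 / 2) ^ Suc n"] obtain g f where "P s n (g, f)" unfolding P_def by auto
    then show "\<exists>r. P s n r" by blast
  qed
  then obtain s where s: "\<And>n. P s n (s n)" by blast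
  define f where "f n = snd (s n)" for n
  define g where "g n = fst (s n)" for n
  have fX: "f n \<in> X" for n using P_X[OF s] by (simp add: f_def)
  have f [measurable]: "f n \<in> borel_measurable M"
    and fQ: "(\<integral>\<^sup>+ \<omega>. ennreal (Q (cmod (f n \<omega>))) \<partial>M) \<le> ennreal ((1 / 2) ^ Suc n)"
    and fdom: "f n \<omega> \<noteq> 0 \<Longrightarrow> (\<Sum>i<n. cmod (f i \<omega>)) \<le> cmod (f n \<omega>)"
    and gA: "g n \<in> A" and gf: "\<epsilon> < cmod (g n (f n))" for n \<omega>
    using s[of n] by (auto simp: P_def f_def g_def)
  \<comment> \<open>At each point the last nonvanishing term decides: it is at least the sum of the
    previous ones, hence at least half of the whole sum.\<close>
  have Qsum: "Q ((\<Sum>i<n. cmod (f i \<omega>)) / 2) \<le> (\<Sum>i<n. Q (cmod (f i \<omega>)))" for n \<omega>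
  proof (induction n)
    case (Suc n)
    show ?case
    proof (cases "f n \<omega> = 0")
      case False
      have "Q ((\<Sum>i<Suc n. cmod (f i \<omega>)) / 2) \<le> Q (cmod (f n \<omega>))"
        using fdom[OF False] by (intro monoD[OF Q_mono]) simp
      also have "\<dots> \<le> (\<Sum>i<Suc n. Q (cmod (f i \<omega>)))" using Q_nonneg by (simp add: sum_nonneg)
      finally show ?thesis .
    qed (use Suc Q_0 in auto)
  qed (simp add: Q_0)
  have bound: "NR (\<lambda>\<omega>. \<Sum>i<n. cmod (f i \<omega>)) \<le> 4 * (1 + b)" for n
  proof -
    define p where "p = (\<lambda>\<omega>. \<Sum>i<n. cmod (f i \<omega>))"
    have p: "p \<in> pos" unfolding p_def by (intro pos_sum pos_abs fX)
    have p0: "p \<omega> \<ge> 0" for \<omega> using pos_nonneg[OF p] .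
    have [measurable]: "p \<in> borel_measurable M" using pos_meas[OF p] .
    have "(\<integral>\<^sup>+ \<omega>. ennreal (Q (cmod (complex_of_real (1/2) * complex_of_real (p \<omega>)))) \<partial>M) \<le>
        (\<integral>\<^sup>+ \<omega>. (\<Sum>i<n. ennreal (Q (cmod (f i \<omega>)))) \<partial>M)"
    proof (intro nn_integral_mono)
      fix \<omega>
      have "cmod (complex_of_real (1/2) * complex_of_real (p \<omega>)) = p \<omega> / 2" using p0[of \<omega>] by (simp add: norm_mult)
      then have "Q (cmod (complex_of_real (1/2) * complex_of_real (p \<omega>))) \<le> (\<Sum>i<n. Q (cmod (f i \<omega>)))"
        using Qsum[of \<omega> n] by (simp only: p_def)
      then show "ennreal (Q (cmod (complex_of_real (1/2) * complex_of_real (p \<omega>)))) \<le> (\<Sum>i<n. ennreal (Q (cmod (f i \<omega>))))"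
        using Q_nonneg by (simp add: sum_ennreal ennreal_leI)
    qed
    also have "\<dots> = (\<Sum>i<n. (\<integral>\<^sup>+ \<omega>. ennreal (Q (cmod (f i \<omega>))) \<partial>M))" by (rule nn_integral_sum) measurable
    also have "\<dots> \<le> (\<Sum>i<n. ennreal ((1 / 2) ^ Suc i))" by (intro sum_mono fQ)
    also have "\<dots> = ennreal (\<Sum>i<n. (1 / 2) ^ Suc i)" by (rule sum_ennreal) auto
    also have "(\<Sum>i<n. (1 / 2 :: real) ^ Suc i) = 1 - (1 / 2) ^ n" by (induction n) auto
    also have "ennreal (1 - (1 / 2) ^ n) \<le> 1" by (simp flip: ennreal_1)
    finally have "N (\<lambda>\<omega>. complex_of_real (1/2) * complex_of_real (p \<omega>)) \<le> 2 * (1 + b)"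
      by (intro Q_norm(2)) measurable
    then have "NR p \<le> 4 * (1 + b)" unfolding N_cmult[OF pos_X[OF p]] by simp
    then show ?thesis by (simp add: p_def)
  qed
  from V_setD[OF A wuc_sequenceI[OF fX bound] \<epsilon>]
  obtain n0 where "\<And>n g. n \<ge> n0 \<Longrightarrow> g \<in> A \<Longrightarrow> cmod (g (f n)) \<le> \<epsilon>" by blast
  from this[OF order_refl gA, of n0] gf[of n0] show False by simp
qed

text \<open>Uniform convexity says nothing where the difference of two combinations is small
  compared with their moduli; there the norm bound 1/2 on each gives a small norm directly.
  Elsewhere the midpoint defect of the integral controls the modular of half the difference.\<close>

lemma modular_convex_Cauchy:
  assumes f: "\<And>n. f n \<in> X" "\<And>n. N (f n) \<le> 1 / 2"
  shows "\<exists>T. (\<forall>k. leaves (T k) \<subseteq> {k..}) \<and> (\<forall>\<epsilon>>0. \<forall>\<delta>>0. \<exists>K. \<forall>k\<ge>K. \<forall>l\<ge>K. \<exists>r\<in>X. \<exists>w\<in>X.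
    (\<forall>\<omega>. teval f (T k) \<omega> - teval f (T l) \<omega> = r \<omega> + w \<omega>) \<and> N r \<le> \<epsilon> \<and>
    (\<integral>\<^sup>+ \<omega>. ennreal (Q (cmod (w \<omega>) / 2)) \<partial>M) \<le> ennreal \<delta>)"
proof -
  have tX: "teval f T \<in> X" and tN: "N (teval f T) \<le> 1 / 2" for T
    using teval_X[of f, OF f(1)] N_teval[of f "1/2", OF f] by auto
  have tm [measurable]: "teval f T \<in> borel_measurable M" for T using orlicz_meas[OF tX] .
  define J where "J T = (LINT \<omega>|M. Q (cmod (teval f T \<omega>)))" for T
  have fin: "(\<integral>\<^sup>+ \<omega>. ennreal (Q (cmod (teval f T \<omega>))) \<partial>M) < \<infinity>" for T
    using Q_ball[OF tX tN] by (rule le_less_trans) simp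
  have int: "integrable M (\<lambda>\<omega>. Q (cmod (teval f T \<omega>)))" for T
    by (rule integrableI_nonneg) (use fin Q_nonneg in auto)
  have J0: "0 \<le> J T" for T unfolding J_def using Q_nonneg by simp
  have JC: "J T \<le> \<bar>a\<bar>" for T
  proof -
    have "ennreal (J T) \<le> ennreal \<bar>a\<bar>"
      unfolding J_def by (subst nn_integral_eq_integral[symmetric, OF int]) (use Q_ball[OF tX tN] Q_nonneg in auto)
    then show ?thesis by simp
  qed
  obtain T where T: "\<And>k. leaves (T k) \<subseteq> {k..}"
    "\<And>\<eta>. \<eta> > 0 \<Longrightarrow> \<exists>K. \<forall>k\<ge>K. \<forall>l\<ge>K. (J (T k) + J (T l)) / 2 - J (Mid (T k) (T l)) \<le> \<eta>"
    using midpoint_minimise[of J "\<bar>a\<bar>", OF J0 JC] by blast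
  show ?thesis
  proof (intro exI[of _ T] conjI allI impI T(1))
    fix \<epsilon> \<delta> :: real assume \<epsilon>: "\<epsilon> > 0" and \<delta>: "\<delta> > 0"
    obtain d where d: "d > 0" "\<And>u v. \<epsilon> * max (cmod u) (cmod v) \<le> cmod (u - v) \<Longrightarrow>
       Q (cmod (u + v) / 2) \<le> (1 - d) * ((Q (cmod u) + Q (cmod v)) / 2)"
      using Q_uniform[OF \<epsilon>] by blast
    obtain K where K: "\<And>k l. k \<ge> K \<Longrightarrow> l \<ge> K \<Longrightarrow> (J (T k) + J (T l)) / 2 - J (Mid (T k) (T l)) \<le> d / 2 * \<delta>"
      using T(2)[of "d / 2 * \<delta>"] d \<delta> by (meson half_gt_zero mult_pos_pos)
    show "\<exists>K. \<forall>k\<ge>K. \<forall>l\<ge>K. \<exists>r\<in>X. \<exists>w\<in>X.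
        (\<forall>\<omega>. teval f (T k) \<omega> - teval f (T l) \<omega> = r \<omega> + w \<omega>) \<and> N r \<le> \<epsilon> \<and>
        (\<integral>\<^sup>+ \<omega>. ennreal (Q (cmod (w \<omega>) / 2)) \<partial>M) \<le> ennreal \<delta>"
    proof (intro exI[of _ K] allI impI)
      fix k l assume kl: "K \<le> k" "K \<le> l"
      define u where "u = teval f (T k)"
      define v where "v = teval f (T l)"
      have uX: "u \<in> X" "N u \<le> 1 / 2" and vX: "v \<in> X" "N v \<le> 1 / 2" using tX tN by (auto simp: u_def v_def)
      have [measurable]: "u \<in> borel_measurable M" "v \<in> borel_measurable M" by (auto simp: u_def v_def)
      define big where "big \<omega> \<longleftrightarrow> \<epsilon> * max (cmod (u \<omega>)) (cmod (v \<omega>)) \<le> cmod (u \<omega> - v \<omega>)" for \<omega>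
      have [measurable]: "Measurable.pred M big" unfolding big_def by measurable
      define r where "r = (\<lambda>\<omega>. if big \<omega> then 0 else u \<omega> - v \<omega>)"
      define w where "w = (\<lambda>\<omega>. if big \<omega> then u \<omega> - v \<omega> else 0)"
      have [measurable]: "r \<in> borel_measurable M" "w \<in> borel_measurable M" unfolding r_def w_def by measurable
      define e where "e = (\<lambda>\<omega>. \<epsilon> * (cmod (u \<omega>) + cmod (v \<omega>)))"
      have e: "e \<in> pos" unfolding e_def using \<epsilon> uX vX by (intro pos_cmult pos_add pos_abs) auto
      have re: "cmod (r \<omega>) \<le> e \<omega>" for \<omega>
      proof (cases "big \<omega>")
        case True
        then show ?thesis using pos_nonneg[OF e, of \<omega>] by (simp add: r_def)
      next
        case False
        then have "cmod (r \<omega>) \<le> \<epsilon> * max (cmod (u \<omega>)) (cmod (v \<omega>))" by (simp add: r_def big_def)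
        also have "\<dots> \<le> e \<omega>" unfolding e_def using \<epsilon> by (intro mult_left_mono) auto
        finally show ?thesis .
      qed
      have rX: "r \<in> X" using dominated_X(1)[OF e _ re] by simp
      have "N r \<le> NR e" using dominated_X(2)[OF e _ re] by simp
      also have "NR e \<le> \<epsilon>"
      proof -
        define p where "p = (\<lambda>\<omega>. complex_of_real (cmod (u \<omega>)))"
        define p' where "p' = (\<lambda>\<omega>. complex_of_real (cmod (v \<omega>)))"
        have p: "p \<in> X" "p' \<in> X" unfolding p_def p'_def using pos_X[OF pos_abs] uX vX by auto
        have "N p \<le> N u" by (rule N_solid[OF uX(1) X_meas[OF p(1)]]) (simp add: p_def)
        moreover have "N p' \<le> N v" by (rule N_solid[OF vX(1) X_meas[OF p(2)]]) (simp add: p'_def)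
        ultimately have "N (\<lambda>\<omega>. p \<omega> + p' \<omega>) \<le> 1" using N_add[OF p] uX(2) vX(2) by simp
        then have "\<epsilon> * N (\<lambda>\<omega>. p \<omega> + p' \<omega>) \<le> \<epsilon> * 1" using \<epsilon> by (intro mult_left_mono) auto
        moreover have "NR e = \<epsilon> * N (\<lambda>\<omega>. p \<omega> + p' \<omega>)"
          using N_cmult[OF X_add[OF p], of "of_real \<epsilon>"] \<epsilon> by (simp add: e_def p_def p'_def)
        ultimately show ?thesis by simp
      qed
      finally have rN: "N r \<le> \<epsilon>" .
      have "(\<lambda>\<omega>. u \<omega> - v \<omega>) \<in> X" by (rule X_diff[OF uX(1) vX(1)])
      then have wX: "w \<in> X" by (rule X_solid) (auto simp: w_def)
      \<comment> \<open>On \<open>big\<close> the right side is at least \<open>d\<close> times the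
        mean of \<open>Q (cmod (u \<omega>))\<close> and \<open>Q (cmod (v \<omega>))\<close>, and
        \<open>cmod (w \<omega>) / 2\<close> is at most the larger modulus; hence the factor
        \<open>d / 2\<close>.\<close>
      have pt: "d / 2 * Q (cmod (w \<omega>) / 2) \<le>
          (Q (cmod (u \<omega>)) + Q (cmod (v \<omega>))) / 2 - Q (cmod (teval f (Mid (T k) (T l)) \<omega>))" for \<omega>
      proof -
        have "teval f (Mid (T k) (T l)) \<omega> = (u \<omega> + v \<omega>) / 2"
          by (simp add: teval_Mid u_def v_def add_divide_distrib)
        then have mid: "cmod (teval f (Mid (T k) (T l)) \<omega>) = cmod (u \<omega> + v \<omega>) / 2"
          by (simp only: norm_divide norm_numeral)
        show ?thesis
        proof (cases "big \<omega>")
          case True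
          have wb: "cmod (w \<omega>) / 2 \<le> max (cmod (u \<omega>)) (cmod (v \<omega>))"
            using True norm_triangle_ineq4[of "u \<omega>" "v \<omega>"] by (simp add: w_def)
          have "Q (cmod (w \<omega>) / 2) \<le> Q (max (cmod (u \<omega>)) (cmod (v \<omega>)))" by (rule monoD[OF Q_mono wb])
          also have "\<dots> \<le> Q (cmod (u \<omega>)) + Q (cmod (v \<omega>))" using Q_nonneg by (simp add: max_def)
          finally have "d / 2 * Q (cmod (w \<omega>) / 2) \<le> d / 2 * (Q (cmod (u \<omega>)) + Q (cmod (v \<omega>)))"
            using d(1) by (intro mult_left_mono) auto
          moreover have "Q (cmod (u \<omega> + v \<omega>) / 2) \<le> (1 - d) * ((Q (cmod (u \<omega>)) + Q (cmod (v \<omega>))) / 2)"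
            using True by (intro d(2)) (simp add: big_def)
          moreover define s where "s = Q (cmod (u \<omega>)) + Q (cmod (v \<omega>))"
          ultimately show ?thesis unfolding mid s_def[symmetric] by (simp add: left_diff_distrib)
        next
          case False
          then show ?thesis unfolding mid using Q_midpoint[of "u \<omega>" "v \<omega>"] by (simp add: w_def Q_0)
        qed
      qed
      have iQ: "integrable M (\<lambda>\<omega>. (Q (cmod (u \<omega>)) + Q (cmod (v \<omega>))) / 2 - Q (cmod (teval f (Mid (T k) (T l)) \<omega>)))"
        unfolding u_def v_def by (intro Bochner_Integration.integrable_diff integrable_divide Bochner_Integration.integrable_add int)
      have "ennreal (d / 2) * (\<integral>\<^sup>+ \<omega>. ennreal (Q (cmod (w \<omega>) / 2)) \<partial>M) = (\<integral>\<^sup>+ \<omega>. ennreal (d / 2 * Q (cmod (w \<omega>) / 2)) \<partial>M)"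
      proof -
        have eq: "ennreal (d / 2 * Q t) = ennreal (d / 2) * ennreal (Q t)" for t
          using d(1) Q_nonneg by (intro ennreal_mult) auto
        show ?thesis unfolding eq by (rule nn_integral_cmult[symmetric]) measurable
      qed
      also have "\<dots> \<le> (\<integral>\<^sup>+ \<omega>. ennreal ((Q (cmod (u \<omega>)) + Q (cmod (v \<omega>))) / 2 - Q (cmod (teval f (Mid (T k) (T l)) \<omega>))) \<partial>M)"
        by (intro nn_integral_mono ennreal_leI pt)
      also have "\<dots> = ennreal (LINT \<omega>|M. (Q (cmod (u \<omega>)) + Q (cmod (v \<omega>))) / 2 - Q (cmod (teval f (Mid (T k) (T l)) \<omega>)))"
      proof (rule nn_integral_eq_integral[OF iQ AE_I2])
        fix \<omega>
        have "0 \<le> d / 2 * Q (cmod (w \<omega>) / 2)" using d(1) Q_nonneg by simp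
        then show "0 \<le> (Q (cmod (u \<omega>)) + Q (cmod (v \<omega>))) / 2 - Q (cmod (teval f (Mid (T k) (T l)) \<omega>))"
          using pt[of \<omega>] by linarith
      qed
      also have "(LINT \<omega>|M. (Q (cmod (u \<omega>)) + Q (cmod (v \<omega>))) / 2 - Q (cmod (teval f (Mid (T k) (T l)) \<omega>))) =
          (J (T k) + J (T l)) / 2 - J (Mid (T k) (T l))"
        unfolding J_def u_def v_def
        by (subst Bochner_Integration.integral_diff)
          (auto intro!: int integrable_divide Bochner_Integration.integrable_add simp: Bochner_Integration.integral_add[OF int int])
      also have "ennreal \<dots> \<le> ennreal (d / 2 * \<delta>)" by (intro ennreal_leI K kl)
      also have "\<dots> = ennreal (d / 2) * ennreal \<delta>" using d(1) \<delta> by (intro ennreal_mult) auto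
      finally have "(\<integral>\<^sup>+ \<omega>. ennreal (Q (cmod (w \<omega>) / 2)) \<partial>M) \<le> ennreal \<delta>"
        using d(1) by (subst (asm) ennreal_mult_le_mult_iff) auto
      moreover have "u \<omega> - v \<omega> = r \<omega> + w \<omega>" for \<omega> by (simp add: r_def w_def)
      ultimately show "\<exists>r\<in>X. \<exists>w\<in>X. (\<forall>\<omega>. teval f (T k) \<omega> - teval f (T l) \<omega> = r \<omega> + w \<omega>) \<and> N r \<le> \<epsilon> \<and>
          (\<integral>\<^sup>+ \<omega>. ennreal (Q (cmod (w \<omega>) / 2)) \<partial>M) \<le> ennreal \<delta>"
        using rX wX rN unfolding u_def v_def by blast
    qed
  qed
qed

lemma one_pos: "(\<lambda>_. 1) \<in> pos"
proof -
  have "(\<lambda>_. 1::complex) \<in> X"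
    by (auto simp: orlicz_space_def emeasure_space_1 intro!: exI[of _ 1])
  then show ?thesis by (simp add: pos_def)
qed

text \<open>Two layers of combinations: \<open>F\<close> along \<open>T\<close> makes differences
  small up to an order bounded part, \<open>G\<close> along \<open>S\<close> handles that part. Both
  keep the iterated limits: \<open>h n (G k)\<close> is near \<open>c\<close> for
  \<open>k > n\<close> and near 0 for \<open>n\<close> large compared with \<open>k\<close>.
  Comparing \<open>G k\<close> with \<open>G L\<close> gives
  \<open>cmod c \<le> 4 * \<epsilon>\<close>.\<close>

lemma V_set_no_double_limit:
  assumes A: "V_set A" and g: "\<And>n::nat. g n \<in> A" and g0: "g0 \<in> dual"
    and f: "\<And>n::nat. f n \<in> X" "\<And>n. N (f n) \<le> 1 / 2"
    and \<epsilon>: "\<epsilon> > 0" and c: "10 * \<epsilon> \<le> cmod c"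
    and le: "\<And>n m. m \<le> n \<Longrightarrow> cmod (g n (f m) - g0 (f m)) \<le> \<epsilon>"
    and gt: "\<And>n m. n < m \<Longrightarrow> cmod (g n (f m) - g0 (f m) - c) \<le> \<epsilon>"
  shows False
proof -
  define h where "h n = (\<lambda>f. g n f - g0 f)" for n
  have "range h \<subseteq> (\<lambda>g f. g f - g0 f) ` A" using g by (auto simp: h_def)
  then have hV: "V_set (range h)" using V_set_mono[OF V_set_translate[OF A g0]] by blast
  interpret h: dual_sequence M X N h by unfold_locales (rule hV)
  note hd = h.h_dual
  obtain B where B: "B \<ge> 0" "\<And>h' f. h' \<in> range h \<Longrightarrow> f \<in> X \<Longrightarrow> cmod (h' f) \<le> B * N f"
    using V_set_bounded[OF hV] by blast
  \<comment> \<open>One error \<open>h n (r l)\<close> and twice an error \<open>h n (z l)\<close>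
    add up to \<open>3 * \<eta> = \<epsilon> / 2\<close>.\<close>
  define \<eta> where "\<eta> = \<epsilon> / 6"
  have \<eta>: "\<eta> > 0" using \<epsilon> by (simp add: \<eta>_def)
  obtain x \<delta> where x: "x \<in> pos" "\<delta> > 0"
    and tail: "\<forall>h'\<in>range h. \<forall>f\<in>borel_measurable M.
      (\<integral>\<^sup>+ \<omega>. ennreal (Q (cmod (f \<omega>))) \<partial>M) \<le> ennreal \<delta> \<longrightarrow>
      (\<forall>\<omega>. f \<omega> \<noteq> 0 \<longrightarrow> x \<omega> \<le> cmod (f \<omega>)) \<longrightarrow> cmod (h' f) \<le> \<eta>"
    using V_set_tail[OF hV \<eta>] by (elim bexE exE conjE) (rule that)
  obtain T where T: "\<forall>k. leaves (T k) \<subseteq> {k..}" "\<forall>\<epsilon>>0. \<forall>\<delta>>0. \<exists>K. \<forall>k\<ge>K. \<forall>l\<ge>K. \<exists>r\<in>X. \<exists>w\<in>X.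
      (\<forall>\<omega>. teval f (T k) \<omega> - teval f (T l) \<omega> = r \<omega> + w \<omega>) \<and> N r \<le> \<epsilon> \<and>
      (\<integral>\<^sup>+ \<omega>. ennreal (Q (cmod (w \<omega>) / 2)) \<partial>M) \<le> ennreal \<delta>"
    using modular_convex_Cauchy[of f, OF f] by (elim exE conjE) (rule that)
  have "\<eta> / (B + 1) > 0" using \<eta> B(1) by simp
  from T(2)[rule_format, OF this x(2)] obtain K where K: "\<forall>k\<ge>K. \<forall>l\<ge>K. \<exists>r\<in>X. \<exists>w\<in>X.
      (\<forall>\<omega>. teval f (T k) \<omega> - teval f (T l) \<omega> = r \<omega> + w \<omega>) \<and> N r \<le> \<eta> / (B + 1) \<and>
      (\<integral>\<^sup>+ \<omega>. ennreal (Q (cmod (w \<omega>) / 2)) \<partial>M) \<le> ennreal \<delta>" by (rule exE)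
  define F where "F l = teval f (T (K + l))" for l
  have FX: "F l \<in> X" for l unfolding F_def by (rule teval_X[OF f(1)])
  have "\<exists>r w. r \<in> X \<and> w \<in> X \<and> (\<forall>\<omega>. F l \<omega> - F 0 \<omega> = r \<omega> + w \<omega>) \<and> N r \<le> \<eta> / (B + 1) \<and>
      (\<integral>\<^sup>+ \<omega>. ennreal (Q (cmod (w \<omega>) / 2)) \<partial>M) \<le> ennreal \<delta>" for l
    unfolding F_def using K[rule_format, of "K + l" "K + 0"] by (simp add: Bex_def)
  then obtain r w where rw: "\<And>l. r l \<in> X" "\<And>l. w l \<in> X" "\<And>l \<omega>. F l \<omega> - F 0 \<omega> = r l \<omega> + w l \<omega>"
    "\<And>l. N (r l) \<le> \<eta> / (B + 1)" "\<And>l. (\<integral>\<^sup>+ \<omega>. ennreal (Q (cmod (w l \<omega>) / 2)) \<partial>M) \<le> ennreal \<delta>"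
    by metis
  note [measurable] = X_meas[OF rw(2)] pos_meas[OF x(1)]
  \<comment> \<open>The modular estimate concerns half of \<open>w l\<close>, so that half is
    compared with \<open>x\<close>; then \<open>w l = y l + 2 * z l\<close>.\<close>
  define y where "y l = (\<lambda>\<omega>. if x \<omega> \<le> cmod (w l \<omega>) / 2 then 0 else w l \<omega>)" for l
  define z where "z l = (\<lambda>\<omega>. if x \<omega> \<le> cmod (w l \<omega>) / 2 then (1/2) * w l \<omega> else 0)" for l
  have [measurable]: "y l \<in> borel_measurable M" "z l \<in> borel_measurable M" for l unfolding y_def z_def by measurable
  have yX: "y l \<in> X" and zX: "z l \<in> X" for l
    by (rule X_solid[OF rw(2)[of l]]; simp add: y_def z_def norm_mult)+
  have hz: "cmod (h n (z l)) \<le> \<eta>" for n l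
  proof (rule tail[rule_format, of "h n" "z l"])
    have "(\<integral>\<^sup>+ \<omega>. ennreal (Q (cmod (z l \<omega>))) \<partial>M) \<le> (\<integral>\<^sup>+ \<omega>. ennreal (Q (cmod (w l \<omega>) / 2)) \<partial>M)"
      using Q_nonneg by (intro nn_integral_mono) (auto simp: z_def Q_0 norm_mult)
    also have "\<dots> \<le> ennreal \<delta>" by (rule rw(5))
    finally show "(\<integral>\<^sup>+ \<omega>. ennreal (Q (cmod (z l \<omega>))) \<partial>M) \<le> ennreal \<delta>" .
  qed (auto simp: z_def norm_mult split: if_splits)
  have hr: "cmod (h n (r l)) \<le> \<eta>" for n l
  proof -
    have "cmod (h n (r l)) \<le> B * N (r l)" by (rule B(2)[OF rangeI rw(1)])
    also have "\<dots> \<le> B * (\<eta> / (B + 1))" using B(1) rw(4) by (rule mult_left_mono[rotated])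
    also have "\<dots> \<le> \<eta>" using B(1) \<eta> by (simp add: field_simps)
    finally show ?thesis .
  qed
  have near: "cmod (h n (F l) - h n (y l) - h n (F 0)) \<le> \<epsilon> / 2" for n l
  proof -
    have "h n (\<lambda>\<omega>. F l \<omega> - F 0 \<omega>) = h n (\<lambda>\<omega>. r l \<omega> + (2 * z l \<omega> + y l \<omega>))"
      by (rule arg_cong[of _ _ "h n"]) (auto simp: fun_eq_iff rw(3) z_def y_def)
    also have "\<dots> = h n (r l) + h n (\<lambda>\<omega>. 2 * z l \<omega> + y l \<omega>)"
      by (intro dual_add hd rw X_add X_cmult zX yX)
    also have "h n (\<lambda>\<omega>. 2 * z l \<omega> + y l \<omega>) = h n (\<lambda>\<omega>. 2 * z l \<omega>) + h n (y l)"
      by (intro dual_add hd X_cmult zX yX)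
    also have "h n (\<lambda>\<omega>. 2 * z l \<omega>) = 2 * h n (z l)" by (intro dual_cmult hd zX)
    finally have "h n (F l) - h n (y l) - h n (F 0) = h n (r l) + 2 * h n (z l)"
      using dual_diff[OF hd FX FX, of n l 0] by (simp add: algebra_simps)
    then have "cmod (h n (F l) - h n (y l) - h n (F 0)) \<le> cmod (h n (r l)) + 2 * cmod (h n (z l))"
      using norm_triangle_ineq[of "h n (r l)" "2 * h n (z l)"] by (simp add: norm_mult)
    then show ?thesis using hr[of n l] hz[of n l] by (simp add: \<eta>_def)
  qed
  \<comment> \<open>\<open>y l\<close> is bounded by \<open>2 * x\<close>; adding 1 makes the bound
    strictly positive, as the division in the Hilbert seminorm requires.\<close>
  define x' where "x' = (\<lambda>\<omega>. 2 * x \<omega> + 1)"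
  have x': "x' \<in> pos" unfolding x'_def using x by (intro pos_add pos_cmult one_pos) auto
  have x'0: "0 < x' \<omega>" for \<omega> using pos_nonneg[OF x(1), of \<omega>] by (simp add: x'_def)
  have yx': "cmod (y l \<omega>) \<le> x' \<omega>" for l \<omega>
    using pos_nonneg[OF x(1), of \<omega>] by (auto simp: y_def x'_def)
  have ym: "y l \<in> borel_measurable M" for l by measurable
  obtain S where S: "\<And>k. leaves (S k) \<subseteq> {k..}"
    "\<And>\<epsilon>. \<epsilon> > 0 \<Longrightarrow> \<exists>K. \<forall>k\<ge>K. \<forall>l\<ge>K. \<forall>n. cmod (h n (teval y (S k)) - h n (teval y (S l))) \<le> \<epsilon>"
    using h.order_interval_convex_Cauchy[OF x' x'0, of y, OF ym yx'] by blast
  obtain L where L: "\<And>k l n. k \<ge> L \<Longrightarrow> l \<ge> L \<Longrightarrow> cmod (h n (teval y (S k)) - h n (teval y (S l))) \<le> \<epsilon>"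
    using S(2)[OF \<epsilon>] by blast
  define G where "G k = teval F (S k)" for k
  have hG: "h n (G k) = tval (\<lambda>i. h n (F i)) (S k)" for n k unfolding G_def by (rule dual_teval[OF hd FX])
  have Gy: "cmod (h n (G k) - h n (teval y (S k)) - h n (F 0)) \<le> \<epsilon> / 2" for n k
    using tval_near[of "S k" "\<lambda>i. h n (F i) - h n (y i)" "h n (F 0)" "\<epsilon> / 2"] near
    unfolding tval_diff hG dual_teval[OF hd yX] by blast
  have hF: "h n (F l) = tval (\<lambda>i. h n (f i)) (T (K + l))" for n l unfolding F_def by (rule dual_teval[OF hd f(1)])
  have F_c: "cmod (h n (F l) - c) \<le> \<epsilon>" if "n < l" for n l
    unfolding hF
  proof (rule tval_near)
    fix i assume "i \<in> leaves (T (K + l))"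
    then have "n < i" using T(1)[rule_format, of "K + l"] that by auto
    then show "cmod (h n (f i) - c) \<le> \<epsilon>" using gt by (simp add: h_def)
  qed
  have F_0: "cmod (h n (F l)) \<le> \<epsilon>" if "Max (leaves (T (K + l))) \<le> n" for n l
  proof -
    have "cmod (h n (f i) - 0) \<le> \<epsilon>" if i: "i \<in> leaves (T (K + l))" for i
    proof -
      have "i \<le> n" using Max_ge[OF finite_leaves i] \<open>Max (leaves (T (K + l))) \<le> n\<close> by simp
      then show ?thesis using le by (simp add: h_def)
    qed
    from tval_near[OF this] show ?thesis unfolding hF by simp
  qed
  have G_c: "cmod (h n (G k) - c) \<le> \<epsilon>" if "n < k" for n k
    unfolding hG by (rule tval_near, rule F_c) (use S(1)[of k] that in auto)
  \<comment> \<open>\<open>L\<close> was fixed uniformly in \<open>n\<close>. Now \<open>n\<close>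
    is chosen not below any index that occurs in \<open>G L\<close>, and only then \<open>k\<close>
    above \<open>n\<close>.\<close>
  define n where "n = Max ((\<lambda>l. Max (leaves (T (K + l)))) ` leaves (S L))"
  have G_0: "cmod (h n (G L)) \<le> \<epsilon>"
  proof -
    have "cmod (h n (F i) - 0) \<le> \<epsilon>" if "i \<in> leaves (S L)" for i
      using F_0[of i n] that finite_leaves[of "S L"] by (simp add: n_def)
    then show ?thesis unfolding hG using tval_near[of "S L" "\<lambda>i. h n (F i)" 0 \<epsilon>] by simp
  qed
  define k where "k = max L (Suc n)"
  have tri: "cmod (p1 - p2 + p3 + p4 - p5) \<le> cmod p1 + cmod p2 + cmod p3 + cmod p4 + cmod p5" for p1 p2 p3 p4 p5 :: complex
    using norm_triangle_ineq4[of "p1 - p2 + p3 + p4" p5] norm_triangle_ineq[of "p1 - p2 + p3" p4]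
      norm_triangle_ineq[of "p1 - p2" p3] norm_triangle_ineq4[of p1 p2] by linarith
  have "cmod (h n (teval y (S k)) - h n (teval y (S L))) \<le> \<epsilon>" by (rule L) (auto simp: k_def)
  moreover have "cmod (h n (G k) - c) \<le> \<epsilon>" by (rule G_c) (simp add: k_def)
  moreover have "c = (h n (G k) - h n (teval y (S k)) - h n (F 0)) - (h n (G L) - h n (teval y (S L)) - h n (F 0)) +
      (h n (teval y (S k)) - h n (teval y (S L))) + h n (G L) - (h n (G k) - c)" by simp
  then have "cmod c \<le> cmod (h n (G k) - h n (teval y (S k)) - h n (F 0)) + cmod (h n (G L) - h n (teval y (S L)) - h n (F 0)) +
      cmod (h n (teval y (S k)) - h n (teval y (S L))) + cmod (h n (G L)) + cmod (h n (G k) - c)"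
    using tri by metis
  ultimately show False using Gy[of n k] Gy[of n L] G_0 c \<epsilon> by linarith
qed

theorem property_V_orlicz: "property_V X N"
  unfolding property_V_def
proof (intro allI impI)
  fix A assume "A \<subseteq> dual" and "\<forall>x. wuc_sequence X N x \<longrightarrow> (\<forall>\<epsilon>>0. \<exists>n0. \<forall>n\<ge>n0. \<forall>g\<in>A. cmod (g (x n)) \<le> \<epsilon>)"
  then have A: "V_set A" by (simp add: V_set_def)
  obtain B where B: "B \<ge> 0" "\<And>g f. g \<in> A \<Longrightarrow> f \<in> X \<Longrightarrow> cmod (g f) \<le> B * N f" using V_set_bounded[OF A] by blast
  show "rel_weakly_compact_dual X N A"
  proof (rule rel_weakly_compact_double_limit[where B = B])
    show "A \<subseteq> dual" by fact
    show "cmod (g f) \<le> B * N f" if "g \<in> A" "f \<in> X" for g f using B(2)[OF that] .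
  qed (rule V_set_no_double_limit[OF A])
qed

end

theorem mainTheorem2:
  fixes M :: "'a measure" and \<Psi> :: "real \<Rightarrow> real"
  assumes "prob_space M"
    and "\<not> purely_atomic M"
    and "orlicz_function \<Psi>"
    and "Delta2 (complementary \<Psi>)"
  shows "property_V (orlicz_space M \<Psi>) (luxemburg_norm M \<Psi>)"
proof -
  interpret prob_space M by fact
  interpret orlicz \<Psi> by unfold_locales fact
  interpret orlicz_prob \<Psi> M by unfold_locales
  obtain Q :: "real \<Rightarrow> real" and a b where "uniformly_convex_orlicz \<Psi> M Q a b"
  proof (rule uniformly_convex_equivalent[OF assms(4)])
    fix Q :: "real \<Rightarrow> real" and a b
    assume "mono Q" "\<And>x. 0 \<le> Q x" "b \<ge> 0"
      "\<And>x. x \<ge> 0 \<Longrightarrow> Q x \<le> a * \<Psi> x" "\<And>x. x \<ge> 0 \<Longrightarrow> \<Psi> (x / 2) \<le> Q x + b"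
      "\<And>u v :: complex. Q (cmod (u + v) / 2) \<le> (Q (cmod u) + Q (cmod v)) / 2"
      "\<And>\<epsilon>. \<epsilon> > 0 \<Longrightarrow> \<exists>\<delta>>0. \<forall>u v. \<epsilon> * max (cmod u) (cmod v) \<le> cmod (u - v) \<longrightarrow>
         Q (cmod (u + v) / 2) \<le> (1 - \<delta>) * ((Q (cmod u) + Q (cmod v)) / 2)"
    then have "uniformly_convex_orlicz \<Psi> M Q a b" by unfold_locales
    then show thesis by (rule that)
  qed
  then show ?thesis by (rule uniformly_convex_orlicz.property_V_orlicz)
qed

end
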